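(* For each of the following pairs (primal polytope / dual polytope) in $\mathbb{R}^3$, let $\gamma$ be a geodesic cycle on $\mathbb{S}^2$ induced by the edges of the primal polytope and let $X\subseteq\mathbb{S}^2$ be the set of vertices of the dual polytope (projected onto the sphere). Then $(\gamma,X)$ is a hybrid $s$-design on $\mathbb{S}^2$ with balancing factor $\beta$, where $s$ and $\beta$ are: (1) tetrahedron / dual tetrahedron: $s=3$, $\beta=\dfrac{4}{4+3\sqrt2\,\arccos(-\frac13)}$; (2) octahedron / cube: $s=5$, $\beta=\dfrac{9}{25}$; (3) cube / octahedron: $s=5$, $\beta=\dfrac{10\sqrt2+3\arccos(\frac13)}{10\sqrt2+35\arccos(\frac13)}$; (4) rhombic dodecahedron / cuboctahedron: $s=5$, $\beta=\dfrac{10-3\sqrt2\,\arccos(\frac1{\sqrt3})}{10+5\sqrt2\,\arccos(\frac1{\sqrt3})}$; (5) dodecahedron / icosahedron: $s=9$, $\beta=\dfrac{1190\sqrt5-675\arccos(\frac{\sqrt5}{3})}{1190\sqrt5+6237\arccos(\frac{\sqrt5}{3})}$; (6) icosahedron / dodecahedron: $s=9$, $\beta=\dfrac{126+45\arccos(\frac1{\sqrt5})}{126+301\arccos(\frac1{\sqrt5})}$; (7) rhombic triacontahedron / icosidodecahedron: $s=9$, $\beta=\dfrac{7(17\sqrt5-27)+135\,\theta}{7(17\sqrt5-27)+567\,\theta}$ with $\theta=\arccos\Big(\sqrt{\tfrac13+\tfrac{2}{3\sqrt5}}\Big)$.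
   Context: $\mathbb{S}^2$ is the unit sphere in $\mathbb{R}^3$; $\int_{\mathbb{S}^2}$ is with respect to the normalized rotation-invariant measure; $\mathrm{Pol}_{\le s}$ is the space of real polynomials of total degree at most $s$ in $3$ variables restricted to $\mathbb{S}^2$. For $x,y\in\mathbb{S}^2$, $y\ne\pm x$, the geodesic arc $\gamma_{x,y}$ is the shortest great-circle arc between them, of length $\arccos\langle x,y\rangle$. A geodesic cycle $\gamma$ is a closed chain of finitely many geodesic arcs; $\int_\gamma p$ is the sum of the arc-length integrals over the arcs and $\ell(\gamma)=\int_\gamma1$. Hybrid design: for a closed curve $\gamma$ and a finite set $X\subseteq\mathbb{S}^2$, the pair $(\gamma,X)$ is a hybrid $s$-design with balancing factor $\beta\in[0,1]$ if $\frac{\beta}{|X|}\sum_{x\in X}p(x)+\frac{1-\beta}{\ell(\gamma)}\int_\gamma p=\int_{\mathbb{S}^2}p$ for all $p\in\mathrm{Pol}_{\le s}$. Geodesic cycle induced by the edges of a polytope: each edge is projected radially onto the sphere, giving a geodesic arc; if every vertex is incident with an even number of edges, take any Euler cycle (closed walk traversing each edge exactly once); otherwise double every edge and take any Euler cycle of the doubled graph (so each arc is traversed exactly twice). Realizations of the polytopes, all vertices being taken after radial projection to $\mathbb{S}^2$ (with $\phi=\frac{1+\sqrt5}{2}$; dual pairs are realized compatibly; for regular polytopes the dual has as vertices the projected centers of the facets): - Tetrahedron: vertices $\frac1{\sqrt3}(1,1,1),\frac1{\sqrt3}(1,-1,-1),\frac1{\sqrt3}(-1,1,-1),\frac1{\sqrt3}(-1,-1,1)$,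 all pairs are edges; the dual tetrahedron has the negatives of these as vertices. - Octahedron: vertices $\pm e_1,\pm e_2,\pm e_3$; edges are the pairs with inner product $0$. - Cube: vertices $\frac1{\sqrt3}(\pm1,\pm1,\pm1)$; edges are the pairs with inner product $\frac13$. - Cuboctahedron: vertices all permutations of $\frac{1}{\sqrt2}(\pm1,\pm1,0)$. - Rhombic dodecahedron: its $14$ projected vertices are the $8$ cube vertices $\frac1{\sqrt3}(\pm1,\pm1,\pm1)$ and the $6$ octahedron vertices $\pm e_1,\pm e_2,\pm e_3$; edges are the pairs of a cube vertex and an octahedron vertex with inner product $\frac1{\sqrt3}$. - Icosahedron: vertices all even (cyclic) permutations of $\frac{1}{\sqrt{1+\phi^2}}(\pm\phi,\pm1,0)$; edges are the pairs with inner product $\frac1{\sqrt5}$. - Dodecahedron: vertices $\frac1{\sqrt3}(\pm1,\pm1,\pm1)$ and all even permutations of $\frac{1}{\sqrt3}(\pm\phi,0,\pm\phi^{-1})$; edges are the pairs with inner product $\frac{\sqrt5}{3}$. - Icosidodecahedron: vertices $\pm e_1,\pm e_2,\pm e_3$ and all even permutations of $\frac12(\pm\phi,\pm\phi^{-1},\pm1)$. - Rhombic triacontahedron: its $32$ projected vertices are the $12$ icosahedron vertices (all even permutations of $\frac{1}{\sqrt{1+\phi^2}}(\pm\phi,\pm1,0)$) and the $20$ dodecahedron vertices ($\frac1{\sqrt3}(\pm1,\pm1,\pm1)$ and all even permutations of $\frac{1}{\sqrt3}(\pm\phi,0,\pm\phi^{-1})$); edges are the pairs of an icosahedron vertex and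 a dodecahedron vertex with inner product $\sqrt{\frac13+\frac{2}{3\sqrt5}}$. *)

theory Defs
  imports "HOL-Probability.Probability" "HOL-Library.Multiset"
begin

section \<open>The sphere, its normalized rotation-invariant measure, and polynomials\<close>

abbreviation S2 :: "(real^3) set" where
  "S2 \<equiv> sphere 0 1"

text \<open>
  The normalized rotation-invariant measure on the sphere, as the law of \<open>x / norm x\<close> for \<open>x\<close>
  uniform in the unit ball (the point \<open>0\<close>, where \<open>sgn\<close> leaves the sphere, is a null set).
  The lemmas below show that it is a Borel probability measure on \<open>S2\<close> that is invariant under
  all orthogonal transformations; this determines it uniquely.
\<close>

definition sphere_measure :: "(real^3) measure" where
  "sphere_measure = restrict_space (distr (uniform_measure lborel (ball 0 1)) borel sgn) S2"

lemma sgn_borel_measurable [measurable]: "(sgn :: real^3 \<Rightarrow> real^3) \<in> borel \<rightarrow>\<^sub>M borel"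
  unfolding sgn_div_norm[abs_def] by measurable

lemma space_sphere_measure: "space sphere_measure = S2"
  by (simp add: sphere_measure_def space_restrict_space)

lemma sets_sphere_measure: "sets sphere_measure = sets (restrict_space borel S2)"
  by (simp add: sphere_measure_def sets_restrict_space)

lemma emeasure_sphere_measure:
  assumes "A \<in> sets borel" "A \<subseteq> S2"
  shows "emeasure sphere_measure A =
    emeasure lborel (ball 0 1 \<inter> sgn -` A) / emeasure lborel (ball (0::real^3) 1)"
proof -
  have m: "sgn -` A \<in> sets (borel :: (real^3) measure)"
    using measurable_sets[OF sgn_borel_measurable assms(1)] by simp
  show ?thesis
    using assms m unfolding sphere_measure_def
    by (simp add: emeasure_restrict_space emeasure_distr)
qed

lemma emeasure_unit_ball: "emeasure lborel (ball (0::real^3) 1) \<noteq> 0"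
  "emeasure lborel (ball (0::real^3) 1) \<noteq> \<infinity>"
proof -
  let ?B = "ball (0::real^3) 1"
  show fin: "emeasure lborel ?B \<noteq> \<infinity>"
    using emeasure_bounded_finite[of ?B] by (simp add: less_top[symmetric])
  have "emeasure lborel ?B = ennreal (measure lborel ?B)"
    using fin by (intro emeasure_eq_ennreal_measure) simp
  moreover have "0 < measure lborel ?B"
    by (rule content_ball_pos) simp
  ultimately show "emeasure lborel ?B \<noteq> 0"
    by simp
qed

lemma prob_space_sphere_measure: "prob_space sphere_measure"
proof
  let ?B = "ball (0::real^3) 1"
  have "?B \<inter> sgn -` S2 = ?B - {0}"
    by (auto simp: norm_sgn)
  moreover have "emeasure lborel (?B - {0}) = emeasure lborel ?B"
    by (subst emeasure_Diff) auto
  ultimately have "emeasure sphere_measure S2 = emeasure lborel ?B / emeasure lborel ?B"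
    by (subst emeasure_sphere_measure) (auto intro: borel_closed)
  also have "\<dots> = 1"
    using emeasure_unit_ball by (intro ennreal_divide_self) (auto simp: less_top)
  finally show "emeasure sphere_measure (space sphere_measure) = 1"
    by (simp add: space_sphere_measure)
qed

lemma sphere_measure_rotation_invariant:
  fixes f :: "real^3 \<Rightarrow> real^3"
  assumes f: "orthogonal_transformation f"
  shows "distr sphere_measure (restrict_space borel S2) f = sphere_measure"
proof (rule measure_eqI)
  show "sets (distr sphere_measure (restrict_space borel S2) f) = sets sphere_measure"
    by (simp add: sets_sphere_measure)
next
  have sets_iff: "B \<in> sets (restrict_space borel S2) \<longleftrightarrow> B \<subseteq> S2 \<and> B \<in> sets borel" for B
    by (rule sets_restrict_space_iff) (auto intro: borel_closed)
  fix A assume "A \<in> sets (distr sphere_measure (restrict_space borel S2) f)"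
  hence A: "A \<in> sets borel" "A \<subseteq> S2"
    by (simp_all add: sets_iff)
  have nf: "norm (f x) = norm x" for x
    using f by (simp add: orthogonal_transformation)
  have lf: "linear f"
    using f by (simp add: orthogonal_transformation_linear)
  have cf: "continuous_on UNIV f"
    using lf by (simp add: linear_continuous_on linear_linear)
  have bf [measurable]: "f \<in> borel \<rightarrow>\<^sub>M borel"
    using cf by (rule borel_measurable_continuous_onI)
  have sf: "sgn (f x) = f (sgn x)" for x
    using lf by (simp add: sgn_div_norm nf linear_scale)
  have fA: "f -` A \<in> sets borel" "f -` A \<subseteq> S2"
    using measurable_sets[OF bf A(1)] A(2) nf by auto
  have meas_f: "f \<in> sphere_measure \<rightarrow>\<^sub>M restrict_space borel S2"
    unfolding measurable_cong_sets[OF sets_sphere_measure refl]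
    by (intro measurable_restrict_space3) (auto simp: nf)
  let ?C = "ball 0 1 \<inter> sgn -` A" and ?D = "ball 0 1 \<inter> sgn -` (f -` A)"
  have C: "?C \<in> sets borel" and D: "?D \<in> sets borel"
    using measurable_sets[OF sgn_borel_measurable A(1)]
      measurable_sets[OF sgn_borel_measurable fA(1)] by auto
  have "f ` ?D = ?C"
  proof
    show "f ` ?D \<subseteq> ?C" by (auto simp: nf sf)
    show "?C \<subseteq> f ` ?D"
    proof
      fix y assume y: "y \<in> ?C"
      obtain x where "y = f x"
        using orthogonal_transformation_surj[OF f] by (metis surjD)
      with y show "y \<in> f ` ?D" by (auto simp: nf sf)
    qed
  qed
  moreover have "measure lebesgue (f ` ?D) = measure lebesgue ?D"
    by (rule measure_orthogonal_image[OF f])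
      (use D in \<open>auto intro!: bounded_set_imp_lmeasurable simp: bounded_Int\<close>)
  ultimately have "measure lborel ?C = measure lborel ?D"
    using C D by (simp add: measure_completion)
  moreover have "emeasure lborel ?C \<noteq> \<infinity>" "emeasure lborel ?D \<noteq> \<infinity>"
    using emeasure_bounded_finite[of ?C] emeasure_bounded_finite[of ?D]
    by (auto simp: bounded_Int less_top[symmetric])
  ultimately have "emeasure lborel ?C = emeasure lborel ?D"
    by (simp add: emeasure_eq_ennreal_measure)
  thus "emeasure (distr sphere_measure (restrict_space borel S2) f) A = emeasure sphere_measure A"
    using A fA meas_f
    by (subst emeasure_distr)
      (auto simp: space_sphere_measure emeasure_sphere_measure sets_iff Int_absorb2)
qed

text \<open>
  Functions that agree on the sphere with a polynomial of total degree at most \<open>s\<close>.  Their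
  values off the sphere are arbitrary and play no role below.
\<close>

definition Pol :: "nat \<Rightarrow> (real^3 \<Rightarrow> real) set" where
  "Pol s = {p. \<exists>c :: nat \<Rightarrow> nat \<Rightarrow> nat \<Rightarrow> real. \<forall>x\<in>S2.
     p x = (\<Sum>i\<le>s. \<Sum>j\<le>s-i. \<Sum>k\<le>s-i-j. c i j k * x$1 ^ i * x$2 ^ j * x$3 ^ k)}"


section \<open>Geodesic cycles and hybrid designs\<close>

text \<open>
  For \<open>x, y \<in> S2\<close> with \<open>y \<noteq> x\<close> and \<open>y \<noteq> -x\<close>, the restriction to \<open>{0..arccos (x \<bullet> y)}\<close> is the
  arc-length parametrization of the shortest great-circle arc from \<open>x\<close> to \<open>y\<close>.
\<close>

definition geodesic_arc :: "real^3 \<Rightarrow> real^3 \<Rightarrow> real \<Rightarrow> real^3" where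
  "geodesic_arc x y t = cos t *\<^sub>R x + sin t *\<^sub>R sgn (y - (x \<bullet> y) *\<^sub>R x)"

lemma geodesic_arc:
  assumes "x \<in> S2" "y \<in> S2" "y \<noteq> x" "y \<noteq> - x"
  shows "geodesic_arc x y 0 = x"
    and "geodesic_arc x y (arccos (x \<bullet> y)) = y"
    and "geodesic_arc x y t \<in> S2"
    and "(geodesic_arc x y has_vector_derivative
           (- sin t *\<^sub>R x + cos t *\<^sub>R sgn (y - (x \<bullet> y) *\<^sub>R x))) (at t)"
    and "norm (- sin t *\<^sub>R x + cos t *\<^sub>R sgn (y - (x \<bullet> y) *\<^sub>R x)) = 1"
proof -
  define c where "c = x \<bullet> y"
  define w where "w = y - c *\<^sub>R x"
  have xx: "x \<bullet> x = 1" and yy: "y \<bullet> y = 1"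
    using assms by (auto simp: dot_square_norm)
  have ww: "w \<bullet> w = 1 - c\<^sup>2"
    by (simp add: w_def inner_diff xx yy c_def[symmetric] inner_commute[of y x] power2_eq_square)
  have xw: "x \<bullet> w = 0"
    by (simp add: w_def inner_diff xx c_def)
  have "w \<noteq> 0"
  proof
    assume "w = 0"
    hence "y = c *\<^sub>R x" "c\<^sup>2 = 1" using ww by (auto simp: w_def)
    with assms show False by (auto simp: power2_eq_1_iff)
  qed
  hence u: "sgn w \<bullet> sgn w = 1" "x \<bullet> sgn w = 0" "sgn w \<bullet> x = 0"
    using xw by (auto simp: dot_square_norm norm_sgn sgn_div_norm inner_commute)
  have c: "-1 \<le> c" "c \<le> 1"
    using ww inner_ge_zero[of w] by (auto simp: abs_square_le_1 abs_le_iff)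
  have nw: "norm w = sqrt (1 - c\<^sup>2)"
    by (simp add: norm_eq_sqrt_inner ww)
  have unit: "(a *\<^sub>R x + b *\<^sub>R sgn w) \<bullet> (a *\<^sub>R x + b *\<^sub>R sgn w) = a\<^sup>2 + b\<^sup>2" for a b
    by (simp add: inner_add u xx power2_eq_square)
  show "geodesic_arc x y 0 = x"
    by (simp add: geodesic_arc_def)
  show "geodesic_arc x y (arccos (x \<bullet> y)) = y"
    using c \<open>w \<noteq> 0\<close> unfolding geodesic_arc_def c_def[symmetric] w_def[symmetric]
    by (simp add: sin_arccos nw[symmetric] sgn_div_norm) (simp add: w_def)
  show "geodesic_arc x y t \<in> S2"
    using unit[of "cos t" "sin t"]
    unfolding geodesic_arc_def c_def[symmetric] w_def[symmetric] by (simp add: norm_eq_sqrt_inner)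
  show "norm (- sin t *\<^sub>R x + cos t *\<^sub>R sgn (y - (x \<bullet> y) *\<^sub>R x)) = 1"
    using unit[of "- sin t" "cos t"]
    unfolding c_def[symmetric] w_def[symmetric] by (simp add: norm_eq_sqrt_inner)
  show "(geodesic_arc x y has_vector_derivative
           (- sin t *\<^sub>R x + cos t *\<^sub>R sgn (y - (x \<bullet> y) *\<^sub>R x))) (at t)"
    unfolding geodesic_arc_def[abs_def] has_vector_derivative_def
    by (auto intro!: derivative_eq_intros simp: algebra_simps)
qed

definition arc_integral :: "real^3 \<Rightarrow> real^3 \<Rightarrow> (real^3 \<Rightarrow> real) \<Rightarrow> real" where
  "arc_integral x y p = integral {0..arccos (x \<bullet> y)} (\<lambda>t. p (geodesic_arc x y t))"

text \<open>
  A closed walk is the list \<open>[v0, v1, ..., vn]\<close> of the points it visits, with \<open>vn = v0\<close>.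
\<close>

definition steps :: "'a list \<Rightarrow> ('a \<times> 'a) list" where
  "steps vs = zip vs (tl vs)"

definition geodesic_cycle :: "(real^3) list \<Rightarrow> bool" where
  "geodesic_cycle \<gamma> \<longleftrightarrow> 2 \<le> length \<gamma> \<and> hd \<gamma> = last \<gamma> \<and>
     (\<forall>(x, y) \<in> set (steps \<gamma>). x \<in> S2 \<and> y \<in> S2 \<and> y \<noteq> x \<and> y \<noteq> - x)"

definition cycle_integral :: "(real^3) list \<Rightarrow> (real^3 \<Rightarrow> real) \<Rightarrow> real" where
  "cycle_integral \<gamma> p = (\<Sum>(x, y)\<leftarrow>steps \<gamma>. arc_integral x y p)"

definition cycle_length :: "(real^3) list \<Rightarrow> real" where
  "cycle_length \<gamma> = cycle_integral \<gamma> (\<lambda>_. 1)"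

definition hybrid_design :: "nat \<Rightarrow> real \<Rightarrow> (real^3) list \<Rightarrow> (real^3) set \<Rightarrow> bool" where
  "hybrid_design s \<beta> \<gamma> X \<longleftrightarrow>
     geodesic_cycle \<gamma> \<and> finite X \<and> X \<noteq> {} \<and> X \<subseteq> S2 \<and> 0 \<le> \<beta> \<and> \<beta> \<le> 1 \<and>
     (\<forall>p\<in>Pol s. \<beta> / real (card X) * (\<Sum>x\<in>X. p x) + (1 - \<beta>) / cycle_length \<gamma> * cycle_integral \<gamma> p
        = integral\<^sup>L sphere_measure p)"


section \<open>Euler cycles and geodesic cycles induced by edges\<close>

text \<open>
  Edges are two-element sets; \<open>M\<close> is the multiset of edges of a multigraph, so an Euler cycle
  traverses every edge exactly as often as it occurs in \<open>M\<close>.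
\<close>

definition euler_cycle :: "'a set multiset \<Rightarrow> 'a list \<Rightarrow> bool" where
  "euler_cycle M \<gamma> \<longleftrightarrow> \<gamma> \<noteq> [] \<and> hd \<gamma> = last \<gamma> \<and>
     mset (map (\<lambda>(x, y). {x, y}) (steps \<gamma>)) = M"

definition induced_cycle :: "'a set \<Rightarrow> 'a set set \<Rightarrow> 'a list \<Rightarrow> bool" where
  "induced_cycle V E \<gamma> \<longleftrightarrow>
     euler_cycle (if \<forall>v\<in>V. even (card {e\<in>E. v \<in> e}) then mset_set E else mset_set E + mset_set E) \<gamma>"


section \<open>The polytopes\<close>

definition pm :: "real \<Rightarrow> real set" where
  "pm a = {a, - a}"

definition triples :: "real set \<Rightarrow> real set \<Rightarrow> real set \<Rightarrow> (real^3) set" where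
  "triples A B C = {vector [a, b, c] | a b c. a \<in> A \<and> b \<in> B \<and> c \<in> C}"

definition even_perms :: "real set \<Rightarrow> real set \<Rightarrow> real set \<Rightarrow> (real^3) set" where
  "even_perms A B C = triples A B C \<union> triples B C A \<union> triples C A B"

definition all_perms :: "real set \<Rightarrow> real set \<Rightarrow> real set \<Rightarrow> (real^3) set" where
  "all_perms A B C = even_perms A B C \<union> even_perms B A C"

definition \<phi> :: real where
  "\<phi> = (1 + sqrt 5) / 2"

definition tetrahedron :: "(real^3) set" where
  "tetrahedron = (*\<^sub>R) (1 / sqrt 3) `
     {vector [1, 1, 1], vector [1, -1, -1], vector [-1, 1, -1], vector [-1, -1, 1]}"

definition dual_tetrahedron :: "(real^3) set" where
  "dual_tetrahedron = uminus ` tetrahedron"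

definition octahedron :: "(real^3) set" where
  "octahedron = {\<epsilon> *\<^sub>R axis i 1 | \<epsilon> i. \<epsilon> \<in> pm 1}"

definition cube :: "(real^3) set" where
  "cube = (*\<^sub>R) (1 / sqrt 3) ` triples (pm 1) (pm 1) (pm 1)"

definition cuboctahedron :: "(real^3) set" where
  "cuboctahedron = (*\<^sub>R) (1 / sqrt 2) ` all_perms (pm 1) (pm 1) {0}"

definition rhombic_dodecahedron :: "(real^3) set" where
  "rhombic_dodecahedron = cube \<union> octahedron"

definition icosahedron :: "(real^3) set" where
  "icosahedron = (*\<^sub>R) (1 / sqrt (1 + \<phi>\<^sup>2)) ` even_perms (pm \<phi>) (pm 1) {0}"

definition dodecahedron :: "(real^3) set" where
  "dodecahedron = cube \<union> (*\<^sub>R) (1 / sqrt 3) ` even_perms (pm \<phi>) {0} (pm (1 / \<phi>))"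

definition icosidodecahedron :: "(real^3) set" where
  "icosidodecahedron = octahedron \<union> (*\<^sub>R) (1 / 2) ` even_perms (pm \<phi>) (pm (1 / \<phi>)) (pm 1)"

definition rhombic_triacontahedron :: "(real^3) set" where
  "rhombic_triacontahedron = icosahedron \<union> dodecahedron"

definition pairs_with_inner :: "(real^3) set \<Rightarrow> (real^3) set \<Rightarrow> real \<Rightarrow> (real^3) set set" where
  "pairs_with_inner V W c = {{x, y} | x y. x \<in> V \<and> y \<in> W \<and> x \<bullet> y = c}"

definition tetrahedron_edges :: "(real^3) set set" where
  "tetrahedron_edges = {{x, y} | x y. x \<in> tetrahedron \<and> y \<in> tetrahedron \<and> x \<noteq> y}"

definition octahedron_edges :: "(real^3) set set" where
  "octahedron_edges = pairs_with_inner octahedron octahedron 0"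

definition cube_edges :: "(real^3) set set" where
  "cube_edges = pairs_with_inner cube cube (1 / 3)"

definition rhombic_dodecahedron_edges :: "(real^3) set set" where
  "rhombic_dodecahedron_edges = pairs_with_inner cube octahedron (1 / sqrt 3)"

definition icosahedron_edges :: "(real^3) set set" where
  "icosahedron_edges = pairs_with_inner icosahedron icosahedron (1 / sqrt 5)"

definition dodecahedron_edges :: "(real^3) set set" where
  "dodecahedron_edges = pairs_with_inner dodecahedron dodecahedron (sqrt 5 / 3)"

definition rhombic_triacontahedron_edges :: "(real^3) set set" where
  "rhombic_triacontahedron_edges =
     pairs_with_inner icosahedron dodecahedron (sqrt (1 / 3 + 2 / (3 * sqrt 5)))"

end

theory Submission
  imports Defs
begin

text \<open>
  Subtract the right-hand side of the design identity from the left-hand side.  This gives a linear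
  functional of \<open>p\<close>, the \<^emph>\<open>defect\<close>, which has to vanish for all polynomials of the given degree.

  An Euler cycle runs through all edges equally often, once or twice, and all edges of one polytope
  give arcs of the same length.  So the mean value of \<open>p\<close> along \<open>\<gamma>\<close> is the mean value over the set of
  edges, whatever Euler cycle was chosen, and the defect is invariant under every orthogonal map
  that preserves the vertices of the two polytopes.

  An invariant functional is determined by its values on invariant polynomials, and there are few
  of these.  On the sphere, the invariant polynomials of the degrees in question are spanned by the
  constant \<open>1\<close> and one form: \<open>x y z\<close> for the tetrahedron (degree at most 3),
  \<open>x^4 + y^4 + z^4\<close> for the octahedral family (degree at most 5), and the sum of the sixth powers of
  the linear forms along the six axes of the icosahedron for the icosahedral family (degree at most
  9).  The lemmas \<open>L_Pol_3_eq_0\<close>, \<open>L_Pol_5_eq_0\<close> and \<open>L_Pol_9_eq_0\<close> express this as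
  linear algebra with the values of the functional on monomials.

  The defect of \<open>1\<close> is \<open>0\<close> for every balancing factor, so \<open>\<beta>\<close> only has to annihilate the one
  remaining form; this condition is linear in \<open>\<beta>\<close> and determines it.  The form is constant on \<open>X\<close>,
  and since the symmetries act transitively on the edges, its mean value along \<open>\<gamma>\<close> can be read
  off one arc.  That arc is chosen on a great circle in a mirror plane, where the form is an even
  trigonometric polynomial with an elementary primitive.  The mean value of the form on the sphere
  is a consequence of the rotation invariance of the measure alone.
\<close>

section \<open>The golden ratio\<close>

lemma phi_square: "\<phi>\<^sup>2 = \<phi> + 1"
  by (simp add: \<phi>_def power2_eq_square field_simps)

lemma phi_gt: "\<phi> > 1.6"
proof -
  have "sqrt 5 > 2.2" by (rule real_less_rsqrt) (simp add: power2_eq_square)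
  thus ?thesis by (simp add: \<phi>_def)
qed

lemma phi_less: "\<phi> < 1.7"
proof -
  have "sqrt 5 < 2.4" by (rule real_less_lsqrt) (simp_all add: power2_eq_square)
  thus ?thesis by (simp add: \<phi>_def)
qed

lemma inverse_phi: "1 / \<phi> = \<phi> - 1"
  using phi_square phi_gt by (simp add: field_simps power2_eq_square)

lemma phi_powers: "\<phi> ^ 2 = \<phi> + 1" "\<phi> ^ 3 = 2 * \<phi> + 1" "\<phi> ^ 4 = 3 * \<phi> + 2"
   "\<phi> ^ 5 = 5 * \<phi> + 3" "\<phi> ^ 6 = 8 * \<phi> + 5" "\<phi> ^ 7 = 13 * \<phi> + 8" "\<phi> ^ 8 = 21 * \<phi> + 13"
proof -
  show 2: "\<phi> ^ 2 = \<phi> + 1" by (rule phi_square)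
  have s: "\<phi> ^ Suc n = \<phi> * \<phi> ^ n" for n by simp
  show 3: "\<phi> ^ 3 = 2 * \<phi> + 1" using s[of 2] 2 by (simp add: algebra_simps power2_eq_square)
  show 4: "\<phi> ^ 4 = 3 * \<phi> + 2" using s[of 3] 2 3 by (simp add: algebra_simps power2_eq_square)
  show 5: "\<phi> ^ 5 = 5 * \<phi> + 3" using s[of 4] 2 4 by (simp add: algebra_simps power2_eq_square)
  show 6: "\<phi> ^ 6 = 8 * \<phi> + 5" using s[of 5] 2 5 by (simp add: algebra_simps power2_eq_square)
  show 7: "\<phi> ^ 7 = 13 * \<phi> + 8" using s[of 6] 2 6 by (simp add: algebra_simps power2_eq_square)
  show "\<phi> ^ 8 = 21 * \<phi> + 13" using s[of 7] 2 7 by (simp add: algebra_simps power2_eq_square)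
qed

lemma phi_mult: "\<phi> * \<phi> = \<phi> + 1" "\<phi> * (\<phi> * x) = \<phi> * x + x"
  using phi_square by (simp_all add: power2_eq_square algebra_simps flip: mult.assoc)

lemma phi_conj_powers: "(1 - \<phi>) ^ 2 = 2 - \<phi>" "(1 - \<phi>) ^ 4 = 5 - 3 * \<phi>"
  "(1 - \<phi>) ^ 6 = 13 - 8 * \<phi>" "(1 - \<phi>) ^ 8 = 34 - 21 * \<phi>"
proof -
  show 2: "(1 - \<phi>) ^ 2 = 2 - \<phi>" by (simp add: power2_eq_square algebra_simps phi_mult)
  have s: "(1 - \<phi>) ^ (n + 2) = (1 - \<phi>) ^ n * (2 - \<phi>)" for n
     unfolding power_add 2 by simp
  show 4: "(1 - \<phi>) ^ 4 = 5 - 3 * \<phi>" using s[of 2] 2 by (simp add: algebra_simps phi_mult)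
  show 6: "(1 - \<phi>) ^ 6 = 13 - 8 * \<phi>" using s[of 4] 4 by (simp add: algebra_simps phi_mult)
  show "(1 - \<phi>) ^ 8 = 34 - 21 * \<phi>" using s[of 6] 6 by (simp add: algebra_simps phi_mult)
qed

lemma sqrt_5_eq: "sqrt 5 = 2 * \<phi> - 1"
  by (simp add: \<phi>_def field_simps)

section \<open>Invariant linear functionals\<close>

definition monomial :: "nat \<Rightarrow> nat \<Rightarrow> nat \<Rightarrow> real^3 \<Rightarrow> real" where
  "monomial i j k x = x$1 ^ i * x$2 ^ j * x$3 ^ k"

lemma continuous_on_monomial [continuous_intros]: "continuous_on A (monomial i j k)"
  unfolding monomial_def[abs_def] by (intro continuous_intros)

lemma S2_sum_squares: "x \<in> S2 \<Longrightarrow> (x$1)\<^sup>2 + (x$2)\<^sup>2 + (x$3)\<^sup>2 = 1"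
  by (simp add: norm_vec_def L2_set_def sum_3)

text \<open>
  Additivity is only required for continuous functions, because it fails for integrals of functions
  that are not integrable.
\<close>

locale continuous_functional =
  fixes L :: "(real^3 \<Rightarrow> real) \<Rightarrow> real"
  assumes L_cong: "(\<And>x. x \<in> S2 \<Longrightarrow> p x = q x) \<Longrightarrow> L p = L q"
    and L_add: "continuous_on S2 p \<Longrightarrow> continuous_on S2 q \<Longrightarrow> L (\<lambda>x. p x + q x) = L p + L q"
    and L_scale: "continuous_on S2 p \<Longrightarrow> L (\<lambda>x. a * p x) = a * L p"
begin

lemma L_zero: "L (\<lambda>x. 0) = 0"
  using L_scale[of "\<lambda>x. 0" 0] by simp

lemma L_sum:
  assumes "finite A" "\<And>i. i \<in> A \<Longrightarrow> continuous_on S2 (f i)"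
  shows "L (\<lambda>x. \<Sum>i\<in>A. f i x) = (\<Sum>i\<in>A. L (f i))"
  using assms by (induction A) (simp_all add: L_zero L_add continuous_on_sum)

lemma L_Pol_eq_0:
  assumes p: "p \<in> Pol s" and 0: "\<And>i j k. i + j + k \<le> s \<Longrightarrow> L (monomial i j k) = 0"
  shows "L p = 0"
proof -
  obtain c :: "nat \<Rightarrow> nat \<Rightarrow> nat \<Rightarrow> real" where c: "\<forall>x\<in>S2. p x =
      (\<Sum>i\<le>s. \<Sum>j\<le>s-i. \<Sum>k\<le>s-i-j. c i j k * x$1 ^ i * x$2 ^ j * x$3 ^ k)"
    using p by (auto simp: Pol_def)
  have "L p = L (\<lambda>x. \<Sum>i\<le>s. \<Sum>j\<le>s-i. \<Sum>k\<le>s-i-j. c i j k * monomial i j k x)"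
    by (rule L_cong) (simp add: c monomial_def mult.assoc)
  also have "\<dots> = (\<Sum>i\<le>s. \<Sum>j\<le>s-i. \<Sum>k\<le>s-i-j. c i j k * L (monomial i j k))"
    by (simp add: L_sum L_scale continuous_intros)
  also have "\<dots> = 0"
    by (intro sum.neutral ballI) (simp add: 0)
  finally show ?thesis .
qed

text \<open>
  On the sphere a polynomial may be multiplied by \<open>x\<^sup>2 + y\<^sup>2 + z\<^sup>2 = 1\<close>.  Hence the values in the
  top degree determine those in all lower degrees of the same parity.
\<close>

lemma L_sphere_relation:
  "L (monomial i j k) =
    L (monomial (i + 2) j k) + L (monomial i (j + 2) k) + L (monomial i j (k + 2))"
proof -
  have "L (monomial i j k) =
      L (\<lambda>x. monomial (i + 2) j k x + (monomial i (j + 2) k x + monomial i j (k + 2) x))"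
  proof (rule L_cong)
    fix x assume "x \<in> S2"
    have "monomial i j k x = monomial i j k x * ((x$1)\<^sup>2 + (x$2)\<^sup>2 + (x$3)\<^sup>2)"
      by (simp add: S2_sum_squares[OF \<open>x \<in> S2\<close>])
    also have "\<dots> =
        monomial (i + 2) j k x + (monomial i (j + 2) k x + monomial i j (k + 2) x)"
      by (simp add: monomial_def power_add algebra_simps power2_eq_square)
    finally show "monomial i j k x =
        monomial (i + 2) j k x + (monomial i (j + 2) k x + monomial i j (k + 2) x)" .
  qed
  thus ?thesis
    by (simp add: L_add continuous_intros)
qed

lemma L_linear_form_power:
  "L (\<lambda>x. (a * x$1 + b * x$2 + c * x$3) ^ n) =
    (\<Sum>i\<le>n. \<Sum>j\<le>n-i. real (n choose i) * real (n - i choose j) * a ^ i * b ^ j * c ^ (n - i - j) *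
      L (monomial i j (n - i - j)))"
proof -
  have "L (\<lambda>x. (a * x$1 + b * x$2 + c * x$3) ^ n) =
    L (\<lambda>x. \<Sum>i\<le>n. \<Sum>j\<le>n-i. (real (n choose i) * real (n - i choose j) * a ^ i * b ^ j *
      c ^ (n - i - j)) * monomial i j (n - i - j) x)"
    by (rule L_cong)
      (simp add: add.assoc binomial_ring[of "a * _"] binomial_ring[of "b * _"] sum_distrib_left
        sum_distrib_right monomial_def power_mult_distrib mult_ac)
  also have "\<dots> = (\<Sum>i\<le>n. \<Sum>j\<le>n-i. (real (n choose i) * real (n - i choose j) * a ^ i * b ^ j *
      c ^ (n - i - j)) * L (monomial i j (n - i - j)))"
    by (simp add: L_sum L_scale continuous_intros)
  finally show ?thesis .
qed

end

text \<open>
  The maps \<open>flip\<close> and \<open>cyc\<close> generate the pyritohedral group: all changes of signs combined with the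
  cyclic permutations of the coordinates.  It is contained in the symmetry groups of the cube and of
  the icosahedron in their present position.  Replacing \<open>flip\<close> by \<open>half_turn\<close> gives the rotation group
  of the tetrahedron.
\<close>

definition flip :: "real^3 \<Rightarrow> real^3" where
  "flip x = vector [- x$1, x$2, x$3]"

definition cyc :: "real^3 \<Rightarrow> real^3" where
  "cyc x = vector [x$2, x$3, x$1]"

definition half_turn :: "real^3 \<Rightarrow> real^3" where
  "half_turn x = vector [- x$1, - x$2, x$3]"

lemma vec3_eq_iff: "(x :: 'a^3) = y \<longleftrightarrow> x$1 = y$1 \<and> x$2 = y$2 \<and> x$3 = y$3"
  by (simp add: vec_eq_iff forall_3)

lemma inner3: "(x :: real^3) \<bullet> y = x$1 * y$1 + x$2 * y$2 + x$3 * y$3"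
  by (simp add: inner_vec_def sum_3)

lemma orthogonal_transformation3I:
  fixes g :: "real^3 \<Rightarrow> real^3"
  assumes "\<And>x y. g (x + y) = g x + g y" "\<And>a x. g (a *\<^sub>R x) = a *\<^sub>R g x"
    "\<And>x. g x \<bullet> g x = x \<bullet> x"
  shows "orthogonal_transformation g"
  unfolding orthogonal_transformation using assms by (auto intro!: linearI simp: norm_eq_sqrt_inner)

lemma flip_orthogonal: "orthogonal_transformation flip"
  by (rule orthogonal_transformation3I) (simp_all add: flip_def vec3_eq_iff inner3)

lemma cyc_orthogonal: "orthogonal_transformation cyc"
  by (rule orthogonal_transformation3I) (simp_all add: cyc_def vec3_eq_iff inner3)

lemma half_turn_orthogonal: "orthogonal_transformation half_turn"
  by (rule orthogonal_transformation3I) (simp_all add: half_turn_def vec3_eq_iff inner3)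

locale cyclic_functional = continuous_functional +
  assumes cyc_invariant: "continuous_on S2 p \<Longrightarrow> L (\<lambda>x. p (cyc x)) = L p"
begin

lemma L_monomial_cyc: "L (monomial i j k) = L (monomial k i j)"
  using cyc_invariant[of "monomial i j k", OF continuous_on_monomial]
  by (simp add: monomial_def[abs_def] cyc_def mult_ac)

lemma L_1: "L (\<lambda>_. 1) = L (monomial 0 0 0)"
  by (simp add: monomial_def[abs_def])

lemma L_degree_2: "L (monomial 2 0 0) = L (\<lambda>_. 1) / 3"
  using L_sphere_relation[of 0 0 0] L_monomial_cyc[of 0 2 0] L_monomial_cyc[of 0 0 2]
  by (simp add: L_1 flip: numeral_2_eq_2)

end

locale tetrahedral_functional = cyclic_functional +
  assumes half_turn_invariant: "continuous_on S2 p \<Longrightarrow> L (\<lambda>x. p (half_turn x)) = L p"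
begin

lemma L_monomial_odd_pair:
  assumes "odd (i + j) \<or> odd (j + k) \<or> odd (k + i)"
  shows "L (monomial i j k) = 0"
proof -
  have *: "L (monomial i j k) = 0" if "odd (i + j)" for i j k
  proof -
    have "monomial i j k (half_turn x) = (-1) * monomial i j k x" for x
      using that by (auto simp: monomial_def half_turn_def)
    hence "L (monomial i j k) = L (\<lambda>x. (-1) * monomial i j k x)"
      using half_turn_invariant[of "monomial i j k", OF continuous_on_monomial] by presburger
    also have "\<dots> = - L (monomial i j k)"
      by (subst L_scale) (simp_all add: continuous_intros)
    finally show ?thesis by simp
  qed
  show ?thesis
    using assms *[of i j k] *[of j k i] *[of k i j] L_monomial_cyc[of i j k] L_monomial_cyc[of j k i]
    by metis
qed

text \<open>
  The half turns leave only exponents of equal parity.  Up to degree 3 these are the constant, the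
  squares, which the cyclic symmetry reduces to the constant, and \<open>x y z\<close>.
\<close>

lemma L_Pol_3_eq_0:
  assumes 0: "L (\<lambda>_. 1) = 0" "L (monomial 1 1 1) = 0" and p: "p \<in> Pol 3"
  shows "L p = 0"
proof (rule L_Pol_eq_0[OF p])
  fix i j k :: nat assume le: "i + j + k \<le> 3"
  show "L (monomial i j k) = 0"
  proof (cases "even (i + j) \<and> even (j + k)")
    case False thus ?thesis using L_monomial_odd_pair by blast
  next
    case True
    have z: "L (monomial 0 0 0) = 0" "L (monomial 2 0 0) = 0" "L (monomial (Suc 0) (Suc 0) (Suc 0)) = 0"
      using 0 L_degree_2 by (simp_all add: L_1)
    have z1: "L (monomial 0 2 0) = 0" "L (monomial 0 0 2) = 0"
      using z(2) L_monomial_cyc by metis+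
    have "i \<in> {0,1,2,3}" "j \<in> {0,1,2,3}" "k \<in> {0,1,2,3}" using le by auto
    thus ?thesis using le True by (elim insertE emptyE; simp add: z z1)
  qed
qed

end

locale pyritohedral_functional = cyclic_functional +
  assumes flip_invariant: "continuous_on S2 p \<Longrightarrow> L (\<lambda>x. p (flip x)) = L p"
begin

lemma L_monomial_odd:
  assumes "odd i \<or> odd j \<or> odd k"
  shows "L (monomial i j k) = 0"
proof -
  have *: "L (monomial i j k) = 0" if "odd i" for i j k
  proof -
    have "L (monomial i j k) = L (\<lambda>x. (-1) * monomial i j k x)"
      using flip_invariant[of "monomial i j k", OF continuous_on_monomial] that
      by (simp add: monomial_def[abs_def] flip_def)
    also have "\<dots> = - L (monomial i j k)"
      by (subst L_scale) (simp_all add: continuous_intros)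
    finally show ?thesis by simp
  qed
  show ?thesis
    using assms *[of i j k] *[of j k i] *[of k i j] L_monomial_cyc[of i j k] L_monomial_cyc[of j k i]
    by metis
qed

text \<open>
  In degrees 4, 6 and 8 the surviving monomials form 2, 4 and 5 classes under cyclic permutation.
  The swap of two coordinates is not available, so that for instance \<open>x\<^sup>4 y\<^sup>2\<close> and \<open>x\<^sup>2 y\<^sup>4\<close> have to be
  kept apart.
\<close>

lemma L_degree_4_relation:
  "L (monomial 2 0 0) = L (monomial 4 0 0) + 2 * L (monomial 2 2 0)"
  using L_sphere_relation[of 2 0 0] L_monomial_cyc[of 2 0 2] by (simp flip: numeral_2_eq_2)

lemma L_degree_6_relations:
  "L (monomial 4 0 0) = L (monomial 6 0 0) + L (monomial 4 2 0) + L (monomial 2 4 0)"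
  "L (monomial 2 2 0) = L (monomial 4 2 0) + L (monomial 2 4 0) + L (monomial 2 2 2)"
  using L_sphere_relation[of 4 0 0] L_sphere_relation[of 2 2 0]  L_monomial_cyc[of 2 4 0]
     L_monomial_cyc[of 0 2 4] by (simp_all flip: numeral_2_eq_2)

lemma L_degree_8_relations:
  "L (monomial 6 0 0) = L (monomial 8 0 0) + L (monomial 6 2 0) + L (monomial 2 6 0)"
  "L (monomial 4 2 0) = L (monomial 6 2 0) + L (monomial 4 4 0) + L (monomial 4 2 2)"
  "L (monomial 2 4 0) = L (monomial 4 4 0) + L (monomial 2 6 0) + L (monomial 4 2 2)"
  "L (monomial 2 2 2) = 3 * L (monomial 4 2 2)"
  using L_sphere_relation[of 6 0 0] L_sphere_relation[of 4 2 0] L_sphere_relation[of 2 4 0]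
     L_sphere_relation[of 2 2 2] L_monomial_cyc[of 0 2 6]  L_monomial_cyc[of 2 6 0]
     L_monomial_cyc[of 2 4 2] L_monomial_cyc[of 4 2 2] by (simp_all flip: numeral_2_eq_2)

end

lemma choose_values: "8 choose 2 = (28::nat)" "8 choose 4 = (70::nat)" "8 choose 6 = (28::nat)"
  "6 choose 2 = (15::nat)" "6 choose 4 = (15::nat)" "4 choose 2 = (6::nat)"
  by (simp_all add: eval_nat_numeral)

lemma atMost_values: "{..(8::nat)} = {0,1,2,3,4,5,6,7,8}" "{..(7::nat)} = {0,1,2,3,4,5,6,7}"
  "{..(6::nat)} = {0,1,2,3,4,5,6}" "{..(5::nat)} = {0,1,2,3,4,5}" "{..(4::nat)} = {0,1,2,3,4}"
  "{..(3::nat)} = {0,1,2,3}" "{..(2::nat)} = {0,1,2}" "{..Suc 0} = {0,1}"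
  by auto

context pyritohedral_functional begin

text \<open>
  The multinomial expansions express the values on powers of arbitrary linear forms.  They serve
  twice: a further symmetry that maps one linear form to another becomes a linear relation between
  the values on monomials, and so does the rotation invariance of the measure on the sphere.
\<close>

lemma L_linear_form_power_4:
  "L (\<lambda>x. (a * x$1 + b * x$2 + c * x$3) ^ 4) =
    (a^4 + b^4 + c^4) * L (monomial 4 0 0) +
    6 * (a^2 * b^2 + b^2 * c^2 + c^2 * a^2) * L (monomial 2 2 0)"
  unfolding L_linear_form_power
  using L_monomial_cyc[of 0 0 4] L_monomial_cyc[of 0 4 0] L_monomial_cyc[of 2 0 2] L_monomial_cyc[of 0 2 2]
  by (simp add: atMost_values L_monomial_odd choose_values) (simp add: algebra_simps)

lemma L_linear_form_power_6:
  "L (\<lambda>x. (a * x$1 + b * x$2 + c * x$3) ^ 6) =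
    (a^6 + b^6 + c^6) * L (monomial 6 0 0) +
    15 * (a^4 * b^2 + b^4 * c^2 + c^4 * a^2) * L (monomial 4 2 0) +
    15 * (a^2 * b^4 + b^2 * c^4 + c^2 * a^4) * L (monomial 2 4 0) +
    90 * (a^2 * b^2 * c^2) * L (monomial 2 2 2)"
  unfolding L_linear_form_power
  using L_monomial_cyc[of 0 0 6] L_monomial_cyc[of 0 6 0]
      L_monomial_cyc[of 4 2 0] L_monomial_cyc[of 0 4 2] L_monomial_cyc[of 2 0 4]
      L_monomial_cyc[of 2 4 0] L_monomial_cyc[of 0 2 4] L_monomial_cyc[of 4 0 2]
  by (simp add: atMost_values L_monomial_odd choose_values) (simp add: algebra_simps)

lemma L_linear_form_power_8:
  "L (\<lambda>x. (a * x$1 + b * x$2 + c * x$3) ^ 8) =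
    (a^8 + b^8 + c^8) * L (monomial 8 0 0) +
    28 * (a^6 * b^2 + b^6 * c^2 + c^6 * a^2) * L (monomial 6 2 0) +
    28 * (a^2 * b^6 + b^2 * c^6 + c^2 * a^6) * L (monomial 2 6 0) +
    70 * (a^4 * b^4 + b^4 * c^4 + c^4 * a^4) * L (monomial 4 4 0) +
    420 * (a^4 * b^2 * c^2 + a^2 * b^4 * c^2 + a^2 * b^2 * c^4) * L (monomial 4 2 2)"
  unfolding L_linear_form_power
  using L_monomial_cyc[of 0 0 8] L_monomial_cyc[of 0 8 0]
      L_monomial_cyc[of 0 6 2] L_monomial_cyc[of 2 0 6]
      L_monomial_cyc[of 0 2 6] L_monomial_cyc[of 6 0 2]
      L_monomial_cyc[of 0 4 4] L_monomial_cyc[of 4 0 4]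
      L_monomial_cyc[of 2 4 2] L_monomial_cyc[of 2 2 4]
  by (simp add: atMost_values L_monomial_odd choose_values) (simp add: algebra_simps)

lemma L_monomial_rotations:
  "L (monomial j k i) = L (monomial i j k)" "L (monomial k i j) = L (monomial i j k)"
  using L_monomial_cyc by metis+

text \<open>
  Cyclic symmetry makes the three values on \<open>x\<^sup>2 y\<^sup>2\<close>, \<open>y\<^sup>2 z\<^sup>2\<close>, \<open>z\<^sup>2 x\<^sup>2\<close> equal, so they are determined by the
  values on \<open>1\<close> and \<open>x\<^sup>4\<close>, and nothing else survives up to degree 5.
\<close>

lemma L_Pol_5_eq_0:
  assumes 1: "L (\<lambda>_. 1) = 0" and 4: "L (monomial 4 0 0) = 0"  and p: "p \<in> Pol 5"
  shows "L p = 0"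
proof (rule L_Pol_eq_0[OF p])
  fix i j k :: nat assume le: "i + j + k \<le> 5"
  show "L (monomial i j k) = 0"
  proof (cases "even i \<and> even j \<and> even k")
    case False thus ?thesis using L_monomial_odd by blast
  next
    case True
    then obtain a b c where [simp]: "i = 2 * a" "j = 2 * b" "k = 2 * c" by (auto elim!: evenE)
    have abc: "a + b + c \<le> 2" using le by simp
    have m: "L (monomial 0 0 0) = 0" "L (monomial 2 0 0) = 0" "L (monomial 4 0 0) = 0"
         "L (monomial 2 2 0) = 0"
      using 1 4 L_degree_2 L_degree_4_relation by (simp_all add: L_1)
    have m': "L (monomial 0 2 0) = 0" "L (monomial 0 0 2) = 0" "L (monomial 0 4 0) = 0"
         "L (monomial 0 0 4) = 0" "L (monomial 0 2 2) = 0" "L (monomial 2 0 2) = 0"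
      using m L_monomial_rotations by metis+
    have "a \<in> {0,1,2}" "b \<in> {0,1,2}" "c \<in> {0,1,2}" using abc by auto
    thus ?thesis using abc m m' by auto
  qed
qed

end

section \<open>Icosahedral invariants up to degree nine\<close>

text \<open>
  The reflection in the plane orthogonal to \<open>(1/\<phi>, 1, \<phi>)\<close>.  This vector of length 2 points to a vertex
  of the icosidodecahedron, hence lies on a two-fold axis of the icosahedron.  Together with the
  pyritohedral group, a maximal subgroup, the reflection generates the full icosahedral group.
\<close>

definition golden_reflection :: "real^3 \<Rightarrow> real^3" where
  "golden_reflection x = x - (((\<phi> - 1) * x$1 + x$2 + \<phi> * x$3) / 2) *\<^sub>R vector [\<phi> - 1, 1, \<phi>]"

lemma golden_reflection_orthogonal: "orthogonal_transformation golden_reflection"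
proof (rule orthogonal_transformation3I)
  fix x :: "real^3"
  define s where "s = (\<phi> - 1) * x$1 + x$2 + \<phi> * x$3"
  have "golden_reflection x \<bullet> golden_reflection x = x \<bullet> x - s * s + (s/2)^2 * ((\<phi> - 1)^2 + 1 + \<phi>^2)"
    unfolding golden_reflection_def s_def[symmetric] inner3 by (simp add: field_simps power2_eq_square)
      (simp add: s_def algebra_simps)
  also have "(\<phi> - 1)^2 + 1 + \<phi>^2 = 4"
    using phi_square by (simp add: power2_eq_square algebra_simps)
  finally show "golden_reflection x \<bullet> golden_reflection x = x \<bullet> x" by (simp add: power2_eq_square)
qed (simp_all add: golden_reflection_def vec3_eq_iff field_simps)

locale icosahedral_functional = pyritohedral_functional +
  assumes golden_reflection_invariant: "continuous_on S2 p \<Longrightarrow> L (\<lambda>x. p (golden_reflection x)) = L p"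
begin

text \<open>
  The linear form on the left is the first coordinate of the reflected point.
\<close>

lemma L_first_power:
  "L (\<lambda>x. (\<phi> / 2 * x$1 + (1 - \<phi>) / 2 * x$2 + (- 1 / 2) * x$3) ^ n) = L (monomial n 0 0)"
proof -
  have "golden_reflection x $ 1 = \<phi> / 2 * x$1 + (1 - \<phi>) / 2 * x$2 + (- 1 / 2) * x$3" for x
    by (simp add: golden_reflection_def field_simps phi_mult)
  thus ?thesis
    using golden_reflection_invariant[of "monomial n 0 0", OF continuous_on_monomial] by (simp add: monomial_def[abs_def])
qed

text \<open>
  Up to multiples, the square of \<open>x\<^sup>2 + y\<^sup>2 + z\<^sup>2\<close> is the only icosahedral form of degree 4.  Correspondingly, the
  invariance of the value on \<open>x\<^sup>4\<close> under the reflection gives a second relation for the two unknowns.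
\<close>

lemma L_degree_4_eq_0:
  assumes "L (\<lambda>_. 1) = 0"
  shows "L (monomial 4 0 0) = 0" "L (monomial 2 2 0) = 0"
proof -
  have c: "(\<phi> / 2) ^ 4 + ((1 - \<phi>) / 2) ^ 4 + (- 1 / 2) ^ 4 = 1/2"
    "(\<phi> / 2)^2 * ((1 - \<phi>) / 2)^2 + ((1 - \<phi>) / 2)^2 * (- 1 / 2)^2 + (- 1 / 2)^2 * (\<phi> / 2)^2 = 1/4"
    by (simp_all add: power_divide phi_powers phi_conj_powers) (simp_all add: field_simps phi_mult)
  have "L (monomial 4 0 0) = 1 / 2 * L (monomial 4 0 0) + 6 * (1 / 4) * L (monomial 2 2 0)"
    using L_first_power[of 4] unfolding L_linear_form_power_4 c by simp
  moreover have "L (monomial 4 0 0) + 2 * L (monomial 2 2 0) = 0"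
    using L_degree_2 L_degree_4_relation assms by simp
  ultimately show "L (monomial 4 0 0) = 0" "L (monomial 2 2 0) = 0"
    by simp_all
qed

end

text \<open>
  The sum of the sixth powers of the inner products with \<open>(\<phi>, \<plusminus>1, 0)\<close> and the cyclic permutations,
  one vector for each pair of opposite vertices of the icosahedron.
\<close>

definition icosahedral_form :: "real^3 \<Rightarrow> real" where
  "icosahedral_form x =
     (\<phi> * x$1 + x$2) ^ 6 + (\<phi> * x$1 - x$2) ^ 6 +
     (\<phi> * x$2 + x$3) ^ 6 + (\<phi> * x$2 - x$3) ^ 6 +
     (\<phi> * x$3 + x$1) ^ 6 + (\<phi> * x$3 - x$1) ^ 6"

text \<open>
  The coefficients \<open>0\<close> and \<open>1\<close> are written out to match the expansion lemmas for powers of linear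
  forms.
\<close>

lemma (in continuous_functional) L_icosahedral_form_split:
  "L icosahedral_form =
     L (\<lambda>x. (\<phi> * x$1 + 1 * x$2 + 0 * x$3) ^ 6) + L (\<lambda>x. (\<phi> * x$1 + (-1) * x$2 + 0 * x$3) ^ 6) +
     L (\<lambda>x. (0 * x$1 + \<phi> * x$2 + 1 * x$3) ^ 6) + L (\<lambda>x. (0 * x$1 + \<phi> * x$2 + (-1) * x$3) ^ 6) +
     L (\<lambda>x. (1 * x$1 + 0 * x$2 + \<phi> * x$3) ^ 6) + L (\<lambda>x. ((-1) * x$1 + 0 * x$2 + \<phi> * x$3) ^ 6)"
  unfolding icosahedral_form_def[abs_def] by (simp add: L_add continuous_intros algebra_simps)

lemma (in pyritohedral_functional) L_icosahedral_form:
  "L icosahedral_form = 6 * ((8 * \<phi> + 6) * L (monomial 6 0 0) +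
     15 * (3 * \<phi> + 2) * L (monomial 4 2 0) + 15 * (\<phi> + 1) * L (monomial 2 4 0))"
  unfolding L_icosahedral_form_split L_linear_form_power_6 by (simp add: phi_powers algebra_simps)

context icosahedral_functional begin

text \<open>
  Once degree 4 vanishes, two unknowns \<open>v\<close> and \<open>w\<close> are left in degree 6.  The hypothesis on the
  icosahedral form and the reflection give two linear equations, whose determinant is a multiple
  of \<open>2 \<phi> + 1\<close> and therefore not \<open>0\<close>.
\<close>

lemma L_degree_6_eq_0:
  assumes "L (\<lambda>_. 1) = 0" "L icosahedral_form = 0"
  shows "L (monomial 6 0 0) = 0" "L (monomial 4 2 0) = 0" "L (monomial 2 4 0) = 0" "L (monomial 2 2 2) = 0"
proof -
  define v where "v = L (monomial 4 2 0)"
  define w where "w = L (monomial 2 4 0)"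
  have u: "L (monomial 6 0 0) = - (v + w)" and t: "L (monomial 2 2 2) = - (v + w)"
    using L_degree_4_eq_0[OF assms(1)] L_degree_6_relations by (simp_all add: v_def w_def)
  have 1: "(37 * \<phi> + 24) * v + (7 * \<phi> + 9) * w = 0"
    using L_icosahedral_form[unfolded u v_def[symmetric] w_def[symmetric]] assms(2)
    by (simp add: algebra_simps)
  have c: "(\<phi> / 2) ^ 6 + ((1 - \<phi>) / 2) ^ 6 + (- 1 / 2) ^ 6 = 19 / 64"
    "(\<phi> / 2)^4 * ((1 - \<phi>) / 2)^2 + ((1 - \<phi>) / 2)^4 * (- 1 / 2)^2 + (- 1 / 2)^4 * (\<phi> / 2)^2 = (7 - \<phi>) / 64"
    "(\<phi> / 2)^2 * ((1 - \<phi>) / 2)^4 + ((1 - \<phi>) / 2)^2 * (- 1 / 2)^4 + (- 1 / 2)^2 * (\<phi> / 2)^4 = (6 + \<phi>) / 64"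
    "(\<phi> / 2)^2 * ((1 - \<phi>) / 2)^2 * (- 1 / 2)^2 = 1 / 64"
    by (simp_all add: power_divide phi_powers phi_conj_powers) (simp_all add: field_simps phi_mult)
  have 2: "(4 - \<phi>) * v + (3 + \<phi>) * w = 0"
    using L_first_power[of 6] unfolding L_linear_form_power_6 c u t v_def[symmetric] w_def[symmetric]
    by (simp add: field_simps)
  have "(80 * (2 * \<phi> + 1)) * v = 0"
  proof -
    \<comment> \<open>Cramer's rule: the combination of both equations that eliminates \<open>w\<close>.\<close>
    have "(3 + \<phi>) * ((37 * \<phi> + 24) * v + (7 * \<phi> + 9) * w) - (7 * \<phi> + 9) * ((4 - \<phi>) * v + (3 + \<phi>) * w)
      = 80 * (2 * \<phi> + 1) * v"
      by (simp add: algebra_simps phi_mult)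
    thus ?thesis using 1 2 by simp
  qed
  hence v: "v = 0" using phi_gt by simp
  hence "w = 0" using 2 phi_gt by simp
  with v u t show "L (monomial 6 0 0) = 0" "L (monomial 4 2 0) = 0" "L (monomial 2 4 0) = 0"
     "L (monomial 2 2 2) = 0" by (simp_all add: v_def w_def)
qed

text \<open>
  Vanishing in degree 6 leaves a single unknown in degree 8, because up to multiples there is only
  one pyritohedral harmonic form of degree 8.  The reflection forces it to be \<open>0\<close>.
\<close>

lemma L_degree_8_eq_0:
  assumes "L (\<lambda>_. 1) = 0" "L icosahedral_form = 0"
  shows "L (monomial 8 0 0) = 0" "L (monomial 6 2 0) = 0" "L (monomial 2 6 0) = 0"
    "L (monomial 4 4 0) = 0" "L (monomial 4 2 2) = 0"
proof -
  define d where "d = L (monomial 4 4 0)"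
  have r: "L (monomial 8 0 0) = 2 * d" "L (monomial 6 2 0) = - d" "L (monomial 2 6 0) = - d"
     "L (monomial 4 4 0) = d" "L (monomial 4 2 2) = 0"
    using L_degree_6_eq_0[OF assms] L_degree_8_relations by (simp_all add: d_def)
  have c: "(\<phi> / 2) ^ 8 + ((1 - \<phi>) / 2) ^ 8 + (- 1 / 2) ^ 8 = 48 / 256"
    "(\<phi> / 2)^6 * ((1 - \<phi>) / 2)^2 + ((1 - \<phi>) / 2)^6 * (- 1 / 2)^2 + (- 1 / 2)^6 * (\<phi> / 2)^2 = (16 - 4 * \<phi>) / 256"
    "(\<phi> / 2)^2 * ((1 - \<phi>) / 2)^6 + ((1 - \<phi>) / 2)^2 * (- 1 / 2)^6 + (- 1 / 2)^2 * (\<phi> / 2)^6 = (12 + 4 * \<phi>) / 256"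
    "(\<phi> / 2)^4 * ((1 - \<phi>) / 2)^4 + ((1 - \<phi>) / 2)^4 * (- 1 / 2)^4 + (- 1 / 2)^4 * (\<phi> / 2)^4 = 8 / 256"
    by (simp_all add: power_divide phi_powers phi_conj_powers) (simp_all add: field_simps phi_mult)
  have "d = 0"
    using L_first_power[of 8] unfolding L_linear_form_power_8 c r
    by (simp add: field_simps)
  with r show "L (monomial 8 0 0) = 0" "L (monomial 6 2 0) = 0" "L (monomial 2 6 0) = 0"
    "L (monomial 4 4 0) = 0" "L (monomial 4 2 2) = 0" by simp_all
qed

lemma L_Pol_9_eq_0:
  assumes 0: "L (\<lambda>_. 1) = 0" "L icosahedral_form = 0" and p: "p \<in> Pol 9"
  shows "L p = 0"
proof (rule L_Pol_eq_0[OF p])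
  fix i j k :: nat assume le: "i + j + k \<le> 9"
  show "L (monomial i j k) = 0"
  proof (cases "even i \<and> even j \<and> even k")
    case False thus ?thesis using L_monomial_odd by blast
  next
    case True
    then obtain a b c where [simp]: "i = 2 * a" "j = 2 * b" "k = 2 * c" by (auto elim!: evenE)
    have abc: "a + b + c \<le> 4" using le by simp
    have 1: "L (monomial 0 0 0) = 0" "L (monomial 2 0 0) = 0"
      using 0 L_degree_2 by (simp_all add: L_1)
    note z = 1 L_degree_4_eq_0[OF 0(1)] L_degree_6_eq_0[OF 0] L_degree_8_eq_0[OF 0]
    have rot: "L (monomial i j k) = 0 \<Longrightarrow> L (monomial k i j) = 0" for i j k
      using L_monomial_cyc by metis
    note z1 = z[THEN rot]
    note z2 = z1[THEN rot]
    have "a \<in> {0,1,2,3,4}" "b \<in> {0,1,2,3,4}" "c \<in> {0,1,2,3,4}" using abc by auto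
    thus ?thesis using abc
      by (elim insertE emptyE; simp add: z z1 z2)
  qed
qed
end

section \<open>Moments of the sphere\<close>

lemma sphere_integrable:
  fixes p :: "real^3 \<Rightarrow> real"
  assumes "continuous_on S2 p"
  shows "integrable sphere_measure p"
proof -
  interpret prob_space sphere_measure by (rule prob_space_sphere_measure)
  have "compact (p ` S2)"
    using assms by (intro compact_continuous_image) auto
  then obtain B where B: "\<forall>y\<in>p ` S2. norm y \<le> B"
    using compact_imp_bounded bounded_iff by blast
  show ?thesis
  proof (rule integrable_const_bound)
    show "AE x in sphere_measure. norm (p x) \<le> B"
      using B by (intro AE_I2) (simp add: space_sphere_measure)
    show "p \<in> borel_measurable sphere_measure"
      unfolding measurable_cong_sets[OF sets_sphere_measure refl]
      by (rule borel_measurable_continuous_on_restrict[OF assms])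
  qed
qed

lemma sphere_integral_isometry:
  fixes p :: "real^3 \<Rightarrow> real"
  assumes g: "orthogonal_transformation g" and p: "continuous_on S2 p"
  shows "integral\<^sup>L sphere_measure (\<lambda>x. p (g x)) = integral\<^sup>L sphere_measure p"
proof -
  have g': "g \<in> borel \<rightarrow>\<^sub>M borel"
    using g by (intro borel_measurable_continuous_onI)
      (simp add: orthogonal_transformation_linear linear_continuous_on linear_linear)
  have m: "g \<in> sphere_measure \<rightarrow>\<^sub>M restrict_space borel S2"
    unfolding measurable_cong_sets[OF sets_sphere_measure refl]
    using g g' by (intro measurable_restrict_space3) (auto simp: orthogonal_transformation_norm)
  have "integral\<^sup>L sphere_measure p = integral\<^sup>L (distr sphere_measure (restrict_space borel S2) g) p"
    by (simp add: sphere_measure_rotation_invariant[OF g])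
  also have "\<dots> = integral\<^sup>L sphere_measure (\<lambda>x. p (g x))"
    by (rule integral_distr[OF m borel_measurable_continuous_on_restrict[OF p]])
  finally show ?thesis by simp
qed

lemma continuous_functional_sphere: "continuous_functional (integral\<^sup>L sphere_measure)"
  by standard (auto intro!: Bochner_Integration.integral_cong Bochner_Integration.integral_add
       sphere_integrable simp: space_sphere_measure)

interpretation sphere: continuous_functional "integral\<^sup>L sphere_measure"
  by (rule continuous_functional_sphere)

interpretation sphere: pyritohedral_functional "integral\<^sup>L sphere_measure"
  by standard (simp_all add: sphere_integral_isometry flip_orthogonal cyc_orthogonal)

lemma measure_sphere [simp]: "measure sphere_measure (space sphere_measure) = 1"
  by (rule prob_space.prob_space[OF prob_space_sphere_measure])

lemma sphere_integral_1: "integral\<^sup>L sphere_measure (\<lambda>_. 1 :: real) = 1"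
  by simp

text \<open>
  Some rotation takes \<open>a\<close> to the first coordinate axis.
\<close>

lemma sphere_integral_linear_form_power:
  "integral\<^sup>L sphere_measure (\<lambda>x. (a \<bullet> x) ^ n) = norm a ^ n * integral\<^sup>L sphere_measure (\<lambda>x. (x$1) ^ n)"
proof -
  let ?e = "axis 1 1 :: real^3"
  have "norm a = norm (norm a *\<^sub>R ?e)" by (simp add: norm_axis_1)
  then obtain g :: "real^3 \<Rightarrow> real^3" where g: "orthogonal_transformation g" "g a = norm a *\<^sub>R ?e"
    using orthogonal_transformation_exists by blast
  have c: "continuous_on S2 (\<lambda>x::real^3. (x$1) ^ n)" by (intro continuous_intros)
  have "(a \<bullet> x) ^ n = norm a ^ n * (g x $ 1) ^ n" for x
  proof -
    have "a \<bullet> x = g a \<bullet> g x" using g(1) by (simp add: orthogonal_transformation_def)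
    also have "\<dots> = norm a * g x $ 1" by (simp add: g(2) inner_axis')
    finally show ?thesis by (simp add: power_mult_distrib)
  qed
  thus ?thesis
    using sphere_integral_isometry[OF g(1) c] by simp
qed

text \<open>
  Rotation by 45 degrees takes \<open>x + y\<close> to \<open>\<surd>2 x\<close>.  Comparing the expansion of \<open>(x + y)^n\<close> with the \<open>n\<close>-th power
  of \<open>\<surd>2 x\<close> relates the moments of degree \<open>n\<close> to each other, and multiplication by \<open>x\<^sup>2 + y\<^sup>2 + z\<^sup>2\<close>
  relates them to those of degree \<open>n - 2\<close>.
\<close>

lemma sphere_integral_x4: "integral\<^sup>L sphere_measure (monomial 4 0 0) = 1 / 5"
  and sphere_integral_x6: "integral\<^sup>L sphere_measure (monomial 6 0 0) = 1 / 7"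
proof -
  let ?a = "vector [1, 1, 0] :: real^3"
  have n: "norm ?a = sqrt 2" by (simp add: norm_eq_sqrt_inner inner3)
  have f: "integral\<^sup>L sphere_measure (\<lambda>x. (1 * x$1 + 1 * x$2 + 0 * x$3) ^ k) =
     sqrt 2 ^ k * integral\<^sup>L sphere_measure (monomial k 0 0)" for k
    using sphere_integral_linear_form_power[of ?a k] by (simp add: n inner3 monomial_def[abs_def])
  have s: "sqrt 2 ^ 4 = 4" "sqrt 2 ^ 6 = 8"
    by (simp_all add: power_even_abs eval_nat_numeral)
  show 4: "integral\<^sup>L sphere_measure (monomial 4 0 0) = 1 / 5"
    using f[of 4] unfolding sphere.L_linear_form_power_4
    using sphere.L_degree_2 sphere.L_degree_4_relation sphere_integral_1 s by simp
  show "integral\<^sup>L sphere_measure (monomial 6 0 0) = 1 / 7"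
    using f[of 6] unfolding sphere.L_linear_form_power_6
    using sphere.L_degree_6_relations 4 s by simp
qed

lemma sphere_integral_icosahedral_form:
  "integral\<^sup>L sphere_measure icosahedral_form = 6 * (20 * \<phi> + 15) / 7"
proof -
  have f: "integral\<^sup>L sphere_measure (\<lambda>x. (a * x$1 + b * x$2 + c * x$3) ^ 6) = (20 * \<phi> + 15) / 7"
    if "a\<^sup>2 + b\<^sup>2 + c\<^sup>2 = \<phi> + 2" for a b c
  proof -
    have "norm (vector [a, b, c] :: real^3) = sqrt (\<phi> + 2)"
      using that by (simp add: norm_eq_sqrt_inner inner3 power2_eq_square)
    moreover have "sqrt (\<phi> + 2) ^ 6 = (\<phi> + 2) ^ 3"
      using phi_gt power_mult[of "sqrt (\<phi> + 2)" 2 3] by simp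
    moreover have "(\<phi> + 2) ^ 3 = 20 * \<phi> + 15"
      by (simp add: power3_eq_cube algebra_simps phi_mult)
    ultimately show ?thesis
      using sphere_integral_linear_form_power[of "vector [a, b, c]" 6] sphere_integral_x6
      by (simp add: inner3 monomial_def[abs_def])
  qed
  show ?thesis
    using f[of \<phi> 1 0] f[of \<phi> "-1" 0] f[of 0 \<phi> 1] f[of 0 \<phi> "-1"] f[of 1 0 \<phi>] f[of "-1" 0 \<phi>]
    by (simp add: sphere.L_icosahedral_form_split phi_powers)
qed

section \<open>Integrals along great-circle arcs\<close>

text \<open>
  An arc is the parametrization of its great circle with respect to any orthonormal frame
  \<open>m\<close>, \<open>w\<close>, shifted by the angle of its starting point.  A frame adapted to the symmetries makes the
  integrals below elementary.
\<close>

lemma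
  fixes m w :: "real^3"
  assumes mw: "m \<bullet> m = 1" "w \<bullet> w = 1" "m \<bullet> w = 0" and ab: "a < b" "b < a + pi"
    and x: "x = cos a *\<^sub>R m + sin a *\<^sub>R w" and y: "y = cos b *\<^sub>R m + sin b *\<^sub>R w"
  shows arccos_great_circle: "arccos (x \<bullet> y) = b - a"
    and geodesic_arc_great_circle: "geodesic_arc x y t = cos (t + a) *\<^sub>R m + sin (t + a) *\<^sub>R w"
proof -
  have wm: "w \<bullet> m = 0" using mw by (simp add: inner_commute)
  have xy: "x \<bullet> y = cos (b - a)"
    unfolding x y by (simp add: inner_add mw wm cos_diff)
  thus "arccos (x \<bullet> y) = b - a"
    using ab by (simp add: arccos_cos)
  have s: "sin (b - a) > 0" using ab by (simp add: sin_gt_zero)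
  define n where "n = - sin a *\<^sub>R m + cos a *\<^sub>R w"
  have "n \<bullet> n = 1" by (simp add: n_def inner_add inner_diff mw wm flip: power2_eq_square)
  hence n: "norm n = 1" by (simp add: norm_eq_sqrt_inner)
  have e: "cos b - cos (b - a) * cos a = - sin (b - a) * sin a"
       "sin b - cos (b - a) * sin a = sin (b - a) * cos a"
    using cos_add[of "b - a" a] sin_add[of "b - a" a] by simp_all
  have "y - (x \<bullet> y) *\<^sub>R x =
      (cos b - cos (b - a) * cos a) *\<^sub>R m + (sin b - cos (b - a) * sin a) *\<^sub>R w"
    unfolding xy by (simp add: x y algebra_simps)
  also have "\<dots> = sin (b - a) *\<^sub>R n"
    unfolding e by (simp add: n_def algebra_simps)
  finally have "y - (x \<bullet> y) *\<^sub>R x = sin (b - a) *\<^sub>R n" .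
  hence sg: "sgn (y - (x \<bullet> y) *\<^sub>R x) = n"
    using s n by (simp add: sgn_scaleR sgn_div_norm)
  show "geodesic_arc x y t = cos (t + a) *\<^sub>R m + sin (t + a) *\<^sub>R w"
    unfolding geodesic_arc_def sg unfolding x n_def by (simp add: cos_add sin_add algebra_simps)
qed

lemma arc_integral_great_circle:
  fixes m w :: "real^3"
  assumes mw: "m \<bullet> m = 1" "w \<bullet> w = 1" "m \<bullet> w = 0" and ab: "a < b" "b < a + pi"
    and x: "x = cos a *\<^sub>R m + sin a *\<^sub>R w" and y: "y = cos b *\<^sub>R m + sin b *\<^sub>R w"
    and F: "\<And>u. (F has_real_derivative p (cos u *\<^sub>R m + sin u *\<^sub>R w)) (at u)"
  shows "arc_integral x y p = F b - F a"
proof -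
  have "((\<lambda>t. p (cos (t + a) *\<^sub>R m + sin (t + a) *\<^sub>R w)) has_integral F (b - a + a) - F (0 + a)) {0..b - a}"
  proof (rule fundamental_theorem_of_calculus)
    fix t
    have "((\<lambda>t. F (t + a)) has_real_derivative p (cos (t + a) *\<^sub>R m + sin (t + a) *\<^sub>R w)) (at t)"
      by (rule DERIV_shift[THEN iffD1, OF F])
    thus "((\<lambda>t. F (t + a)) has_vector_derivative p (cos (t + a) *\<^sub>R m + sin (t + a) *\<^sub>R w)) (at t within {0..b - a})"
      by (simp add: has_real_derivative_iff_has_vector_derivative has_vector_derivative_at_within)
  qed (use ab in simp)
  thus ?thesis
    unfolding arc_integral_def arccos_great_circle[OF mw ab x y] geodesic_arc_great_circle[OF mw ab x y]
    by (simp add: integral_unique)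
qed

lemma geodesic_arc_isometry:
  assumes "orthogonal_transformation g"
  shows "geodesic_arc (g x) (g y) t = g (geodesic_arc x y t)"
proof -
  have l: "linear g" using assms by (rule orthogonal_transformation_linear)
  have i: "g x \<bullet> g y = x \<bullet> y" for x y using assms by (simp add: orthogonal_transformation_def)
  have "sgn (g z) = g (sgn z)" for z
    using assms l by (simp add: sgn_div_norm orthogonal_transformation_norm linear_scale)
  moreover have "g y - (x \<bullet> y) *\<^sub>R g x = g (y - (x \<bullet> y) *\<^sub>R x)"
    using l by (simp add: linear_diff linear_scale)
  ultimately show ?thesis
    using l by (simp add: geodesic_arc_def i linear_add linear_scale)
qed

lemma arc_integral_isometry:
  assumes "orthogonal_transformation g"
  shows "arc_integral (g x) (g y) p = arc_integral x y (\<lambda>z. p (g z))"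
  using assms by (simp add: arc_integral_def geodesic_arc_isometry orthogonal_transformation_def)

lemma geodesic_arc_commute:
  assumes "x \<in> S2" "y \<in> S2" "y \<noteq> x" "y \<noteq> - x"
  shows "geodesic_arc y x t = geodesic_arc x y (arccos (x \<bullet> y) - t)"
proof -
  define \<theta> where "\<theta> = arccos (x \<bullet> y)"
  define w where "w = sgn (y - (x \<bullet> y) *\<^sub>R x)"
  have g: "geodesic_arc x y t = cos t *\<^sub>R x + sin t *\<^sub>R w" for t
    by (simp add: geodesic_arc_def w_def)
  have y: "y = cos \<theta> *\<^sub>R x + sin \<theta> *\<^sub>R w"
    using geodesic_arc(2)[OF assms] by (simp add: g \<theta>_def)
  have xx: "x \<bullet> x = 1" using assms(1) by (simp add: dot_square_norm)
  have yy: "y \<bullet> y = 1" using assms(2) by (simp add: dot_square_norm)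
  have "norm w = 1" using geodesic_arc(5)[OF assms, of 0] by (simp add: w_def)
  hence ww: "w \<bullet> w = 1" by (simp add: dot_square_norm)
  have "x \<bullet> (y - (x \<bullet> y) *\<^sub>R x) = 0" by (simp add: inner_diff xx)
  hence xw: "x \<bullet> w = 0" by (simp add: w_def sgn_div_norm)
  have c: "-1 \<le> x \<bullet> y" "x \<bullet> y \<le> 1"
    using Cauchy_Schwarz_ineq2[of x y] assms(1,2) by (auto simp: abs_le_iff)
  have "x \<bullet> y \<noteq> 1" "x \<bullet> y \<noteq> -1"
  proof -
    have "(y - x) \<bullet> (y - x) = 2 - 2 * (x \<bullet> y)" "(y + x) \<bullet> (y + x) = 2 + 2 * (x \<bullet> y)"
      by (simp_all add: inner_diff inner_add xx yy inner_commute)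
    thus "x \<bullet> y \<noteq> 1" "x \<bullet> y \<noteq> -1"
      using assms(3,4) by (auto simp: add_eq_0_iff)
  qed
  hence th: "0 < \<theta>" "\<theta> < pi"
    using c arccos_lt_bounded[of "x \<bullet> y"] by (auto simp: \<theta>_def)
  have "geodesic_arc y x t = cos (t + - \<theta>) *\<^sub>R x + sin (t + - \<theta>) *\<^sub>R (- w)"
    by (rule geodesic_arc_great_circle[of x "- w" "- \<theta>" 0]) (use xx ww xw th y in auto)
  also have "\<dots> = geodesic_arc x y (\<theta> - t)"
    by (simp add: g cos_diff sin_diff algebra_simps)
  finally show ?thesis by (simp add: \<theta>_def)
qed

lemma arc_integral_commute:
  assumes "x \<in> S2" "y \<in> S2" "y \<noteq> x" "y \<noteq> - x"
  shows "arc_integral y x p = arc_integral x y p"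
proof -
  define \<theta> where "\<theta> = arccos (x \<bullet> y)"
  define f where "f = (\<lambda>t. p (geodesic_arc x y t))"
  have "arc_integral y x p = integral {0..\<theta>} (\<lambda>t. f (\<theta> - t))"
    unfolding arc_integral_def geodesic_arc_commute[OF assms] by (simp add: \<theta>_def f_def inner_commute)
  also have "\<dots> = integral {-\<theta>..0} (\<lambda>t. f (t + \<theta>))"
    using Henstock_Kurzweil_Integration.integral_reflect_real[where a = 0 and b = \<theta> and f = "\<lambda>t. f (\<theta> - t)"] by (simp add: add.commute)
  also have "\<dots> = integral {0..\<theta>} f"
    using integral_shift_real_ivl[of 0 \<theta> \<theta> f] by simp
  finally show ?thesis by (simp add: arc_integral_def f_def \<theta>_def)
qed

lemma arc_integrable:
  fixes p :: "real^3 \<Rightarrow> real"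
  assumes "x \<in> S2" "y \<in> S2" "y \<noteq> x" "y \<noteq> - x" "continuous_on S2 p"
  shows "(\<lambda>t. p (geodesic_arc x y t)) integrable_on {0..arccos (x \<bullet> y)}"
proof (rule integrable_continuous_real)
  show "continuous_on {0..arccos (x \<bullet> y)} (\<lambda>t. p (geodesic_arc x y t))"
  proof (rule continuous_on_compose2[OF assms(5)])
    show "continuous_on {0..arccos (x \<bullet> y)} (geodesic_arc x y)"
      unfolding geodesic_arc_def[abs_def] by (intro continuous_intros)
  qed (use geodesic_arc(3)[OF assms(1-4)] in auto)
qed

section \<open>The defect of an edge design\<close>

text \<open>
  The choice of the order of the end points is harmless, as the arc integral is symmetric.
\<close>

definition edge_integral :: "(real^3 \<Rightarrow> real) \<Rightarrow> (real^3) set \<Rightarrow> real" where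
  "edge_integral p e = (SOME v. \<exists>x y. e = {x, y} \<and> v = arc_integral x y p)"

lemma edge_integral_pair:
  assumes "x \<in> S2" "y \<in> S2" "y \<noteq> x" "y \<noteq> - x"
  shows "edge_integral p {x, y} = arc_integral x y p"
  unfolding edge_integral_def
proof (rule some_equality)
  fix v assume "\<exists>x' y'. {x, y} = {x', y'} \<and> v = arc_integral x' y' p"
  thus "v = arc_integral x y p"
    using arc_integral_commute[OF assms] by (auto simp: doubleton_eq_iff)
qed blast

text \<open>
  The edges are the pairs in \<open>V \<times> W\<close> with inner product \<open>c\<close>, so that all arcs have length \<open>arccos c\<close>;
  \<open>X\<close> is the point set of the design.
\<close>

locale edge_design =
  fixes V W X :: "(real^3) set" and c \<beta> :: real
  assumes finite: "finite V" "finite W" "finite X"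
    and on_sphere: "V \<subseteq> S2" "W \<subseteq> S2" "X \<subseteq> S2"
    and X_nonempty: "X \<noteq> {}"
    and c_bounds: "-1 < c" "c < 1"
    and edge_exists: "\<exists>x\<in>V. \<exists>y\<in>W. x \<bullet> y = c"
    and \<beta>_bounds: "0 \<le> \<beta>" "\<beta> \<le> 1"
begin

abbreviation E :: "(real^3) set set" where "E \<equiv> pairs_with_inner V W c"

definition edge_mean :: "(real^3 \<Rightarrow> real) \<Rightarrow> real" where
  "edge_mean p = (\<Sum>e\<in>E. edge_integral p e) / (real (card E) * arccos c)"

definition defect :: "(real^3 \<Rightarrow> real) \<Rightarrow> real" where
  "defect p = \<beta> / real (card X) * (\<Sum>x\<in>X. p x) + (1 - \<beta>) * edge_mean p - integral\<^sup>L sphere_measure p"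

lemma arc_endpoints:
  assumes "x \<in> S2" "y \<in> S2" "x \<bullet> y = c"
  shows "y \<noteq> x" "y \<noteq> - x"
  using assms c_bounds by (auto simp: dot_square_norm)

lemma edgeE:
  assumes "e \<in> E"
  obtains x y where "e = {x, y}" "x \<in> V" "y \<in> W" "x \<in> S2" "y \<in> S2" "x \<bullet> y = c" "y \<noteq> x" "y \<noteq> - x"
    "\<And>p. edge_integral p e = arc_integral x y p"
proof -
  from assms obtain x y where e: "e = {x, y}" "x \<in> V" "y \<in> W" "x \<bullet> y = c"
    by (auto simp: pairs_with_inner_def)
  moreover from e on_sphere have s: "x \<in> S2" "y \<in> S2" by auto
  moreover note arc_endpoints[OF s e(4)]
  moreover from this s have "edge_integral p e = arc_integral x y p" for p
    by (simp add: e edge_integral_pair)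
  ultimately show ?thesis using that by blast
qed

lemma finite_E: "finite E" and E_nonempty: "E \<noteq> {}"
proof -
  have "E \<subseteq> (\<lambda>(x, y). {x, y}) ` (V \<times> W)" by (auto simp: pairs_with_inner_def)
  thus "finite E" by (rule finite_subset) (simp add: finite)
  show "E \<noteq> {}" using edge_exists by (auto simp: pairs_with_inner_def)
qed

lemma card_E: "card E > 0"
  using finite_E E_nonempty by (simp add: card_gt_0_iff)

lemma edge_length_pos: "arccos c > 0"
  using c_bounds arccos_lt_bounded[of c] by simp

lemma edge_integral_1:
  assumes "e \<in> E" shows "edge_integral (\<lambda>_. 1) e = arccos c"
  using assms edge_length_pos by (auto elim!: edgeE simp: arc_integral_def)

lemma edge_mean_const:
  assumes "\<And>e. e \<in> E \<Longrightarrow> edge_integral p e = J"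
  shows "edge_mean p = J / arccos c"
  using assms card_E by (simp add: edge_mean_def)

lemma continuous_functional_defect: "continuous_functional defect"
proof
  fix p q :: "real^3 \<Rightarrow> real" assume pq: "\<And>x. x \<in> S2 \<Longrightarrow> p x = q x"
  have "edge_integral p e = edge_integral q e" if "e \<in> E" for e
    using that by (auto elim!: edgeE intro!: integral_cong pq geodesic_arc(3) simp: arc_integral_def simp del: mem_sphere mem_sphere_0)
  moreover have "(\<Sum>x\<in>X. p x) = (\<Sum>x\<in>X. q x)"
    using on_sphere by (intro sum.cong pq) auto
  ultimately show "defect p = defect q"
    using sphere.L_cong[of p q] pq by (simp add: defect_def edge_mean_def)
next
  fix p q :: "real^3 \<Rightarrow> real" assume pq: "continuous_on S2 p" "continuous_on S2 q"
  have "edge_integral (\<lambda>x. p x + q x) e = edge_integral p e + edge_integral q e" if "e \<in> E" for e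
    using that pq by (auto elim!: edgeE simp: arc_integral_def simp del: mem_sphere mem_sphere_0 intro!: Henstock_Kurzweil_Integration.integral_add arc_integrable)
  hence "edge_mean (\<lambda>x. p x + q x) = edge_mean p + edge_mean q"
    by (simp add: edge_mean_def sum.distrib add_divide_distrib)
  thus "defect (\<lambda>x. p x + q x) = defect p + defect q"
    using sphere.L_add[OF pq] by (simp add: defect_def sum.distrib algebra_simps)
next
  fix p :: "real^3 \<Rightarrow> real" and a :: real assume p: "continuous_on S2 p"
  have "edge_integral (\<lambda>x. a * p x) e = a * edge_integral p e" if "e \<in> E" for e
    using that by (auto elim!: edgeE simp: arc_integral_def)
  hence "edge_mean (\<lambda>x. a * p x) = a * edge_mean p"
    by (simp add: edge_mean_def flip: sum_distrib_left)
  thus "defect (\<lambda>x. a * p x) = a * defect p"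
    using sphere.L_scale[OF p] by (simp add: defect_def algebra_simps flip: sum_distrib_left)
qed

sublocale continuous_functional defect
  by (rule continuous_functional_defect)

text \<open>
  By finiteness, mapping a vertex set into itself is enough, which spares all inverse maps.
\<close>

lemma image_eq_if_isometry:
  assumes "orthogonal_transformation g" "finite A" "g ` A \<subseteq> A"
  shows "g ` A = A"
  using assms(2,3) inj_on_subset[OF orthogonal_transformation_inj[OF assms(1)] subset_UNIV]
  by (rule endo_inj_surj)

lemma defect_isometry:
  assumes g: "orthogonal_transformation g" and V: "g ` V \<subseteq> V" and W: "g ` W \<subseteq> W" and X: "g ` X \<subseteq> X"
    and p: "continuous_on S2 p"
  shows "defect (\<lambda>x. p (g x)) = defect p"
proof -
  have inj: "inj g" using g by (rule orthogonal_transformation_inj)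
  have gX: "g ` X = X" by (rule image_eq_if_isometry[OF g finite(3) X])
  have injE: "inj_on ((`) g) E" using inj by (meson inj_on_image inj_on_subset subset_UNIV)
  have "(`) g ` E \<subseteq> E"
  proof safe
    fix e assume "e \<in> E"
    then obtain x y where "e = {x, y}" "x \<in> V" "y \<in> W" "x \<bullet> y = c" by (auto simp: pairs_with_inner_def)
    hence "g ` e = {g x, g y}" "g x \<in> V" "g y \<in> W" "g x \<bullet> g y = c"
      using V W g by (auto simp: orthogonal_transformation_def)
    thus "g ` e \<in> E" unfolding pairs_with_inner_def by blast
  qed
  hence gE: "(`) g ` E = E" using endo_inj_surj finite_E injE by blast
  have "edge_integral (\<lambda>x. p (g x)) e = edge_integral p (g ` e)" if "e \<in> E" for e
  proof -
    from that obtain x y where e: "e = {x, y}" "x \<in> V" "y \<in> W" "x \<bullet> y = c"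
      "\<And>p. edge_integral p e = arc_integral x y p"  by (auto elim: edgeE)
    have s: "g x \<in> S2" "g y \<in> S2" "g x \<bullet> g y = c" using e V W on_sphere g
      by (auto simp: orthogonal_transformation_def simp del: mem_sphere mem_sphere_0)
    have "g ` e = {g x, g y}" by (simp add: e(1))
    thus ?thesis
      using edge_integral_pair[OF s(1,2) arc_endpoints[OF s], of p]
      by (simp only: e(5) arc_integral_isometry[OF g])
  qed
  hence "(\<Sum>e\<in>E. edge_integral (\<lambda>x. p (g x)) e) = (\<Sum>e\<in>(`) g ` E. edge_integral p e)"
    using injE by (simp add: sum.reindex)
  moreover have "(\<Sum>x\<in>X. p (g x)) = (\<Sum>x\<in>g ` X. p x)"
    using inj by (subst sum.reindex) (auto intro: inj_on_subset)
  ultimately show ?thesis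
    using sphere_integral_isometry[OF g p] by (simp add: defect_def edge_mean_def gX gE)
qed

lemma defect_1: "defect (\<lambda>_. 1) = 0"
  using edge_mean_const[OF edge_integral_1] finite X_nonempty edge_length_pos by (simp add: defect_def)

lemma defect_eq_0:
  assumes X: "\<And>x. x \<in> X \<Longrightarrow> p x = a"
    and arcs: "\<And>x y. x \<in> V \<Longrightarrow> y \<in> W \<Longrightarrow> x \<bullet> y = c \<Longrightarrow> arc_integral x y p = J"
    and balance: "\<beta> * a + (1 - \<beta>) * (J / arccos c) = integral\<^sup>L sphere_measure p"
  shows "defect p = 0"
proof -
  have "edge_mean p = J / arccos c"
    by (rule edge_mean_const) (auto elim!: edgeE simp: arcs)
  thus ?thesis using X finite X_nonempty balance by (simp add: defect_def)
qed

text \<open>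
  The vertex degrees only decide whether the Euler cycle runs through every edge once or twice.  The
  factor \<open>k\<close> that records this cancels between the cycle integral and the cycle length.
\<close>

lemma hybrid_design:
  assumes \<gamma>: "induced_cycle U E \<gamma>" and p: "\<And>p. p \<in> Pol s \<Longrightarrow> defect p = 0"
  shows "hybrid_design s \<beta> \<gamma> X"
proof -
  define f where "f = (\<lambda>(x, y). {x, y :: real^3})"
  have euler: "\<gamma> \<noteq> [] \<and> hd \<gamma> = last \<gamma> \<and> mset (map f (steps \<gamma>)) =
      (if \<forall>v\<in>U. even (card {e\<in>E. v \<in> e}) then mset_set E else mset_set E + mset_set E)"
    using \<gamma> unfolding induced_cycle_def euler_cycle_def f_def .
  hence \<gamma>': "\<gamma> \<noteq> []" "hd \<gamma> = last \<gamma>"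
    by blast+
  from euler have "mset (map f (steps \<gamma>)) = mset_set E \<or>
      mset (map f (steps \<gamma>)) = mset_set E + mset_set E"
    by argo
  moreover have "repeat_mset 1 M = M" "repeat_mset 2 M = M + M" for M :: "(real^3) set multiset"
    by (simp_all add: numeral_2_eq_2)
  ultimately obtain k :: nat where k: "k > 0" "mset (map f (steps \<gamma>)) = repeat_mset k (mset_set E)"
    using that[of 1] that[of 2] by fastforce
  have "set_mset (repeat_mset k (mset_set E)) = E"
    using k(1) finite_E by (simp add: set_eq_iff count_mset_set' flip: count_greater_zero_iff)
  hence set_steps: "f ` set (steps \<gamma>) = E"
    using arg_cong[OF k(2), of set_mset] by simp
  have step: "x \<in> S2 \<and> y \<in> S2 \<and> y \<noteq> x \<and> y \<noteq> - x" if "(x, y) \<in> set (steps \<gamma>)" for x y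
  proof -
    have "{x, y} \<in> E" using that set_steps by (force simp: f_def)
    thus ?thesis by (elim edgeE) (auto simp: doubleton_eq_iff)
  qed
  have int: "cycle_integral \<gamma> p = real k * (\<Sum>e\<in>E. edge_integral p e)" for p
  proof -
    have "cycle_integral \<gamma> p = (\<Sum>s\<leftarrow>steps \<gamma>. edge_integral p (f s))"
      unfolding cycle_integral_def using step
      by (intro arg_cong[of _ _ sum_list] map_cong refl) (auto simp: f_def edge_integral_pair)
    also have "\<dots> = sum_mset (image_mset (edge_integral p) (mset (map f (steps \<gamma>))))"
      by (simp add: sum_mset_sum_list[symmetric] multiset.map_comp comp_def)
    also have "\<dots> = real k * (\<Sum>e\<in>E. edge_integral p e)"
    proof -
      have "sum_mset (image_mset h (repeat_mset k M)) = real k * sum_mset (image_mset h M)"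
        for h :: "(real^3) set \<Rightarrow> real" and M
        by (induction k) (simp_all add: algebra_simps)
      thus ?thesis
        unfolding k(2) sum_unfold_sum_mset .
    qed
    finally show ?thesis .
  qed
  have len: "cycle_length \<gamma> = real k * (card E * arccos c)"
    by (simp add: cycle_length_def int edge_integral_1)
  have mean: "(1 - \<beta>) / cycle_length \<gamma> * cycle_integral \<gamma> p = (1 - \<beta>) * edge_mean p" for p
    using k(1) by (simp add: len int edge_mean_def)
  have "steps \<gamma> \<noteq> []" using set_steps E_nonempty by auto
  hence "2 \<le> length \<gamma>" using \<gamma>' by (cases \<gamma>; cases "tl \<gamma>") (auto simp: steps_def)
  hence "geodesic_cycle \<gamma>" using \<gamma>' step by (auto simp: geodesic_cycle_def)
  thus ?thesis
    using p finite on_sphere X_nonempty \<beta>_bounds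
    unfolding hybrid_design_def mean defect_def by simp
qed

end

section \<open>Vertices as orbits of the pyritohedral group\<close>

text \<open>
  The orbit of \<open>(a, b, c)\<close> under the pyritohedral group.  Up to a scaling factor, all vertex sets
  except those of the tetrahedra are unions of such orbits.
\<close>

definition orbit :: "real \<Rightarrow> real \<Rightarrow> real \<Rightarrow> (real^3) set" where
  "orbit a b c = even_perms (pm a) (pm b) (pm c)"

lemma mem_triples_iff: "v \<in> triples A B C \<longleftrightarrow> v$1 \<in> A \<and> v$2 \<in> B \<and> v$3 \<in> C"
proof -
  have "v = vector [v$1, v$2, v$3]" by (simp add: vec3_eq_iff)
  thus ?thesis by (auto simp: triples_def)
qed

lemma mem_orbit_iff:
  "v \<in> orbit a b c \<longleftrightarrow>
     v$1 \<in> pm a \<and> v$2 \<in> pm b \<and> v$3 \<in> pm c \<or>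
     v$1 \<in> pm b \<and> v$2 \<in> pm c \<and> v$3 \<in> pm a \<or>
     v$1 \<in> pm c \<and> v$2 \<in> pm a \<and> v$3 \<in> pm b"
  by (auto simp: orbit_def even_perms_def mem_triples_iff)

lemma mem_pm_iff: "x \<in> pm a \<longleftrightarrow> x = a \<or> x = - a"
  by (simp add: pm_def)

lemma finite_orbit: "finite (orbit a b c)"
proof -
  have "triples A B C = (\<lambda>(a, b, c). vector [a, b, c]) ` (A \<times> B \<times> C)" for A B C
    by (force simp: triples_def image_iff)
  thus ?thesis by (simp add: orbit_def even_perms_def pm_def)
qed

lemma flip_vector: "flip (vector [a, b, c]) = vector [- a, b, c]"
  by (simp add: flip_def)

lemma cyc_vector: "cyc (vector [a, b, c]) = vector [b, c, a]"
  by (simp add: cyc_def)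

lemma isometry_scale: "orthogonal_transformation g \<Longrightarrow> g (k *\<^sub>R x) = k *\<^sub>R g x"
  by (simp add: linear_scale orthogonal_transformation_linear)

definition pyritohedral :: "(real^3) set \<Rightarrow> bool" where
  "pyritohedral A \<longleftrightarrow> flip ` A \<subseteq> A \<and> cyc ` A \<subseteq> A"

lemma pyritohedral_orbit: "pyritohedral (orbit a b c)"
  by (auto simp: pyritohedral_def mem_orbit_iff flip_def cyc_def mem_pm_iff)

lemma pyritohedral_Un: "pyritohedral A \<Longrightarrow> pyritohedral B \<Longrightarrow> pyritohedral (A \<union> B)"
  by (auto simp: pyritohedral_def)

lemma image_scale_subset:
  assumes "orthogonal_transformation g" "g ` A \<subseteq> A"
  shows "g ` ((*\<^sub>R) k ` A) \<subseteq> (*\<^sub>R) k ` A"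
proof safe
  fix x assume "x \<in> A"
  hence "g x \<in> A" using assms(2) by blast
  thus "g (k *\<^sub>R x) \<in> (*\<^sub>R) k ` A" unfolding isometry_scale[OF assms(1)] by (rule imageI)
qed

lemma pyritohedral_scale: "pyritohedral A \<Longrightarrow> pyritohedral ((*\<^sub>R) k ` A)"
  unfolding pyritohedral_def by (simp add: image_scale_subset flip_orthogonal cyc_orthogonal)

lemma orbit_induct [consumes 1, case_names base flip cyc]:
  assumes "x \<in> orbit a b c" and base: "P (vector [a, b, c])"
    and flip: "\<And>x. P x \<Longrightarrow> P (flip x)" and cyc: "\<And>x. P x \<Longrightarrow> P (cyc x)"
  shows "P x"
proof -
  have cyc': "P (vector [a, b, c]) \<Longrightarrow> P (vector [b, c, a])" for a b c
    using cyc[of "vector [a, b, c]"] by (simp add: cyc_vector)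
  have neg1: "P (vector [a, b, c]) \<Longrightarrow> P (vector [- a, b, c])" for a b c
    using flip[of "vector [a, b, c]"] by (simp add: flip_vector)
  have neg2: "P (vector [a, b, c]) \<Longrightarrow> P (vector [a, - b, c])" for a b c
    using cyc'[of c a "- b"] cyc'[of "- b" c a] neg1[of b c a] cyc'[of a b c] by blast
  have neg3: "P (vector [a, b, c]) \<Longrightarrow> P (vector [a, b, - c])" for a b c
    using cyc'[of "- c" a b] neg1[of c a b] cyc'[of b c a] cyc'[of a b c] by blast
  have signs: "P (vector [x, y, z])"
    if "P (vector [a, b, c])" "x \<in> pm a" "y \<in> pm b" "z \<in> pm c" for a b c x y z
    using that neg1 neg2 neg3 by (auto simp: mem_pm_iff)
  have "P (vector [x$1, x$2, x$3])"
    using assms(1) signs[OF base] signs[OF cyc'[OF base]] signs[OF cyc'[OF cyc'[OF base]]]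
    unfolding mem_orbit_iff by blast
  moreover have "vector [x$1, x$2, x$3] = x" by (simp add: vec3_eq_iff)
  ultimately show ?thesis by simp
qed

lemma scaled_orbit_on_sphere:
  assumes "k > 0" "a\<^sup>2 + b\<^sup>2 + c\<^sup>2 = k\<^sup>2"
  shows "(*\<^sub>R) (1 / k) ` orbit a b c \<subseteq> S2"
proof -
  have "norm x = k" if "x \<in> orbit a b c" for x
  proof -
    have "x \<bullet> x = k\<^sup>2"
      using that assms(2) by (auto simp: inner3 mem_orbit_iff mem_pm_iff power2_eq_square)
    thus ?thesis using assms(1) by (simp add: norm_eq_sqrt_inner)
  qed
  thus ?thesis using assms(1) by auto
qed

text \<open>
  The scaling factor \<open>1\<close> keeps the common shape of all vertex sets.
\<close>

lemma octahedron_eq: "octahedron = (*\<^sub>R) 1 ` orbit 1 0 0"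
proof -
  have e: "axis 1 1 = (vector [1, 0, 0] :: real^3)" "axis 2 1 = (vector [0, 1, 0] :: real^3)"
    "axis 3 1 = (vector [0, 0, 1] :: real^3)"
    by (simp_all add: vec3_eq_iff axis_def)
  have "octahedron = (\<Union>i\<in>UNIV. (\<lambda>\<epsilon>. \<epsilon> *\<^sub>R axis i 1) ` pm 1)"
    by (auto simp: octahedron_def)
  also have "\<dots> = orbit 1 0 0"
    unfolding UNIV_3 set_eq_iff by (auto simp: e pm_def mem_orbit_iff vec3_eq_iff)
  finally show ?thesis by simp
qed

lemma cube_eq: "cube = (*\<^sub>R) (1 / sqrt 3) ` orbit 1 1 1"
  by (simp add: cube_def orbit_def even_perms_def)

lemma cuboctahedron_eq: "cuboctahedron = (*\<^sub>R) (1 / sqrt 2) ` orbit 1 1 0"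
  by (simp add: cuboctahedron_def orbit_def all_perms_def pm_def[of 0])

lemma icosahedron_eq: "icosahedron = (*\<^sub>R) (1 / sqrt (\<phi> + 2)) ` orbit \<phi> 1 0"
  by (simp add: icosahedron_def orbit_def pm_def[of 0] phi_square add_ac)

lemma dodecahedron_eq: "dodecahedron = (*\<^sub>R) (1 / sqrt 3) ` (orbit 1 1 1 \<union> orbit \<phi> 0 (\<phi> - 1))"
  unfolding dodecahedron_def cube_eq inverse_phi image_Un by (simp add: orbit_def pm_def[of 0])

lemma icosidodecahedron_eq:
  "icosidodecahedron = (*\<^sub>R) (1 / 2) ` (orbit 2 0 0 \<union> orbit \<phi> (\<phi> - 1) 1)"
proof -
  have "orbit 1 0 0 = (*\<^sub>R) (1 / 2) ` orbit 2 0 0"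
  proof (intro equalityI subsetI)
    fix v :: "real^3" assume "v \<in> orbit 1 0 0"
    hence "2 *\<^sub>R v \<in> orbit 2 0 0" by (auto simp: mem_orbit_iff mem_pm_iff)
    thus "v \<in> (*\<^sub>R) (1 / 2) ` orbit 2 0 0" by (force intro: image_eqI[of _ _ "2 *\<^sub>R v"])
  qed (auto simp: mem_orbit_iff mem_pm_iff)
  thus ?thesis
    by (simp add: icosidodecahedron_def octahedron_eq inverse_phi image_Un orbit_def)
qed

lemmas vertex_sets = octahedron_eq cube_eq cuboctahedron_eq icosahedron_eq dodecahedron_eq
  icosidodecahedron_eq

lemma golden_reflection_components:
  "golden_reflection x $ 1 = (\<phi> * x$1 + (1 - \<phi>) * x$2 - x$3) / 2"
  "golden_reflection x $ 2 = ((1 - \<phi>) * x$1 + x$2 - \<phi> * x$3) / 2"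
  "golden_reflection x $ 3 = (- x$1 - \<phi> * x$2 + (1 - \<phi>) * x$3) / 2"
  by (simp_all add: golden_reflection_def field_simps phi_mult)

text \<open>
  The icosahedral vertex sets are closed under the reflection: all images have coordinates in
  the span of \<open>1\<close> and \<open>\<phi>\<close> over the rationals, where \<open>\<phi>\<^sup>2 = \<phi> + 1\<close> decides every case.
\<close>

lemma golden_reflection_icosahedron:
  "golden_reflection ` orbit \<phi> 1 0 \<subseteq> orbit \<phi> 1 0"
proof (rule image_subsetI)
  fix v assume "v \<in> orbit \<phi> 1 0"
  thus "golden_reflection v \<in> orbit \<phi> 1 0"
    unfolding mem_orbit_iff mem_pm_iff golden_reflection_components
    by (elim disjE conjE; simp only:; simp add: ring_distribs phi_mult)
qed

lemma golden_reflection_dodecahedron: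
  "golden_reflection ` (orbit 1 1 1 \<union> orbit \<phi> 0 (\<phi> - 1)) \<subseteq> orbit 1 1 1 \<union> orbit \<phi> 0 (\<phi> - 1)"
proof (rule image_subsetI)
  fix v assume "v \<in> orbit 1 1 1 \<union> orbit \<phi> 0 (\<phi> - 1)"
  thus "golden_reflection v \<in> orbit 1 1 1 \<union> orbit \<phi> 0 (\<phi> - 1)"
    unfolding Un_iff mem_orbit_iff mem_pm_iff golden_reflection_components
    by (elim disjE conjE; simp only:; simp add: ring_distribs phi_mult)
qed

lemma golden_reflection_icosidodecahedron:
  "golden_reflection ` (orbit 2 0 0 \<union> orbit \<phi> (\<phi> - 1) 1) \<subseteq> orbit 2 0 0 \<union> orbit \<phi> (\<phi> - 1) 1"
proof (rule image_subsetI)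
  fix v assume "v \<in> orbit 2 0 0 \<union> orbit \<phi> (\<phi> - 1) 1"
  thus "golden_reflection v \<in> orbit 2 0 0 \<union> orbit \<phi> (\<phi> - 1) 1"
    unfolding Un_iff mem_orbit_iff mem_pm_iff golden_reflection_components
    by (elim disjE conjE; simp only:; simp add: ring_distribs phi_mult)
qed

section \<open>Invariant forms and equivalent arcs\<close>

definition quartic_form :: "real^3 \<Rightarrow> real" where
  "quartic_form x = x$1 ^ 4 + x$2 ^ 4 + x$3 ^ 4"

lemma (in cyclic_functional) L_quartic_form: "L quartic_form = 3 * L (monomial 4 0 0)"
proof -
  have e: "quartic_form = (\<lambda>x. monomial 4 0 0 x + (monomial 0 4 0 x + monomial 0 0 4 x))"
    by (simp add: quartic_form_def monomial_def fun_eq_iff)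
  have "L quartic_form = L (monomial 4 0 0) + (L (monomial 0 4 0) + L (monomial 0 0 4))"
    unfolding e by (simp add: L_add continuous_intros)
  thus ?thesis using L_monomial_cyc[of 0 4 0] L_monomial_cyc[of 0 0 4] by simp
qed

definition pyritohedral_form :: "(real^3 \<Rightarrow> real) \<Rightarrow> bool" where
  "pyritohedral_form p \<longleftrightarrow> (\<forall>x. p (flip x) = p x) \<and> (\<forall>x. p (cyc x) = p x)"

lemma pyritohedral_quartic_form: "pyritohedral_form quartic_form"
  by (simp add: pyritohedral_form_def quartic_form_def flip_def cyc_def)

lemma even_power_diff_commute: "(a - b) ^ 6 = (b - a) ^ 6" "(- a - b) ^ 6 = (a + b) ^ 6"
   for a b :: real
proof -
  have "(- x) ^ 6 = x ^ 6" for x :: real by simp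
  from this[of "a - b"] this[of "a + b"] show "(a - b) ^ 6 = (b - a) ^ 6" "(- a - b) ^ 6 = (a + b) ^ 6"
    by simp_all
qed

lemma pyritohedral_icosahedral_form: "pyritohedral_form icosahedral_form"
  using even_power_diff_commute(1)[of "x$2" "\<phi> * x$1" for x :: "real^3"]
    even_power_diff_commute(2)[of "\<phi> * x$1" "x$2" for x :: "real^3"]
  by (simp add: pyritohedral_form_def icosahedral_form_def flip_def cyc_def)

text \<open>
  Up to signs, the reflection permutes the six linear forms, as it permutes the vertices of the
  icosahedron.
\<close>

lemma icosahedral_form_golden_reflection: "icosahedral_form (golden_reflection x) = icosahedral_form x"
proof -
  let ?y = "golden_reflection x"
  have "\<phi> * ?y$1 + ?y$2 = x$1 - \<phi> * x$3" "\<phi> * ?y$1 - ?y$2 = \<phi> * x$1 - x$2"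
    "\<phi> * ?y$2 + ?y$3 = - x$1 - \<phi> * x$3" "\<phi> * ?y$2 - ?y$3 = \<phi> * x$2 - x$3"
    "\<phi> * ?y$3 + ?y$1 = - (\<phi> * x$2) - x$3" "\<phi> * ?y$3 - ?y$1 = - (\<phi> * x$1) - x$2"
    by (simp_all add: golden_reflection_components field_simps phi_mult)
  note e = this
  show ?thesis
    unfolding icosahedral_form_def e even_power_diff_commute(2)
    by (simp add: even_power_diff_commute(1)[of "x$1" "\<phi> * x$3"] add_ac)
qed

lemma form_on_scaled_orbit:
  assumes "pyritohedral_form p" "x \<in> (*\<^sub>R) k ` orbit a b c"
  shows "p x = p (k *\<^sub>R vector [a, b, c])"
proof -
  obtain v where v: "v \<in> orbit a b c" "x = k *\<^sub>R v" using assms(2) by blast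
  from v(1) have "p (k *\<^sub>R v) = p (k *\<^sub>R vector [a, b, c])"
  proof (induction rule: orbit_induct)
    case (flip x) thus ?case using assms(1)
      by (simp add: pyritohedral_form_def flip: isometry_scale[OF flip_orthogonal])
  next
    case (cyc x) thus ?case using assms(1)
      by (simp add: pyritohedral_form_def flip: isometry_scale[OF cyc_orthogonal])
  qed simp
  thus ?thesis by (simp add: v)
qed

lemma arc_integral_invariant:
  assumes "orthogonal_transformation g" "\<And>x. p (g x) = p x"
  shows "arc_integral (g x) (g y) p = arc_integral x y p"
  using assms by (simp add: arc_integral_isometry)

text \<open>
  The group acts transitively on the orbit of \<open>(a, b, c)\<close>.  So a statement about all edges reduces to
  the edges at the single vertex \<open>(a, b, c)\<close>.
\<close>

lemma arc_integral_orbit: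
  assumes p: "pyritohedral_form p" and W: "finite W" "pyritohedral W"
    and base: "\<And>y. y \<in> W \<Longrightarrow> (k *\<^sub>R vector [a, b, c]) \<bullet> y = d \<Longrightarrow>
      arc_integral (k *\<^sub>R vector [a, b, c]) y p = J"
    and x: "x \<in> (*\<^sub>R) k ` orbit a b c" and y: "y \<in> W" "x \<bullet> y = d"
  shows "arc_integral x y p = J"
proof -
  define Q where "Q v \<longleftrightarrow> (\<forall>y\<in>W. (k *\<^sub>R v) \<bullet> y = d \<longrightarrow> arc_integral (k *\<^sub>R v) y p = J)" for v
  have step: "Q (g v)" if Q: "Q v" and g: "orthogonal_transformation g" "g ` W \<subseteq> W" "\<And>x. p (g x) = p x" for g v
    unfolding Q_def
  proof (intro ballI impI)
    fix y assume y: "y \<in> W" "(k *\<^sub>R g v) \<bullet> y = d"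
    have "inj_on g W" using orthogonal_transformation_inj[OF g(1)] by (rule inj_on_subset) simp
    hence "g ` W = W" by (rule endo_inj_surj[OF W(1) g(2)])
    then obtain z where z: "z \<in> W" "y = g z" using y(1) by blast
    have "(k *\<^sub>R v) \<bullet> z = d"
      using y(2) g(1) by (simp add: z orthogonal_transformation_def)
    hence "arc_integral (k *\<^sub>R v) z p = J" using Q z(1) by (simp add: Q_def)
    thus "arc_integral (k *\<^sub>R g v) y p = J"
      using arc_integral_invariant[where p = p, OF g(1,3), of "k *\<^sub>R v" z] by (simp add: z isometry_scale[OF g(1)])
  qed
  obtain v where v: "v \<in> orbit a b c" "x = k *\<^sub>R v" using x by blast
  from v(1) have "Q v"
  proof (induction rule: orbit_induct)
    case base thus ?case using assms(4) by (simp add: Q_def)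
  next
    case (flip v) thus ?case
      using W(2) p step[OF flip flip_orthogonal] by (simp add: pyritohedral_def pyritohedral_form_def)
  next
    case (cyc v) thus ?case
      using W(2) p step[OF cyc cyc_orthogonal] by (simp add: pyritohedral_def pyritohedral_form_def)
  qed
  thus ?thesis using y by (simp add: Q_def v)
qed

text \<open>
  Restricted to a great circle in a mirror plane, the forms become polynomials in \<open>(cos u)\<^sup>2\<close> of degree
  at most 3.  Their primitives are parametrized by \<open>A\<close>, \<open>a\<close>, \<open>b\<close>, \<open>d\<close>; comparing coefficients
  determines the parameters.
\<close>

lemma sin_cos_primitive:
  "((\<lambda>u. A * u + sin u * cos u * (a + b * (cos u)\<^sup>2 + d * cos u ^ 4)) has_real_derivative
     (A - a) + (2 * a - 3 * b) * (cos u)\<^sup>2 + (4 * b - 5 * d) * cos u ^ 4 + 6 * d * cos u ^ 6) (at u)"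
proof -
  have s: "sin u * sin u = 1 - cos u * cos u"
    using sin_squared_eq[of u] by (simp add: power2_eq_square)
  have s': "sin u * (sin u * x) = x - cos u * (cos u * x)" for x
    using s by (metis (no_types, opaque_lifting) left_diff_distrib mult.assoc mult_1)
  show ?thesis
    by (auto intro!: derivative_eq_intros) (simp add: eval_nat_numeral algebra_simps s s')
qed

lemma arc_integral_even_trig_polynomial:
  fixes m w :: "real^3"
  assumes mw: "m \<bullet> m = 1" "w \<bullet> w = 1" "m \<bullet> w = 0" and \<alpha>: "\<alpha>1 < \<alpha>2" "\<alpha>2 < \<alpha>1 + pi"
    and x: "x = cos \<alpha>1 *\<^sub>R m + sin \<alpha>1 *\<^sub>R w" and y: "y = cos \<alpha>2 *\<^sub>R m + sin \<alpha>2 *\<^sub>R w"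
    and p: "\<And>u. p (cos u *\<^sub>R m + sin u *\<^sub>R w) =
      (A - a) + (2 * a - 3 * b) * (cos u)\<^sup>2 + (4 * b - 5 * d) * cos u ^ 4 + 6 * d * cos u ^ 6"
  shows "arc_integral x y p = A * arccos (x \<bullet> y) +
    sin \<alpha>2 * cos \<alpha>2 * (a + b * (cos \<alpha>2)\<^sup>2 + d * cos \<alpha>2 ^ 4) -
    sin \<alpha>1 * cos \<alpha>1 * (a + b * (cos \<alpha>1)\<^sup>2 + d * cos \<alpha>1 ^ 4)"
  unfolding arccos_great_circle[OF mw \<alpha> x y]
    arc_integral_great_circle[of m w \<alpha>1 \<alpha>2 x y _ p, OF mw \<alpha> x y sin_cos_primitive[of A a b d, folded p]]
  by (simp add: algebra_simps)

lemma quadrant_angle: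
  fixes p q :: real
  assumes "0 < p" "0 < q" "p\<^sup>2 + q\<^sup>2 = 1"
  obtains \<alpha> where "0 < \<alpha>" "\<alpha> < pi / 2" "cos \<alpha> = p" "sin \<alpha> = q"
proof (rule that[of "arccos p"])
  have "p < 1"
  proof (rule ccontr)
    assume "\<not> p < 1"
    hence "p\<^sup>2 \<ge> 1" by simp
    thus False using assms by (smt (verit) zero_less_power2)
  qed
  show "cos (arccos p) = p" using assms \<open>p < 1\<close> by (intro cos_arccos) auto
  have "sin (arccos p) = sqrt (1 - p\<^sup>2)" using assms \<open>p < 1\<close> by (intro sin_arccos) auto
  also have "1 - p\<^sup>2 = q\<^sup>2" using assms by simp
  finally show "sin (arccos p) = q" using assms by simp
  show "0 < arccos p" using assms \<open>p < 1\<close> arccos_lt_bounded[of p] by auto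
  show "arccos p < pi / 2" using assms \<open>p < 1\<close> arccos_less_arccos[of 0 p] by simp
qed

context edge_design begin

lemma pyritohedral_functional_defect:
  assumes "pyritohedral V" "pyritohedral W" "pyritohedral X"
  shows "pyritohedral_functional defect"
proof
  fix p :: "real^3 \<Rightarrow> real" assume p: "continuous_on S2 p"
  show "defect (\<lambda>x. p (cyc x)) = defect p" "defect (\<lambda>x. p (flip x)) = defect p"
    using assms p by (auto simp: pyritohedral_def intro!: defect_isometry cyc_orthogonal flip_orthogonal)
qed

text \<open>
  It remains to check three numbers: the value \<open>a\<close> of the form on \<open>X\<close>, its integral \<open>J\<close> over
  an edge, and its mean value on the sphere, here \<open>3/5\<close>.
\<close>

lemma hybrid_5_design:
  assumes "pyritohedral V" "pyritohedral W" "pyritohedral X"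
    and X: "\<And>x. x \<in> X \<Longrightarrow> quartic_form x = a"
    and arcs: "\<And>x y. x \<in> V \<Longrightarrow> y \<in> W \<Longrightarrow> x \<bullet> y = c \<Longrightarrow> arc_integral x y quartic_form = J"
    and balance: "\<beta> * a + (1 - \<beta>) * (J / arccos c) = 3 / 5"
    and \<gamma>: "induced_cycle U E \<gamma>"
  shows "hybrid_design 5 \<beta> \<gamma> X"
proof (rule hybrid_design[OF \<gamma>])
  interpret D: pyritohedral_functional defect
    by (rule pyritohedral_functional_defect) fact+
  have "integral\<^sup>L sphere_measure quartic_form = 3 / 5"
    by (simp add: sphere.L_quartic_form sphere_integral_x4)
  hence q: "defect quartic_form = 0"
    by - (rule defect_eq_0, erule X, erule (2) arcs, erule ssubst, rule balance)
  show "defect p = 0" if "p \<in> Pol 5" for p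
    by (rule D.L_Pol_5_eq_0[OF _ _ that]) (use q in \<open>simp_all add: defect_1 D.L_quartic_form\<close>)
qed

lemma hybrid_9_design:
  assumes "pyritohedral V" "pyritohedral W" "pyritohedral X"
    and golden: "golden_reflection ` V \<subseteq> V" "golden_reflection ` W \<subseteq> W" "golden_reflection ` X \<subseteq> X"
    and X: "\<And>x. x \<in> X \<Longrightarrow> icosahedral_form x = a"
    and arcs: "\<And>x y. x \<in> V \<Longrightarrow> y \<in> W \<Longrightarrow> x \<bullet> y = c \<Longrightarrow> arc_integral x y icosahedral_form = J"
    and balance: "\<beta> * a + (1 - \<beta>) * (J / arccos c) = 6 * (20 * \<phi> + 15) / 7"
    and \<gamma>: "induced_cycle U E \<gamma>"
  shows "hybrid_design 9 \<beta> \<gamma> X"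
proof (rule hybrid_design[OF \<gamma>])
  interpret D: pyritohedral_functional defect
    by (rule pyritohedral_functional_defect) fact+
  interpret D: icosahedral_functional defect
    by standard (rule defect_isometry[OF golden_reflection_orthogonal golden])
  have q: "defect icosahedral_form = 0"
    by (rule defect_eq_0, erule X, erule (2) arcs, unfold sphere_integral_icosahedral_form, rule balance)
  show "defect p = 0" if "p \<in> Pol 9" for p
    by (rule D.L_Pol_9_eq_0[OF defect_1 q that])
qed

end

text \<open>
  Clearing denominators turns the balance condition for \<open>\<beta> = N / D\<close> into a polynomial identity.
\<close>

lemma balance_quotient:
  fixes N D a J S \<theta> :: real
  assumes "D \<noteq> 0" "\<theta> \<noteq> 0" "N * a * \<theta> + (D - N) * J = S * D * \<theta>"
  shows "N / D * a + (1 - N / D) * (J / \<theta>) = S"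
proof -
  have "N / D * a + (1 - N / D) * (J / \<theta>) = (N * a * \<theta> + (D - N) * J) / (D * \<theta>)"
    using assms(1,2) by (simp add: field_simps)
  thus ?thesis using assms by simp
qed

lemma vertices_on_sphere:
  "octahedron \<subseteq> S2" "cube \<subseteq> S2" "cuboctahedron \<subseteq> S2" "icosahedron \<subseteq> S2" "dodecahedron \<subseteq> S2"
  "icosidodecahedron \<subseteq> S2"
  unfolding vertex_sets image_Un Un_subset_iff
  using scaled_orbit_on_sphere[of 1 1 0 0] scaled_orbit_on_sphere[of "sqrt 3" 1 1 1]
    scaled_orbit_on_sphere[of "sqrt 2" 1 1 0] scaled_orbit_on_sphere[of "sqrt (\<phi> + 2)" \<phi> 1 0]
    scaled_orbit_on_sphere[of "sqrt 3" \<phi> 0 "\<phi> - 1"]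
    scaled_orbit_on_sphere[of 2 2 0 0] scaled_orbit_on_sphere[of 2 \<phi> "\<phi> - 1" 1] phi_gt
  by (simp_all add: phi_powers power2_diff)

lemma finite_vertices:
  "finite octahedron" "finite cube" "finite cuboctahedron" "finite icosahedron" "finite dodecahedron"
  "finite icosidodecahedron"
  by (simp_all add: vertex_sets finite_orbit)

lemma pyritohedral_vertices:
  "pyritohedral octahedron" "pyritohedral cube" "pyritohedral cuboctahedron"
  "pyritohedral icosahedron" "pyritohedral dodecahedron" "pyritohedral icosidodecahedron"
  unfolding vertex_sets by (intro pyritohedral_scale pyritohedral_Un pyritohedral_orbit)+

lemma golden_reflection_vertices:
  "golden_reflection ` icosahedron \<subseteq> icosahedron" "golden_reflection ` dodecahedron \<subseteq> dodecahedron"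
  "golden_reflection ` icosidodecahedron \<subseteq> icosidodecahedron"
  unfolding vertex_sets
  by (intro image_scale_subset golden_reflection_orthogonal golden_reflection_icosahedron
      golden_reflection_dodecahedron golden_reflection_icosidodecahedron)+

lemma base_vertex:
  "vector [a, b, c] \<in> orbit a b c" "vector [b, c, a] \<in> orbit a b c" "vector [c, a, b] \<in> orbit a b c"
  by (simp_all add: mem_orbit_iff mem_pm_iff)

lemma nonempty_vertices:
  "cube \<noteq> {}" "octahedron \<noteq> {}" "cuboctahedron \<noteq> {}" "icosahedron \<noteq> {}" "dodecahedron \<noteq> {}" "icosidodecahedron \<noteq> {}"
  unfolding vertex_sets using base_vertex by blast+

text \<open>
  These moves act on both end points of an arc at once.  With the exchange of the end points they
  lead from one reference arc to all edges at a vertex of the octahedral polytopes; for the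
  icosahedral ones the golden reflection has to be added.
\<close>

lemma arc_integral_neg1:
  assumes "pyritohedral_form p"
  shows "arc_integral (k *\<^sub>R vector [- a, b, c]) (s *\<^sub>R vector [- a', b', c']) p =
    arc_integral (k *\<^sub>R vector [a, b, c]) (s *\<^sub>R vector [a', b', c']) p"
  using arc_integral_invariant[OF flip_orthogonal, of p "k *\<^sub>R vector [a, b, c]" "s *\<^sub>R vector [a', b', c']"] assms
  by (simp add: isometry_scale flip_orthogonal flip_vector pyritohedral_form_def)

lemma arc_integral_rotate:
  assumes "pyritohedral_form p"
  shows "arc_integral (k *\<^sub>R vector [b, c, a]) (s *\<^sub>R vector [b', c', a']) p =
    arc_integral (k *\<^sub>R vector [a, b, c]) (s *\<^sub>R vector [a', b', c']) p"
  using arc_integral_invariant[OF cyc_orthogonal, of p "k *\<^sub>R vector [a, b, c]" "s *\<^sub>R vector [a', b', c']"] assms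
  by (simp add: isometry_scale cyc_orthogonal cyc_vector pyritohedral_form_def)

lemma arc_integral_neg2:
  assumes "pyritohedral_form p"
  shows "arc_integral (k *\<^sub>R vector [a, - b, c]) (s *\<^sub>R vector [a', - b', c']) p =
    arc_integral (k *\<^sub>R vector [a, b, c]) (s *\<^sub>R vector [a', b', c']) p"
  by (metis assms arc_integral_neg1 arc_integral_rotate)

lemma arc_integral_neg3:
  assumes "pyritohedral_form p"
  shows "arc_integral (k *\<^sub>R vector [a, b, - c]) (s *\<^sub>R vector [a', b', - c']) p =
    arc_integral (k *\<^sub>R vector [a, b, c]) (s *\<^sub>R vector [a', b', c']) p"
  by (metis assms arc_integral_neg1 arc_integral_rotate)

lemma arc_integral_swap:
  assumes "x \<in> S2" "y \<in> S2" "-1 < x \<bullet> y" "x \<bullet> y < 1"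
  shows "arc_integral y x p = arc_integral x y p"
proof (rule arc_integral_commute[OF assms(1,2)])
  show "y \<noteq> x" "y \<noteq> - x"
    using assms by (auto simp: dot_square_norm)
qed

section \<open>Octahedron, cube and rhombic dodecahedron\<close>

text \<open>
  Here \<open>cos\<^sup>4 + sin\<^sup>4 = 1 - 2 cos\<^sup>2 + 2 cos\<^sup>4\<close> yields the parameters \<open>A = 3/4\<close>, \<open>a = -1/4\<close>, \<open>b = 1/2\<close>, \<open>d = 0\<close> of the
  primitive.
\<close>

lemma quartic_arc_coordinate_plane:
  "arc_integral (1 *\<^sub>R vector [1, 0, 0]) (1 *\<^sub>R vector [0, 1, 0]) quartic_form = 3 * pi / 8"
proof -
  let ?m = "vector [1, 0, 0] :: real^3" and ?w = "vector [0, 1, 0] :: real^3"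
  have q: "quartic_form (cos u *\<^sub>R ?m + sin u *\<^sub>R ?w) =
      (3 / 4 - - 1 / 4) + (2 * (- 1 / 4) - 3 * (1 / 2)) * (cos u)\<^sup>2 + (4 * (1 / 2) - 5 * 0) * cos u ^ 4
        + 6 * 0 * cos u ^ 6" for u
  proof -
    have "sin u ^ 4 = (1 - (cos u)\<^sup>2)\<^sup>2" by (simp flip: sin_squared_eq)
    thus ?thesis by (simp add: quartic_form_def power2_eq_square eval_nat_numeral algebra_simps)
  qed
  show ?thesis
    using arc_integral_even_trig_polynomial[of ?m ?w 0 "pi / 2" "1 *\<^sub>R ?m" "1 *\<^sub>R ?w", OF _ _ _ _ _ _ _ q]
    by (simp add: inner3)
qed

lemma quartic_edge_octahedron:
  assumes "x \<in> octahedron" "y \<in> octahedron" "x \<bullet> y = 0"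
  shows "arc_integral x y quartic_form = 3 * pi / 8"
proof (rule arc_integral_orbit[OF pyritohedral_quartic_form finite_vertices(1) pyritohedral_vertices(1)])
  show "x \<in> (*\<^sub>R) 1 ` orbit 1 0 0" using assms by (simp add: octahedron_eq)
next
  fix y assume "y \<in> octahedron" and d: "(1 *\<^sub>R vector [1, 0, 0]) \<bullet> y = 0"
  then obtain v where v: "v \<in> orbit 1 0 0" "y = 1 *\<^sub>R v" by (auto simp: octahedron_eq)
  have v': "v = vector [0, 1, 0] \<or> v = vector [0, - 1, 0] \<or> v = vector [0, 0, 1] \<or> v = vector [0, 0, - 1]"
    using v d unfolding mem_orbit_iff mem_pm_iff by (auto simp: inner3 vec3_eq_iff)
  let ?I = "\<lambda>v w. arc_integral (1 *\<^sub>R v) (1 *\<^sub>R w) quartic_form"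
  note p = pyritohedral_quartic_form
  have 1: "?I (vector [1, 0, 0]) (vector [0, 1, 0]) = 3 * pi / 8"
    by (rule quartic_arc_coordinate_plane)
  have 2: "?I (vector [1, 0, 0]) (vector [0, - 1, 0]) = 3 * pi / 8"
    using 1 arc_integral_neg2[OF p, of 1 1 0 0 1 0 1 0] by simp
  have "?I (vector [0, 0, 1]) (vector [1, 0, 0]) = 3 * pi / 8"
    using 1 arc_integral_rotate[OF p, of 1 0 0 1 1 1 0 0] by simp
  hence 3: "?I (vector [1, 0, 0]) (vector [0, 0, 1]) = 3 * pi / 8"
    by (subst arc_integral_swap) (simp_all add: inner3 norm_eq_sqrt_inner)
  have 4: "?I (vector [1, 0, 0]) (vector [0, 0, - 1]) = 3 * pi / 8"
    using 3 arc_integral_neg3[OF p, of 1 1 0 0 1 0 0 1] by simp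
  show "arc_integral (1 *\<^sub>R vector [1, 0, 0]) y quartic_form = 3 * pi / 8"
    using v' 1 2 3 4 by (auto simp: v)
qed (use assms in simp_all)

lemma quartic_values:
  "x \<in> octahedron \<Longrightarrow> quartic_form x = 1" "x \<in> cube \<Longrightarrow> quartic_form x = 1 / 3"
  "x \<in> cuboctahedron \<Longrightarrow> quartic_form x = 1 / 2"
  unfolding vertex_sets
  by (rule trans[OF form_on_scaled_orbit[OF pyritohedral_quartic_form]], assumption,
      simp add: quartic_form_def power_divide power4_eq_xxxx)+

theorem octahedron_cube_design:
  assumes "induced_cycle octahedron octahedron_edges \<gamma>"
  shows "hybrid_design 5 (9 / 25) \<gamma> cube"
proof -
  interpret edge_design octahedron octahedron cube 0 "9 / 25"
  proof
    show "\<exists>x\<in>octahedron. \<exists>y\<in>octahedron. x \<bullet> y = 0"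
      by (rule bexI[of _ "vector [1, 0, 0]"], rule bexI[of _ "vector [0, 1, 0]"])
        (simp_all add: octahedron_eq base_vertex inner3 mem_orbit_iff mem_pm_iff)
  qed (simp_all add: finite_vertices vertices_on_sphere nonempty_vertices)
  show ?thesis
    by (rule hybrid_5_design[where U = octahedron, OF _ _ _ quartic_values(2) quartic_edge_octahedron])
      (use assms in \<open>simp_all add: pyritohedral_vertices octahedron_edges_def\<close>)
qed

lemma diagonal_plane_angle:
  obtains \<alpha> where "0 < \<alpha>" "\<alpha> < pi / 2" "cos \<alpha> = sqrt 2 / sqrt 3" "sin \<alpha> = 1 / sqrt 3"
  by (rule quadrant_angle[of "sqrt 2 / sqrt 3" "1 / sqrt 3"]) (simp_all add: power_divide)

text \<open>
  The mirror plane \<open>x = y\<close> contains the cube edge from \<open>(1, 1, -1)\<close> to \<open>(1, 1, 1)\<close> and the edge of the rhombic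
  dodecahedron from \<open>(1, 1, 1)\<close> to \<open>(0, 0, 1)\<close>, up to scaling.  The restriction of the form is
  \<open>1 - 2 cos\<^sup>2 + 3/2 cos\<^sup>4\<close>.
\<close>

lemma quartic_form_diagonal_plane:
  "quartic_form (cos u *\<^sub>R vector [1 / sqrt 2, 1 / sqrt 2, 0] + sin u *\<^sub>R vector [0, 0, 1]) =
      (9 / 16 - - 7 / 16) + (2 * (- 7 / 16) - 3 * (3 / 8)) * (cos u)\<^sup>2 + (4 * (3 / 8) - 5 * 0) * cos u ^ 4
        + 6 * 0 * cos u ^ 6"
proof -
  have "sin u ^ 4 = (1 - (cos u)\<^sup>2)\<^sup>2" by (simp flip: sin_squared_eq)
  moreover have "sqrt 2 ^ 4 = 4" by (simp add: power4_eq_xxxx)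
  ultimately show ?thesis
    by (simp add: quartic_form_def power_divide power2_eq_square power4_eq_xxxx algebra_simps)
qed

lemma quartic_arc_cube:
  "arc_integral ((1 / sqrt 3) *\<^sub>R vector [1, 1, - 1]) ((1 / sqrt 3) *\<^sub>R vector [1, 1, 1]) quartic_form =
     9 / 16 * arccos (1 / 3) - sqrt 2 / 8"
proof -
  obtain \<alpha> where \<alpha>: "0 < \<alpha>" "\<alpha> < pi / 2" "cos \<alpha> = sqrt 2 / sqrt 3" "sin \<alpha> = 1 / sqrt 3"
    by (rule diagonal_plane_angle)
  let ?m = "vector [1 / sqrt 2, 1 / sqrt 2, 0] :: real^3" and ?w = "vector [0, 0, 1] :: real^3"
  let ?x = "(1 / sqrt 3) *\<^sub>R vector [1, 1, - 1] :: real^3" and ?y = "(1 / sqrt 3) *\<^sub>R vector [1, 1, 1] :: real^3"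
  have "arc_integral ?x ?y quartic_form = 9 / 16 * arccos (?x \<bullet> ?y) +
      sin \<alpha> * cos \<alpha> * (- 7 / 16 + 3 / 8 * (cos \<alpha>)\<^sup>2 + 0 * cos \<alpha> ^ 4) -
      sin (- \<alpha>) * cos (- \<alpha>) * (- 7 / 16 + 3 / 8 * (cos (- \<alpha>))\<^sup>2 + 0 * cos (- \<alpha>) ^ 4)"
    by (rule arc_integral_even_trig_polynomial[of ?m ?w, OF _ _ _ _ _ _ _ quartic_form_diagonal_plane])
      (use \<alpha> in \<open>simp_all add: inner3 vec3_eq_iff\<close>)
  moreover have "?x \<bullet> ?y = 1 / 3" by (simp add: inner3)
  ultimately show ?thesis by (simp add: \<alpha> power_divide)
qed

lemma quartic_arc_rhombic_dodecahedron:
  "arc_integral ((1 / sqrt 3) *\<^sub>R vector [1, 1, 1]) (1 *\<^sub>R vector [0, 0, 1]) quartic_form =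
     9 / 16 * arccos (1 / sqrt 3) + sqrt 2 / 16"
proof -
  obtain \<alpha> where \<alpha>: "0 < \<alpha>" "\<alpha> < pi / 2" "cos \<alpha> = sqrt 2 / sqrt 3" "sin \<alpha> = 1 / sqrt 3"
    by (rule diagonal_plane_angle)
  let ?m = "vector [1 / sqrt 2, 1 / sqrt 2, 0] :: real^3" and ?w = "vector [0, 0, 1] :: real^3"
  let ?x = "(1 / sqrt 3) *\<^sub>R vector [1, 1, 1] :: real^3" and ?y = "1 *\<^sub>R vector [0, 0, 1] :: real^3"
  have "arc_integral ?x ?y quartic_form = 9 / 16 * arccos (?x \<bullet> ?y) +
      sin (pi / 2) * cos (pi / 2) * (- 7 / 16 + 3 / 8 * (cos (pi / 2))\<^sup>2 + 0 * cos (pi / 2) ^ 4) -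
      sin \<alpha> * cos \<alpha> * (- 7 / 16 + 3 / 8 * (cos \<alpha>)\<^sup>2 + 0 * cos \<alpha> ^ 4)"
    by (rule arc_integral_even_trig_polynomial[of ?m ?w, OF _ _ _ _ _ _ _ quartic_form_diagonal_plane])
      (use \<alpha> in \<open>simp_all add: inner3 vec3_eq_iff\<close>)
  moreover have "?x \<bullet> ?y = 1 / sqrt 3" by (simp add: inner3)
  ultimately show ?thesis by (simp add: \<alpha> power_divide)
qed

lemma quartic_edge_cube:
  assumes "x \<in> cube" "y \<in> cube" "x \<bullet> y = 1 / 3"
  shows "arc_integral x y quartic_form = 9 / 16 * arccos (1 / 3) - sqrt 2 / 8"
proof (rule arc_integral_orbit[OF pyritohedral_quartic_form finite_vertices(2) pyritohedral_vertices(2)])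
  show "x \<in> (*\<^sub>R) (1 / sqrt 3) ` orbit 1 1 1" using assms by (simp add: cube_eq)
next
  fix y assume "y \<in> cube" and d: "((1 / sqrt 3) *\<^sub>R vector [1, 1, 1]) \<bullet> y = 1 / 3"
  then obtain v where v: "v \<in> orbit 1 1 1" "y = (1 / sqrt 3) *\<^sub>R v" by (auto simp: cube_eq)
  have "v$1 + v$2 + v$3 = 1" using d by (simp add: v inner3 field_simps)
  hence v': "v = vector [1, 1, - 1] \<or> v = vector [1, - 1, 1] \<or> v = vector [- 1, 1, 1]"
    using v unfolding mem_orbit_iff mem_pm_iff by (auto simp: vec3_eq_iff)
  let ?I = "\<lambda>v w. arc_integral ((1 / sqrt 3) *\<^sub>R v) ((1 / sqrt 3) *\<^sub>R w) quartic_form"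
  let ?J = "9 / 16 * arccos (1 / 3) - sqrt 2 / 8"
  note p = pyritohedral_quartic_form
  have 1: "?I (vector [1, 1, 1]) (vector [1, 1, - 1]) = ?J"
    using quartic_arc_cube arc_integral_neg3[OF p, of "1 / sqrt 3" 1 1 "- 1" "1 / sqrt 3" 1 1 1] by simp
  have 2: "?I (vector [1, 1, 1]) (vector [1, - 1, 1]) = ?J"
    using 1 arc_integral_rotate[OF p, of "1 / sqrt 3" 1 1 1 "1 / sqrt 3" 1 "- 1" 1] by simp
  have 3: "?I (vector [1, 1, 1]) (vector [- 1, 1, 1]) = ?J"
    using 2 arc_integral_rotate[OF p, of "1 / sqrt 3" 1 1 1 "1 / sqrt 3" "- 1" 1 1] by simp
  show "arc_integral ((1 / sqrt 3) *\<^sub>R vector [1, 1, 1]) y quartic_form = ?J"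
    using v' 1 2 3 by (auto simp: v)
qed (use assms in simp_all)

lemma quartic_edge_rhombic_dodecahedron:
  assumes "x \<in> cube" "y \<in> octahedron" "x \<bullet> y = 1 / sqrt 3"
  shows "arc_integral x y quartic_form = 9 / 16 * arccos (1 / sqrt 3) + sqrt 2 / 16"
proof (rule arc_integral_orbit[OF pyritohedral_quartic_form finite_vertices(1) pyritohedral_vertices(1)])
  show "x \<in> (*\<^sub>R) (1 / sqrt 3) ` orbit 1 1 1" using assms by (simp add: cube_eq)
next
  fix y assume "y \<in> octahedron" and d: "((1 / sqrt 3) *\<^sub>R vector [1, 1, 1]) \<bullet> y = 1 / sqrt 3"
  then obtain v where v: "v \<in> orbit 1 0 0" "y = 1 *\<^sub>R v" by (auto simp: octahedron_eq)
  have "v$1 + v$2 + v$3 = 1" using d by (simp add: v inner3 field_simps)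
  hence v': "v = vector [0, 0, 1] \<or> v = vector [0, 1, 0] \<or> v = vector [1, 0, 0]"
    using v unfolding mem_orbit_iff mem_pm_iff by (auto simp: vec3_eq_iff)
  let ?I = "\<lambda>v w. arc_integral ((1 / sqrt 3) *\<^sub>R v) (1 *\<^sub>R w) quartic_form"
  let ?J = "9 / 16 * arccos (1 / sqrt 3) + sqrt 2 / 16"
  note p = pyritohedral_quartic_form
  have 1: "?I (vector [1, 1, 1]) (vector [0, 0, 1]) = ?J"
    by (rule quartic_arc_rhombic_dodecahedron)
  have 2: "?I (vector [1, 1, 1]) (vector [0, 1, 0]) = ?J"
    using 1 arc_integral_rotate[OF p, of "1 / sqrt 3" 1 1 1 1 0 1 0] by simp
  have 3: "?I (vector [1, 1, 1]) (vector [1, 0, 0]) = ?J"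
    using 2 arc_integral_rotate[OF p, of "1 / sqrt 3" 1 1 1 1 1 0 0] by simp
  show "arc_integral ((1 / sqrt 3) *\<^sub>R vector [1, 1, 1]) y quartic_form = ?J"
    using v' 1 2 3 by (auto simp: v)
qed (use assms in simp_all)

theorem cube_octahedron_design:
  assumes "induced_cycle cube cube_edges \<gamma>"
  shows "hybrid_design 5
    ((10 * sqrt 2 + 3 * arccos (1 / 3)) / (10 * sqrt 2 + 35 * arccos (1 / 3))) \<gamma> octahedron"
proof -
  define \<theta> :: real where "\<theta> = arccos (1 / 3)"
  have \<theta>: "0 < \<theta>" using arccos_lt_bounded[of "1 / 3"] by (simp add: \<theta>_def)
  have D: "0 < 10 * sqrt 2 + 35 * \<theta>" using \<theta> by (simp add: add_pos_pos)
  interpret edge_design cube cube octahedron "1 / 3" "(10 * sqrt 2 + 3 * \<theta>) / (10 * sqrt 2 + 35 * \<theta>)"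
  proof
    show "\<exists>x\<in>cube. \<exists>y\<in>cube. x \<bullet> y = 1 / 3"
      by (rule bexI[of _ "(1 / sqrt 3) *\<^sub>R vector [1, 1, 1]"], rule bexI[of _ "(1 / sqrt 3) *\<^sub>R vector [1, 1, - 1]"])
        (auto simp: cube_eq inner3 mem_orbit_iff mem_pm_iff intro!: imageI)
  qed (use \<theta> D in \<open>simp_all add: finite_vertices vertices_on_sphere nonempty_vertices divide_le_eq_1\<close>)
  have "(10 * sqrt 2 + 3 * \<theta>) / (10 * sqrt 2 + 35 * \<theta>) * 1 +
      (1 - (10 * sqrt 2 + 3 * \<theta>) / (10 * sqrt 2 + 35 * \<theta>)) * ((9 / 16 * \<theta> - sqrt 2 / 8) / \<theta>) = 3 / 5"
  proof (rule balance_quotient)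
    show "10 * sqrt 2 + 35 * \<theta> \<noteq> 0" using D by simp
  qed (use \<theta> in \<open>simp_all add: algebra_simps\<close>)
  thus ?thesis
    using hybrid_5_design[where U = cube, OF pyritohedral_vertices(2,2,1) quartic_values(1) quartic_edge_cube] assms
    unfolding \<theta>_def cube_edges_def by blast
qed

theorem rhombic_dodecahedron_cuboctahedron_design:
  assumes "induced_cycle rhombic_dodecahedron rhombic_dodecahedron_edges \<gamma>"
  shows "hybrid_design 5 ((10 - 3 * sqrt 2 * arccos (1 / sqrt 3)) / (10 + 5 * sqrt 2 * arccos (1 / sqrt 3)))
    \<gamma> cuboctahedron"
proof -
  define \<theta> :: real where "\<theta> = arccos (1 / sqrt 3)"
  have c: "- 1 < 1 / sqrt 3" by (rule less_trans[of _ 0]) simp_all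
  have \<theta>: "0 < \<theta>" using arccos_lt_bounded[OF c] by (simp add: \<theta>_def)
  \<comment> \<open>The crude bound \<open>\<theta> < 2\<close> is enough for \<open>\<beta> \<ge> 0\<close>.\<close>
  have "\<theta> \<le> pi / 2" unfolding \<theta>_def by (rule arccos_le_pi2) simp_all
  hence "\<theta> < 2" using pi_less_4 by simp
  have s: "sqrt 2 < 3 / 2" by (rule real_less_lsqrt) (simp_all add: power2_eq_square)
  have "sqrt 2 * \<theta> < 3 / 2 * 2" using \<theta> \<open>\<theta> < 2\<close> s by (intro mult_strict_mono) simp_all
  hence N: "10 - 3 * sqrt 2 * \<theta> \<ge> 0" by simp
  have t: "0 < sqrt 2 * \<theta>" using \<theta> by simp
  have D: "0 < 10 + 5 * sqrt 2 * \<theta>" using t by linarith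
  interpret edge_design cube octahedron cuboctahedron "1 / sqrt 3" "(10 - 3 * sqrt 2 * \<theta>) / (10 + 5 * sqrt 2 * \<theta>)"
  proof
    show "\<exists>x\<in>cube. \<exists>y\<in>octahedron. x \<bullet> y = 1 / sqrt 3"
      by (rule bexI[of _ "(1 / sqrt 3) *\<^sub>R vector [1, 1, 1]"], rule bexI[of _ "vector [1, 0, 0]"])
        (auto simp: cube_eq octahedron_eq inner3 mem_orbit_iff mem_pm_iff intro!: imageI)
    show "0 \<le> (10 - 3 * sqrt 2 * \<theta>) / (10 + 5 * sqrt 2 * \<theta>)"
      using N D by simp
    show "(10 - 3 * sqrt 2 * \<theta>) / (10 + 5 * sqrt 2 * \<theta>) \<le> 1"
      unfolding divide_le_eq_1_pos[OF D] using t by linarith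
    show "- 1 < 1 / sqrt 3" by (rule c)
  qed (simp_all add: finite_vertices vertices_on_sphere nonempty_vertices)
  have "(10 - 3 * sqrt 2 * \<theta>) / (10 + 5 * sqrt 2 * \<theta>) * (1 / 2) +
      (1 - (10 - 3 * sqrt 2 * \<theta>) / (10 + 5 * sqrt 2 * \<theta>)) * ((9 / 16 * \<theta> + sqrt 2 / 16) / \<theta>) = 3 / 5"
  proof (rule balance_quotient)
    show "10 + 5 * sqrt 2 * \<theta> \<noteq> 0" using t by simp
  qed (use \<theta> in \<open>simp_all add: algebra_simps\<close>)
  thus ?thesis
    using hybrid_5_design[where U = rhombic_dodecahedron, OF pyritohedral_vertices(2,1,3) quartic_values(3)
        quartic_edge_rhombic_dodecahedron] assms
    unfolding \<theta>_def rhombic_dodecahedron_edges_def by blast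
qed

section \<open>Icosahedron, dodecahedron and rhombic triacontahedron\<close>

text \<open>
  The coordinate plane \<open>z = 0\<close> is a mirror plane of the icosahedron.  Its great circle contains an edge of
  each of the three polytopes: starting from the first axis it meets the vertex \<open>(\<phi>, 1, 0)\<close> of
  the icosahedron, the vertex \<open>(\<phi> - 1, \<phi>, 0)\<close> of the dodecahedron, and then the second axis.  One
  primitive therefore serves for all of them.
\<close>

lemma icosahedral_form_coordinate_plane:
  "icosahedral_form (cos u *\<^sub>R vector [1, 0, 0] + sin u *\<^sub>R vector [0, 1, 0]) =
      (35 / 8 * (3 + 4 * \<phi>) - 3 / 8 * (3 + 4 * \<phi>)) +
      (2 * (3 / 8 * (3 + 4 * \<phi>)) - 3 * (11 / 4 + 7 * \<phi>)) * (cos u)\<^sup>2 +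
      (4 * (11 / 4 + 7 * \<phi>) - 5 * (- 5 - 10 * \<phi>)) * cos u ^ 4 +
      6 * (- 5 - 10 * \<phi>) * cos u ^ 6"
proof -
  define c where "c = cos u"
  define s where "s = sin u"
  have binomial: "(x + y) ^ 6 + (x - y) ^ 6 = 2 * x ^ 6 + 30 * x ^ 4 * y\<^sup>2 + 30 * x\<^sup>2 * y ^ 4 + 2 * y ^ 6"
    for x y :: real
    by (simp add: eval_nat_numeral algebra_simps)
  have s2: "s\<^sup>2 = 1 - c\<^sup>2" by (simp add: s_def c_def sin_squared_eq)
  have s4: "s ^ 4 = 1 - 2 * c\<^sup>2 + c ^ 4"
    using power_mult[of s 2 2] by (simp add: s2 power2_diff flip: power_mult)
  have s6: "s ^ 6 = 1 - 3 * c\<^sup>2 + 3 * c ^ 4 - c ^ 6"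
  proof -
    have "s ^ 6 = s ^ 4 * s\<^sup>2" by (simp flip: power_add)
    thus ?thesis unfolding s4 s2 by (simp add: eval_nat_numeral algebra_simps)
  qed
  have "icosahedral_form (c *\<^sub>R vector [1, 0, 0] + s *\<^sub>R vector [0, 1, 0]) =
      ((\<phi> * c + s) ^ 6 + (\<phi> * c - s) ^ 6) + 2 * \<phi> ^ 6 * s ^ 6 + 2 * c ^ 6"
    by (simp add: icosahedral_form_def power_mult_distrib)
  also have "\<dots> = 2 * \<phi> ^ 6 * c ^ 6 + 30 * \<phi> ^ 4 * c ^ 4 * s\<^sup>2 + 30 * \<phi>\<^sup>2 * c\<^sup>2 * s ^ 4 + 2 * s ^ 6
      + 2 * \<phi> ^ 6 * s ^ 6 + 2 * c ^ 6"
    unfolding binomial by (simp add: power_mult_distrib)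
  also have "\<dots> = (35 / 8 * (3 + 4 * \<phi>) - 3 / 8 * (3 + 4 * \<phi>)) +
      (2 * (3 / 8 * (3 + 4 * \<phi>)) - 3 * (11 / 4 + 7 * \<phi>)) * c\<^sup>2 +
      (4 * (11 / 4 + 7 * \<phi>) - 5 * (- 5 - 10 * \<phi>)) * c ^ 4 +
      6 * (- 5 - 10 * \<phi>) * c ^ 6"
    unfolding s2 s4 s6 phi_powers by (simp add: eval_nat_numeral algebra_simps)
  finally show ?thesis by (simp add: c_def s_def)
qed

lemma icosahedron_angle:
  obtains \<alpha> where "0 < \<alpha>" "\<alpha> < pi / 2" "cos \<alpha> = \<phi> / sqrt (\<phi> + 2)" "sin \<alpha> = 1 / sqrt (\<phi> + 2)"
    "sin \<alpha> * cos \<alpha> = (2 * \<phi> - 1) / 5" "(cos \<alpha>)\<^sup>2 = (\<phi> + 2) / 5" "cos \<alpha> ^ 4 = (\<phi> + 1) / 5"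
proof (rule quadrant_angle[of "\<phi> / sqrt (\<phi> + 2)" "1 / sqrt (\<phi> + 2)"])
  have pos: "\<phi> + 2 > 0" using phi_gt by simp
  show "0 < \<phi> / sqrt (\<phi> + 2)" "0 < 1 / sqrt (\<phi> + 2)" using phi_gt by simp_all
  show "(\<phi> / sqrt (\<phi> + 2))\<^sup>2 + (1 / sqrt (\<phi> + 2))\<^sup>2 = 1"
    using pos by (simp add: power_divide phi_powers field_simps)
  fix \<alpha> assume \<alpha>: "0 < \<alpha>" "\<alpha> < pi / 2" "cos \<alpha> = \<phi> / sqrt (\<phi> + 2)" "sin \<alpha> = 1 / sqrt (\<phi> + 2)"
  have "sin \<alpha> * cos \<alpha> = \<phi> / (\<phi> + 2)" using pos by (simp add: \<alpha>)
  also have "\<dots> = (2 * \<phi> - 1) / 5" using pos by (simp add: field_simps phi_mult)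
  finally have sc: "sin \<alpha> * cos \<alpha> = (2 * \<phi> - 1) / 5" .
  have "(cos \<alpha>)\<^sup>2 = (\<phi> + 1) / (\<phi> + 2)" using pos by (simp add: \<alpha> power_divide phi_powers)
  also have "\<dots> = (\<phi> + 2) / 5" using pos by (simp add: field_simps phi_mult)
  finally have c2: "(cos \<alpha>)\<^sup>2 = (\<phi> + 2) / 5" .
  have "cos \<alpha> ^ 4 = ((cos \<alpha>)\<^sup>2)\<^sup>2" by simp
  also have "\<dots> = (\<phi> + 1) / 5" unfolding c2 by (simp add: power2_eq_square field_simps phi_mult)
  finally show ?thesis using that \<alpha> sc c2 by blast
qed

lemma dodecahedron_angle:
  obtains \<alpha> where "0 < \<alpha>" "\<alpha> < pi / 2" "cos \<alpha> = (\<phi> - 1) / sqrt 3" "sin \<alpha> = \<phi> / sqrt 3"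
    "sin \<alpha> * cos \<alpha> = 1 / 3" "(cos \<alpha>)\<^sup>2 = (2 - \<phi>) / 3" "cos \<alpha> ^ 4 = (5 - 3 * \<phi>) / 9"
proof (rule quadrant_angle[of "(\<phi> - 1) / sqrt 3" "\<phi> / sqrt 3"])
  show "0 < (\<phi> - 1) / sqrt 3" "0 < \<phi> / sqrt 3" using phi_gt by simp_all
  have sq: "(\<phi> - 1)\<^sup>2 = 2 - \<phi>" by (simp add: power2_eq_square algebra_simps phi_mult)
  show "((\<phi> - 1) / sqrt 3)\<^sup>2 + (\<phi> / sqrt 3)\<^sup>2 = 1"
    by (simp add: power_divide phi_powers sq field_simps)
  fix \<alpha> assume \<alpha>: "0 < \<alpha>" "\<alpha> < pi / 2" "cos \<alpha> = (\<phi> - 1) / sqrt 3" "sin \<alpha> = \<phi> / sqrt 3"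
  have sc: "sin \<alpha> * cos \<alpha> = 1 / 3" by (simp add: \<alpha> algebra_simps phi_mult)
  have c2: "(cos \<alpha>)\<^sup>2 = (2 - \<phi>) / 3" by (simp add: \<alpha> power_divide sq)
  have "cos \<alpha> ^ 4 = ((cos \<alpha>)\<^sup>2)\<^sup>2" by simp
  also have "\<dots> = (5 - 3 * \<phi>) / 9" unfolding c2 by (simp add: power2_eq_square field_simps phi_mult)
  finally show ?thesis using that \<alpha> sc c2 by blast
qed

text \<open>
  The non-linear part of the primitive at the two vertices in the plane \<open>z = 0\<close>.
\<close>

lemma icosahedral_primitive_values:
  "(2 * \<phi> - 1) / 5 * (3 / 8 * (3 + 4 * \<phi>) + (11 / 4 + 7 * \<phi>) * ((\<phi> + 2) / 5) + (- 5 - 10 * \<phi>) * ((\<phi> + 1) / 5))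
    = (3 + 4 * \<phi>) / 8"
  "1 / 3 * (3 / 8 * (3 + 4 * \<phi>) + (11 / 4 + 7 * \<phi>) * ((2 - \<phi>) / 3) + (- 5 - 10 * \<phi>) * ((5 - 3 * \<phi>) / 9))
    = 85 / 216 * (1 + 2 * \<phi>)"
  by (simp_all add: field_simps phi_mult)

lemma icosahedral_arc_icosahedron:
  "arc_integral ((1 / sqrt (\<phi> + 2)) *\<^sub>R vector [\<phi>, - 1, 0]) ((1 / sqrt (\<phi> + 2)) *\<^sub>R vector [\<phi>, 1, 0]) icosahedral_form =
     35 / 8 * (3 + 4 * \<phi>) * arccos (1 / sqrt 5) + (3 + 4 * \<phi>) / 4" (is "?I = _")
proof -
  obtain \<alpha> where \<alpha>: "0 < \<alpha>" "\<alpha> < pi / 2" "cos \<alpha> = \<phi> / sqrt (\<phi> + 2)" "sin \<alpha> = 1 / sqrt (\<phi> + 2)"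
    and v: "sin \<alpha> * cos \<alpha> = (2 * \<phi> - 1) / 5" "(cos \<alpha>)\<^sup>2 = (\<phi> + 2) / 5" "cos \<alpha> ^ 4 = (\<phi> + 1) / 5"
    by (rule icosahedron_angle)
  let ?m = "vector [1, 0, 0] :: real^3" and ?w = "vector [0, 1, 0] :: real^3"
  let ?x = "(1 / sqrt (\<phi> + 2)) *\<^sub>R vector [\<phi>, - 1, 0] :: real^3"
  let ?y = "(1 / sqrt (\<phi> + 2)) *\<^sub>R vector [\<phi>, 1, 0] :: real^3"
  let ?P = "\<lambda>u. 3 / 8 * (3 + 4 * \<phi>) + (11 / 4 + 7 * \<phi>) * (cos u)\<^sup>2 + (- 5 - 10 * \<phi>) * cos u ^ 4"
  have I: "?I = 35 / 8 * (3 + 4 * \<phi>) * arccos (?x \<bullet> ?y) +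
      sin \<alpha> * cos \<alpha> * ?P \<alpha> - sin (- \<alpha>) * cos (- \<alpha>) * ?P (- \<alpha>)"
    by (rule arc_integral_even_trig_polynomial[of ?m ?w, OF _ _ _ _ _ _ _ icosahedral_form_coordinate_plane])
      (use \<alpha> in \<open>simp_all add: inner3 vec3_eq_iff\<close>)
  have "?x \<bullet> ?y = (1 / sqrt (\<phi> + 2)) * (1 / sqrt (\<phi> + 2)) * (\<phi> * \<phi> - 1)"
    unfolding inner_scaleR_left inner_scaleR_right by (simp add: inner3)
  also have "\<dots> = (\<phi> * \<phi> - 1) / (\<phi> + 2)" using phi_gt by simp
  also have "\<dots> = 1 / sqrt 5"
    unfolding sqrt_5_eq using phi_gt by (simp add: field_simps phi_mult)
  finally have xy: "?x \<bullet> ?y = 1 / sqrt 5" .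
  have G: "sin \<alpha> * cos \<alpha> * ?P \<alpha> = (3 + 4 * \<phi>) / 8"
    unfolding v by (rule icosahedral_primitive_values)
  have e: "sin (- \<alpha>) * cos (- \<alpha>) * ?P (- \<alpha>) = - (sin \<alpha> * cos \<alpha> * ?P \<alpha>)" by simp
  show ?thesis unfolding I xy e G by (simp add: field_simps)
qed

lemma icosahedral_arc_dodecahedron:
  "arc_integral ((1 / sqrt 3) *\<^sub>R vector [\<phi> - 1, \<phi>, 0]) ((1 / sqrt 3) *\<^sub>R vector [- (\<phi> - 1), \<phi>, 0]) icosahedral_form =
     35 / 8 * (3 + 4 * \<phi>) * arccos (sqrt 5 / 3) - 85 / 108 * (1 + 2 * \<phi>)" (is "?I = _")
proof -
  obtain \<alpha> where \<alpha>: "0 < \<alpha>" "\<alpha> < pi / 2" "cos \<alpha> = (\<phi> - 1) / sqrt 3" "sin \<alpha> = \<phi> / sqrt 3"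
    and v: "sin \<alpha> * cos \<alpha> = 1 / 3" "(cos \<alpha>)\<^sup>2 = (2 - \<phi>) / 3" "cos \<alpha> ^ 4 = (5 - 3 * \<phi>) / 9"
    by (rule dodecahedron_angle)
  let ?m = "vector [1, 0, 0] :: real^3" and ?w = "vector [0, 1, 0] :: real^3"
  let ?x = "(1 / sqrt 3) *\<^sub>R vector [\<phi> - 1, \<phi>, 0] :: real^3"
  let ?y = "(1 / sqrt 3) *\<^sub>R vector [- (\<phi> - 1), \<phi>, 0] :: real^3"
  let ?P = "\<lambda>u. 3 / 8 * (3 + 4 * \<phi>) + (11 / 4 + 7 * \<phi>) * (cos u)\<^sup>2 + (- 5 - 10 * \<phi>) * cos u ^ 4"
  have I: "?I = 35 / 8 * (3 + 4 * \<phi>) * arccos (?x \<bullet> ?y) +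
      sin (pi - \<alpha>) * cos (pi - \<alpha>) * ?P (pi - \<alpha>) - sin \<alpha> * cos \<alpha> * ?P \<alpha>"
    by (rule arc_integral_even_trig_polynomial[of ?m ?w, OF _ _ _ _ _ _ _ icosahedral_form_coordinate_plane])
      (use \<alpha> in \<open>simp_all add: inner3 vec3_eq_iff field_simps\<close>)
  have xy: "?x \<bullet> ?y = sqrt 5 / 3"
    unfolding sqrt_5_eq by (simp add: inner3 field_simps phi_mult)
  have G: "sin \<alpha> * cos \<alpha> * ?P \<alpha> = 85 / 216 * (1 + 2 * \<phi>)"
    unfolding v by (rule icosahedral_primitive_values)
  have e: "sin (pi - \<alpha>) * cos (pi - \<alpha>) * ?P (pi - \<alpha>) = - (sin \<alpha> * cos \<alpha> * ?P \<alpha>)" by simp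
  show ?thesis unfolding I xy e G by (simp add: field_simps)
qed

lemma rhombic_triacontahedron_inner:
  "sqrt (1 / 3 + 2 / (3 * sqrt 5)) = (\<phi> + 1) / (sqrt (\<phi> + 2) * sqrt 3)"
proof -
  have "((\<phi> + 1) / (sqrt (\<phi> + 2) * sqrt 3))\<^sup>2 = (\<phi> + 1)\<^sup>2 / ((\<phi> + 2) * 3)"
    using phi_gt by (simp add: power_divide power_mult_distrib)
  also have "\<dots> = 1 / 3 + 2 / (3 * sqrt 5)"
    unfolding sqrt_5_eq using phi_gt by (simp add: power2_eq_square field_simps phi_mult)
  finally show ?thesis
    using phi_gt by (intro real_sqrt_unique) simp_all
qed

lemma icosahedral_arc_rhombic_triacontahedron:
  "arc_integral ((1 / sqrt (\<phi> + 2)) *\<^sub>R vector [\<phi>, 1, 0]) ((1 / sqrt 3) *\<^sub>R vector [\<phi> - 1, \<phi>, 0]) icosahedral_form =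
     35 / 8 * (3 + 4 * \<phi>) * arccos (sqrt (1 / 3 + 2 / (3 * sqrt 5))) + (2 + 31 * \<phi>) / 108" (is "?I = _")
proof -
  obtain \<alpha> where \<alpha>: "0 < \<alpha>" "\<alpha> < pi / 2" "cos \<alpha> = \<phi> / sqrt (\<phi> + 2)" "sin \<alpha> = 1 / sqrt (\<phi> + 2)"
    and v: "sin \<alpha> * cos \<alpha> = (2 * \<phi> - 1) / 5" "(cos \<alpha>)\<^sup>2 = (\<phi> + 2) / 5" "cos \<alpha> ^ 4 = (\<phi> + 1) / 5"
    by (rule icosahedron_angle)
  obtain \<alpha>' where \<alpha>': "0 < \<alpha>'" "\<alpha>' < pi / 2" "cos \<alpha>' = (\<phi> - 1) / sqrt 3" "sin \<alpha>' = \<phi> / sqrt 3"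
    and v': "sin \<alpha>' * cos \<alpha>' = 1 / 3" "(cos \<alpha>')\<^sup>2 = (2 - \<phi>) / 3" "cos \<alpha>' ^ 4 = (5 - 3 * \<phi>) / 9"
    by (rule dodecahedron_angle)
  \<comment> \<open>The sign of the sine of the difference is visible without any estimate of the angles.\<close>
  have "\<alpha> < \<alpha>'"
  proof (rule ccontr)
    assume "\<not> \<alpha> < \<alpha>'"
    hence "sin (\<alpha> - \<alpha>') \<ge> 0" using \<alpha> \<alpha>' by (intro sin_ge_zero) auto
    moreover have "sin (\<alpha> - \<alpha>') = - 2 / (sqrt (\<phi> + 2) * sqrt 3)"
      unfolding sin_diff \<alpha> \<alpha>' using phi_gt by (simp add: field_simps phi_mult)
    moreover have "0 < 2 / (sqrt (\<phi> + 2) * sqrt 3)" using phi_gt by simp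
    ultimately show False by simp
  qed
  let ?m = "vector [1, 0, 0] :: real^3" and ?w = "vector [0, 1, 0] :: real^3"
  let ?x = "(1 / sqrt (\<phi> + 2)) *\<^sub>R vector [\<phi>, 1, 0] :: real^3"
  let ?y = "(1 / sqrt 3) *\<^sub>R vector [\<phi> - 1, \<phi>, 0] :: real^3"
  let ?P = "\<lambda>u. 3 / 8 * (3 + 4 * \<phi>) + (11 / 4 + 7 * \<phi>) * (cos u)\<^sup>2 + (- 5 - 10 * \<phi>) * cos u ^ 4"
  have I: "?I = 35 / 8 * (3 + 4 * \<phi>) * arccos (?x \<bullet> ?y) +
      sin \<alpha>' * cos \<alpha>' * ?P \<alpha>' - sin \<alpha> * cos \<alpha> * ?P \<alpha>"
    by (rule arc_integral_even_trig_polynomial[of ?m ?w, OF _ _ _ _ _ _ _ icosahedral_form_coordinate_plane])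
      (use \<alpha> \<alpha>' \<open>\<alpha> < \<alpha>'\<close> in \<open>simp_all add: inner3 vec3_eq_iff\<close>)
  have xy: "?x \<bullet> ?y = sqrt (1 / 3 + 2 / (3 * sqrt 5))"
    unfolding rhombic_triacontahedron_inner using phi_gt by (simp add: inner3 field_simps phi_mult)
  have "sin \<alpha> * cos \<alpha> * ?P \<alpha> = (3 + 4 * \<phi>) / 8"
    unfolding v by (rule icosahedral_primitive_values)
  moreover have "sin \<alpha>' * cos \<alpha>' * ?P \<alpha>' = 85 / 216 * (1 + 2 * \<phi>)"
    unfolding v' by (rule icosahedral_primitive_values)
  ultimately show ?thesis unfolding I xy by (simp add: field_simps)
qed

lemma icosahedral_form_scale: "icosahedral_form (k *\<^sub>R x) = k ^ 6 * icosahedral_form x"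
proof -
  have "(\<phi> * (k * a) + k * b) ^ 6 = k ^ 6 * (\<phi> * a + b) ^ 6"
    "(\<phi> * (k * a) - k * b) ^ 6 = k ^ 6 * (\<phi> * a - b) ^ 6" for a b
    by (simp_all add: algebra_simps flip: power_mult_distrib)
  thus ?thesis by (simp add: icosahedral_form_def distrib_left)
qed

lemma icosahedral_form_icosahedron:
  assumes "x \<in> icosahedron" shows "icosahedral_form x = 26 / 5 * (3 + 4 * \<phi>)"
proof -
  have "icosahedral_form x = icosahedral_form ((1 / sqrt (\<phi> + 2)) *\<^sub>R vector [\<phi>, 1, 0])"
    by (rule form_on_scaled_orbit[OF pyritohedral_icosahedral_form assms[unfolded icosahedron_eq]])
  also have "\<dots> = (1 / sqrt (\<phi> + 2)) ^ 6 * ((\<phi> * \<phi> + 1) ^ 6 + (\<phi> * \<phi> - 1) ^ 6 + 4 * \<phi> ^ 6)"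
    unfolding icosahedral_form_scale by (simp add: icosahedral_form_def)
  also have "(\<phi> * \<phi> + 1) ^ 6 = 1000 * \<phi> + 625"
    by (simp add: phi_mult eval_nat_numeral algebra_simps)
  also have "(\<phi> * \<phi> - 1) ^ 6 = 8 * \<phi> + 5"
    by (simp add: phi_mult phi_powers)
  also have "(1 / sqrt (\<phi> + 2)) ^ 6 = 1 / (\<phi> + 2) ^ 3"
    using phi_gt power_mult[of "1 / sqrt (\<phi> + 2)" 2 3] by (simp add: power_divide)
  also have "(\<phi> + 2) ^ 3 = 20 * \<phi> + 15"
    by (simp add: power3_eq_cube algebra_simps phi_mult)
  also have "1 / (20 * \<phi> + 15) * (1000 * \<phi> + 625 + (8 * \<phi> + 5) + 4 * \<phi> ^ 6) = 26 / 5 * (3 + 4 * \<phi>)"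
    using phi_gt by (simp add: phi_powers field_simps phi_mult)
  finally show ?thesis .
qed

lemma icosahedral_form_dodecahedron:
  assumes "x \<in> dodecahedron" shows "icosahedral_form x = 34 / 9 * (3 + 4 * \<phi>)"
proof -
  have k: "(1 / sqrt 3) ^ 6 = 1 / 27"
    using power_mult[of "1 / sqrt 3" 2 3] by (simp add: power_divide)
  have v: "(\<phi> * \<phi>) ^ 6 = 144 * \<phi> + 89" "(\<phi> + 1) ^ 6 = 144 * \<phi> + 89" "(\<phi> - 1) ^ 6 = 13 - 8 * \<phi>"
    "(\<phi> * (\<phi> - 1) + \<phi>) ^ 6 = 144 * \<phi> + 89" "(\<phi> * (\<phi> - 1) - \<phi>) ^ 6 = 13 - 8 * \<phi>"
    by (simp_all add: phi_mult eval_nat_numeral algebra_simps)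
  from assms consider "x \<in> (*\<^sub>R) (1 / sqrt 3) ` orbit 1 1 1" | "x \<in> (*\<^sub>R) (1 / sqrt 3) ` orbit \<phi> 0 (\<phi> - 1)"
    unfolding dodecahedron_eq image_Un by blast
  thus ?thesis
  proof cases
    case 1
    show ?thesis
      unfolding form_on_scaled_orbit[OF pyritohedral_icosahedral_form 1] icosahedral_form_scale k
      by (simp add: icosahedral_form_def v)
  next
    case 2
    show ?thesis
      unfolding form_on_scaled_orbit[OF pyritohedral_icosahedral_form 2] icosahedral_form_scale k
      using even_power_diff_commute(1)[of 0 "\<phi> - 1"] by (simp add: icosahedral_form_def v)
  qed
qed

lemma icosahedral_form_icosidodecahedron:
  assumes "x \<in> icosidodecahedron" shows "icosahedral_form x = 4 * (3 + 4 * \<phi>)"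
proof -
  from assms consider "x \<in> (*\<^sub>R) (1 / 2) ` orbit 2 0 0" | "x \<in> (*\<^sub>R) (1 / 2) ` orbit \<phi> (\<phi> - 1) 1"
    unfolding icosidodecahedron_eq image_Un by blast
  thus ?thesis
  proof cases
    case 1
    show ?thesis
      unfolding form_on_scaled_orbit[OF pyritohedral_icosahedral_form 1] icosahedral_form_scale
      by (simp add: icosahedral_form_def power_mult_distrib power_divide phi_powers)
  next
    case 2
    have v: "\<phi> * \<phi> + (\<phi> - 1) = 2 * \<phi>" "\<phi> * \<phi> - (\<phi> - 1) = 2" "\<phi> * (\<phi> - 1) + 1 = 2" "\<phi> * (\<phi> - 1) - 1 = 0"
      by (simp_all add: algebra_simps phi_mult)
    show ?thesis
      unfolding form_on_scaled_orbit[OF pyritohedral_icosahedral_form 2] icosahedral_form_scale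
      by (simp add: icosahedral_form_def v power_mult_distrib power_divide phi_powers)
  qed
qed

text \<open>
  The pyritohedral group has several orbits on the edges of an icosahedral polytope.  These values
  of the reflection link the orbit of the reference arc to the others.
\<close>

lemma golden_reflection_values:
  "golden_reflection (vector [\<phi>, 1, 0]) = vector [1, 0, - \<phi>]"
  "golden_reflection (vector [\<phi>, - 1, 0]) = vector [\<phi>, - 1, 0]"
  "golden_reflection (vector [\<phi> - 1, \<phi>, 0]) = vector [0, \<phi> - 1, - \<phi>]"
  "golden_reflection (vector [- (\<phi> - 1), \<phi>, 0]) = vector [- 1, 1, - 1]"
  "golden_reflection (vector [\<phi> - 1, - \<phi>, 0]) = vector [1, - 1, 1]"
  by (simp_all add: vec3_eq_iff golden_reflection_components field_simps phi_mult)

lemma arc_integral_golden: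
  "arc_integral (k *\<^sub>R golden_reflection v) (s *\<^sub>R golden_reflection w) icosahedral_form =
    arc_integral (k *\<^sub>R v) (s *\<^sub>R w) icosahedral_form"
  using arc_integral_invariant[OF golden_reflection_orthogonal, of icosahedral_form "k *\<^sub>R v" "s *\<^sub>R w"]
  by (simp add: isometry_scale golden_reflection_orthogonal icosahedral_form_golden_reflection)

lemma icosahedral_edge_icosahedron:
  assumes "x \<in> icosahedron" "y \<in> icosahedron" "x \<bullet> y = 1 / sqrt 5"
  shows "arc_integral x y icosahedral_form =
    35 / 8 * (3 + 4 * \<phi>) * arccos (1 / sqrt 5) + (3 + 4 * \<phi>) / 4"
proof (rule arc_integral_orbit[OF pyritohedral_icosahedral_form finite_vertices(4) pyritohedral_vertices(4)])
  define k where "k = 1 / sqrt (\<phi> + 2)"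
  define J where "J = 35 / 8 * (3 + 4 * \<phi>) * arccos (1 / sqrt 5) + (3 + 4 * \<phi>) / 4"
  let ?I = "\<lambda>v w. arc_integral (k *\<^sub>R v) (k *\<^sub>R w) icosahedral_form"
  note p = pyritohedral_icosahedral_form
  have k2: "k * k = 1 / (\<phi> + 2)" using phi_gt by (simp add: k_def)
  have sphere: "k *\<^sub>R v \<in> S2" if "v \<in> orbit \<phi> 1 0" for v
    using that vertices_on_sphere(4) by (auto simp: icosahedron_eq k_def)
  have base: "?I (vector [\<phi>, - 1, 0]) (vector [\<phi>, 1, 0]) = J"
    unfolding k_def J_def by (rule icosahedral_arc_icosahedron)
  have 1: "?I (vector [\<phi>, 1, 0]) (vector [\<phi>, - 1, 0]) = J"
    using base arc_integral_neg2[OF p, of k \<phi> "- 1" 0 k \<phi> 1 0] by simp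
  \<comment> \<open>The reflection fixes the end point \<open>(\<phi>, -1, 0)\<close> of the reference arc.\<close>
  have "?I (vector [\<phi>, - 1, 0]) (vector [1, 0, - \<phi>]) = J"
    using base arc_integral_golden[of k "vector [\<phi>, - 1, 0]" k "vector [\<phi>, 1, 0]"]
    unfolding golden_reflection_values by simp
  hence 2: "?I (vector [\<phi>, 1, 0]) (vector [1, 0, - \<phi>]) = J"
    using arc_integral_neg2[OF p, of k \<phi> "- 1" 0 k 1 0 "- \<phi>"] by simp
  hence 3: "?I (vector [\<phi>, 1, 0]) (vector [1, 0, \<phi>]) = J"
    using arc_integral_neg3[OF p, of k \<phi> 1 0 k 1 0 \<phi>] by simp
  hence "?I (vector [0, \<phi>, 1]) (vector [\<phi>, 1, 0]) = J"
    using arc_integral_rotate[OF p, of k 1 0 \<phi> k 0 \<phi> 1] arc_integral_rotate[OF p, of k 0 \<phi> 1 k \<phi> 1 0] by simp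
  moreover have "(k *\<^sub>R vector [\<phi>, 1, 0] :: real^3) \<bullet> (k *\<^sub>R vector [0, \<phi>, 1]) = k * k * \<phi>"
    unfolding inner_scaleR_left inner_scaleR_right by (simp add: inner3)
  moreover have "- 1 < k * k * \<phi>" "k * k * \<phi> < 1"
    unfolding k2 using phi_gt by (simp_all add: less_divide_eq)
  moreover have "k *\<^sub>R vector [\<phi>, 1, 0] \<in> S2" "k *\<^sub>R vector [0, \<phi>, 1] \<in> S2"
    by (rule sphere, rule base_vertex)+
  ultimately have 4: "?I (vector [\<phi>, 1, 0]) (vector [0, \<phi>, 1]) = J"
    by (metis arc_integral_swap)
  hence 5: "?I (vector [\<phi>, 1, 0]) (vector [0, \<phi>, - 1]) = J"
    using arc_integral_neg3[OF p, of k \<phi> 1 0 k 0 \<phi> 1] by simp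
  show "x \<in> (*\<^sub>R) k ` orbit \<phi> 1 0" using assms(1) by (simp add: icosahedron_eq k_def)
  fix y assume "y \<in> icosahedron" and d: "(k *\<^sub>R vector [\<phi>, 1, 0]) \<bullet> y = 1 / sqrt 5"
  then obtain v where v: "v \<in> orbit \<phi> 1 0" "y = k *\<^sub>R v" by (auto simp: icosahedron_eq k_def)
  \<comment> \<open>Only the five vertices treated above have the right inner product with \<open>(\<phi>, 1, 0)\<close>.\<close>
  have "k * k * (\<phi> * v$1 + v$2) = 1 / (2 * \<phi> - 1)"
    using d unfolding v inner_scaleR_left inner_scaleR_right sqrt_5_eq by (simp add: inner3)
  hence "\<phi> * v$1 + v$2 = (\<phi> + 2) / (2 * \<phi> - 1)"
    unfolding k2 using phi_gt by (simp add: field_simps)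
  also have "\<dots> = \<phi>" using phi_gt by (simp add: field_simps phi_mult)
  finally have "v = vector [\<phi>, - 1, 0] \<or> v = vector [1, 0, \<phi>] \<or> v = vector [1, 0, - \<phi>] \<or>
      v = vector [0, \<phi>, 1] \<or> v = vector [0, \<phi>, - 1]"
    using v(1) phi_gt phi_less unfolding mem_orbit_iff mem_pm_iff vec3_eq_iff vector_3
    by (elim disjE conjE) (simp_all add: phi_mult)
  thus "arc_integral (k *\<^sub>R vector [\<phi>, 1, 0]) y icosahedral_form =
      35 / 8 * (3 + 4 * \<phi>) * arccos (1 / sqrt 5) + (3 + 4 * \<phi>) / 4"
    using 1 2 3 4 5 unfolding v(2) J_def by blast
qed (use assms in simp_all)

lemma icosahedral_edge_rhombic_triacontahedron:
  assumes "x \<in> icosahedron" "y \<in> dodecahedron" "x \<bullet> y = sqrt (1 / 3 + 2 / (3 * sqrt 5))"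
  shows "arc_integral x y icosahedral_form =
    35 / 8 * (3 + 4 * \<phi>) * arccos (sqrt (1 / 3 + 2 / (3 * sqrt 5))) + (2 + 31 * \<phi>) / 108"
proof (rule arc_integral_orbit[OF pyritohedral_icosahedral_form finite_vertices(5) pyritohedral_vertices(5)])
  define k where "k = 1 / sqrt (\<phi> + 2)"
  define s where "s = 1 / sqrt 3"
  define J where "J = 35 / 8 * (3 + 4 * \<phi>) * arccos (sqrt (1 / 3 + 2 / (3 * sqrt 5))) + (2 + 31 * \<phi>) / 108"
  let ?I = "\<lambda>v w. arc_integral (k *\<^sub>R v) (s *\<^sub>R w) icosahedral_form"
  note p = pyritohedral_icosahedral_form
  have base: "?I (vector [\<phi>, 1, 0]) (vector [\<phi> - 1, \<phi>, 0]) = J"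
    unfolding k_def s_def J_def by (rule icosahedral_arc_rhombic_triacontahedron)
  \<comment> \<open>Reflecting the reference arc, before and after a change of sign, gives all five edges at \<open>(\<phi>, 1, 0)\<close>.\<close>
  have "?I (vector [1, 0, - \<phi>]) (vector [0, \<phi> - 1, - \<phi>]) = J"
    using base arc_integral_golden[of k "vector [\<phi>, 1, 0]" s "vector [\<phi> - 1, \<phi>, 0]"]
    unfolding golden_reflection_values by simp
  hence "?I (vector [1, 0, \<phi>]) (vector [0, \<phi> - 1, \<phi>]) = J"
    using arc_integral_neg3[OF p, of k 1 0 \<phi> s 0 "\<phi> - 1" \<phi>] by simp
  hence 2: "?I (vector [\<phi>, 1, 0]) (vector [\<phi>, 0, \<phi> - 1]) = J"
    using arc_integral_rotate[OF p, of k 0 \<phi> 1 s "\<phi> - 1" \<phi> 0] arc_integral_rotate[OF p, of k \<phi> 1 0 s \<phi> 0 "\<phi> - 1"]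
    by simp
  hence 3: "?I (vector [\<phi>, 1, 0]) (vector [\<phi>, 0, - (\<phi> - 1)]) = J"
    using arc_integral_neg3[OF p, of k \<phi> 1 0 s \<phi> 0 "\<phi> - 1"] by simp
  have "?I (vector [\<phi>, - 1, 0]) (vector [\<phi> - 1, - \<phi>, 0]) = J"
    using base arc_integral_neg2[OF p, of k \<phi> 1 0 s "\<phi> - 1" \<phi> 0] by simp
  hence "?I (vector [\<phi>, - 1, 0]) (vector [1, - 1, 1]) = J"
    using arc_integral_golden[of k "vector [\<phi>, - 1, 0]" s "vector [\<phi> - 1, - \<phi>, 0]"]
    unfolding golden_reflection_values by simp
  hence 4: "?I (vector [\<phi>, 1, 0]) (vector [1, 1, 1]) = J"
    using arc_integral_neg2[OF p, of k \<phi> 1 0 s 1 1 1] by simp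
  hence 5: "?I (vector [\<phi>, 1, 0]) (vector [1, 1, - 1]) = J"
    using arc_integral_neg3[OF p, of k \<phi> 1 0 s 1 1 1] by simp
  show "x \<in> (*\<^sub>R) k ` orbit \<phi> 1 0" using assms(1) by (simp add: icosahedron_eq k_def)
  fix y assume "y \<in> dodecahedron" and d: "(k *\<^sub>R vector [\<phi>, 1, 0]) \<bullet> y = sqrt (1 / 3 + 2 / (3 * sqrt 5))"
  then obtain v where v: "v \<in> orbit 1 1 1 \<union> orbit \<phi> 0 (\<phi> - 1)" "y = s *\<^sub>R v"
    unfolding dodecahedron_eq s_def by blast
  have "k * s * (\<phi> * v$1 + v$2) = (\<phi> + 1) / (sqrt (\<phi> + 2) * sqrt 3)"
    using d unfolding v inner_scaleR_left inner_scaleR_right rhombic_triacontahedron_inner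
    by (simp add: inner3 mult_ac)
  also have "(\<phi> + 1) / (sqrt (\<phi> + 2) * sqrt 3) = k * s * (\<phi> + 1)"
    by (simp add: k_def s_def)
  finally have "\<phi> * v$1 + v$2 = \<phi> + 1"
    using phi_gt by (simp add: k_def s_def)
  hence "v = vector [\<phi> - 1, \<phi>, 0] \<or> v = vector [\<phi>, 0, \<phi> - 1] \<or> v = vector [\<phi>, 0, - (\<phi> - 1)] \<or>
      v = vector [1, 1, 1] \<or> v = vector [1, 1, - 1]"
    using v(1) phi_gt phi_less unfolding Un_iff mem_orbit_iff mem_pm_iff vec3_eq_iff vector_3
    by (elim disjE conjE) (simp_all add: phi_mult algebra_simps)
  thus "arc_integral (k *\<^sub>R vector [\<phi>, 1, 0]) y icosahedral_form =
      35 / 8 * (3 + 4 * \<phi>) * arccos (sqrt (1 / 3 + 2 / (3 * sqrt 5))) + (2 + 31 * \<phi>) / 108"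
    using base 2 3 4 5 unfolding v(2) J_def by blast
qed (use assms in simp_all)

text \<open>
  The dodecahedron has two pyritohedral orbits of vertices, the cube and the rest, so the
  neighbours of one vertex from each have to be examined.
\<close>

lemma icosahedral_edge_dodecahedron:
  assumes xy: "x \<in> dodecahedron" "y \<in> dodecahedron" "x \<bullet> y = sqrt 5 / 3"
  shows "arc_integral x y icosahedral_form =
    35 / 8 * (3 + 4 * \<phi>) * arccos (sqrt 5 / 3) - 85 / 108 * (1 + 2 * \<phi>)"
proof -
  define s where "s = 1 / sqrt 3"
  define J where "J = 35 / 8 * (3 + 4 * \<phi>) * arccos (sqrt 5 / 3) - 85 / 108 * (1 + 2 * \<phi>)"
  let ?I = "\<lambda>v w. arc_integral (s *\<^sub>R v) (s *\<^sub>R w) icosahedral_form"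
  note p = pyritohedral_icosahedral_form
  have s2: "s * s = 1 / 3" by (simp add: s_def)
  have sphere: "s *\<^sub>R v \<in> S2" if "v \<in> orbit 1 1 1 \<union> orbit \<phi> 0 (\<phi> - 1)" for v
    using imageI[OF that, of "(*\<^sub>R) s"] vertices_on_sphere(5) unfolding dodecahedron_eq s_def by blast
  have base: "?I (vector [\<phi> - 1, \<phi>, 0]) (vector [- (\<phi> - 1), \<phi>, 0]) = J"
    unfolding s_def J_def by (rule icosahedral_arc_dodecahedron)
  have 1: "?I (vector [\<phi>, 0, \<phi> - 1]) (vector [\<phi>, 0, - (\<phi> - 1)]) = J"
    using base arc_integral_rotate[OF p, of s \<phi> 0 "\<phi> - 1" s \<phi> 0 "- (\<phi> - 1)"] by simp
  have "?I (vector [0, \<phi> - 1, - \<phi>]) (vector [- 1, 1, - 1]) = J"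
    using base arc_integral_golden[of s "vector [\<phi> - 1, \<phi>, 0]" s "vector [- (\<phi> - 1), \<phi>, 0]"]
    unfolding golden_reflection_values by simp
  hence "?I (vector [0, \<phi> - 1, \<phi>]) (vector [- 1, 1, 1]) = J"
    using arc_integral_neg3[OF p, of s 0 "\<phi> - 1" \<phi> s "- 1" 1 1] by simp
  hence c1: "?I (vector [0, \<phi> - 1, \<phi>]) (vector [1, 1, 1]) = J"
    using arc_integral_neg1[OF p, of s 0 "\<phi> - 1" \<phi> s 1 1 1] by simp
  hence c2: "?I (vector [\<phi> - 1, \<phi>, 0]) (vector [1, 1, 1]) = J"
    using arc_integral_rotate[OF p, of s "\<phi> - 1" \<phi> 0 s 1 1 1] by simp
  hence 2: "?I (vector [\<phi>, 0, \<phi> - 1]) (vector [1, 1, 1]) = J"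
    using arc_integral_rotate[OF p, of s \<phi> 0 "\<phi> - 1" s 1 1 1] by simp
  hence 3: "?I (vector [\<phi>, 0, \<phi> - 1]) (vector [1, - 1, 1]) = J"
    using arc_integral_neg2[OF p, of s \<phi> 0 "\<phi> - 1" s 1 1 1] by simp
  have swap: "?I w v = ?I v w"
    if "v \<in> orbit 1 1 1 \<union> orbit \<phi> 0 (\<phi> - 1)" "w \<in> orbit 1 1 1 \<union> orbit \<phi> 0 (\<phi> - 1)" "v \<bullet> w = 2 * \<phi> - 1" for v w
  proof -
    have "(s *\<^sub>R v) \<bullet> (s *\<^sub>R w) = (2 * \<phi> - 1) / 3"
      using that(3) s2 by (simp add: mult.assoc[symmetric])
    thus ?thesis
      using phi_gt phi_less by (intro arc_integral_swap sphere that) simp_all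
  qed
  have edge: "v \<bullet> w = 2 * \<phi> - 1" if "(s *\<^sub>R v) \<bullet> (s *\<^sub>R w) = sqrt 5 / 3" for v w :: "real^3"
    using that s2 unfolding sqrt_5_eq by (simp add: mult.assoc[symmetric])
  consider "x \<in> (*\<^sub>R) s ` orbit 1 1 1" | "x \<in> (*\<^sub>R) s ` orbit \<phi> 0 (\<phi> - 1)"
    using xy(1) unfolding dodecahedron_eq s_def image_Un by blast
  hence "arc_integral x y icosahedral_form = J"
  proof cases
    case 1
    show ?thesis
    proof (rule arc_integral_orbit[OF p finite_vertices(5) pyritohedral_vertices(5) _ 1 xy(2,3)])
      fix y assume "y \<in> dodecahedron" and d: "(s *\<^sub>R vector [1, 1, 1]) \<bullet> y = sqrt 5 / 3"
      then obtain v where v: "v \<in> orbit 1 1 1 \<union> orbit \<phi> 0 (\<phi> - 1)" "y = s *\<^sub>R v"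
        unfolding dodecahedron_eq s_def by blast
      have e: "vector [1, 1, 1] \<bullet> v = 2 * \<phi> - 1" using d unfolding v by (rule edge)
      hence "v$1 + v$2 + v$3 = 2 * \<phi> - 1" by (simp add: inner3)
      hence "v = vector [\<phi>, 0, \<phi> - 1] \<or> v = vector [\<phi> - 1, \<phi>, 0] \<or> v = vector [0, \<phi> - 1, \<phi>]"
        using v(1) phi_gt phi_less unfolding Un_iff mem_orbit_iff mem_pm_iff vec3_eq_iff vector_3
        by (elim disjE conjE) simp_all
      hence "?I v (vector [1, 1, 1]) = J" using c1 c2 2 by blast
      thus "arc_integral (s *\<^sub>R vector [1, 1, 1]) y icosahedral_form = J"
        using swap[OF v(1), of "vector [1, 1, 1]"] e by (simp add: v(2) base_vertex inner_commute)
    qed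
  next
    case x: 2
    show ?thesis
    proof (rule arc_integral_orbit[OF p finite_vertices(5) pyritohedral_vertices(5) _ x xy(2,3)])
      fix y assume "y \<in> dodecahedron" and d: "(s *\<^sub>R vector [\<phi>, 0, \<phi> - 1]) \<bullet> y = sqrt 5 / 3"
      then obtain v where v: "v \<in> orbit 1 1 1 \<union> orbit \<phi> 0 (\<phi> - 1)" "y = s *\<^sub>R v"
        unfolding dodecahedron_eq s_def by blast
      have "vector [\<phi>, 0, \<phi> - 1] \<bullet> v = 2 * \<phi> - 1" using d unfolding v by (rule edge)
      hence "\<phi> * v$1 + (\<phi> - 1) * v$3 = 2 * \<phi> - 1" by (simp add: inner3)
      hence "v = vector [\<phi>, 0, - (\<phi> - 1)] \<or> v = vector [1, 1, 1] \<or> v = vector [1, - 1, 1]"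
        using v(1) phi_gt phi_less unfolding Un_iff mem_orbit_iff mem_pm_iff vec3_eq_iff vector_3
        by (elim disjE conjE) (simp_all add: phi_mult algebra_simps)
      thus "arc_integral (s *\<^sub>R vector [\<phi>, 0, \<phi> - 1]) y icosahedral_form = J"
        using 1 2 3 unfolding v(2) by blast
    qed
  qed
  thus ?thesis by (simp add: J_def)
qed

theorem dodecahedron_icosahedron_design:
  assumes "induced_cycle dodecahedron dodecahedron_edges \<gamma>"
  shows "hybrid_design 9
    ((1190 * sqrt 5 - 675 * arccos (sqrt 5 / 3)) / (1190 * sqrt 5 + 6237 * arccos (sqrt 5 / 3))) \<gamma> icosahedron"
proof -
  define \<theta> :: real where "\<theta> = arccos (sqrt 5 / 3)"
  have c: "- 1 < sqrt 5 / 3" "sqrt 5 / 3 < 1" "0 \<le> sqrt 5 / 3"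
    unfolding sqrt_5_eq using phi_gt phi_less by simp_all
  have \<theta>: "0 < \<theta>" using arccos_lt_bounded[OF c(1,2)] by (simp add: \<theta>_def)
  \<comment> \<open>The crude bound \<open>\<theta> < 2\<close> is enough for \<open>\<beta> \<ge> 0\<close>.\<close>
  have "\<theta> \<le> pi / 2" unfolding \<theta>_def using c by (intro arccos_le_pi2) simp_all
  hence "\<theta> < 2" using pi_less_4 by simp
  hence N: "0 \<le> 1190 * sqrt 5 - 675 * \<theta>" unfolding sqrt_5_eq using phi_gt by simp
  have D: "0 < 1190 * sqrt 5 + 6237 * \<theta>" unfolding sqrt_5_eq using phi_gt \<theta> by simp
  interpret edge_design dodecahedron dodecahedron icosahedron "sqrt 5 / 3"
    "(1190 * sqrt 5 - 675 * \<theta>) / (1190 * sqrt 5 + 6237 * \<theta>)"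
  proof
    show "\<exists>x\<in>dodecahedron. \<exists>y\<in>dodecahedron. x \<bullet> y = sqrt 5 / 3"
      unfolding dodecahedron_eq sqrt_5_eq
      by (rule bexI[of _ "(1 / sqrt 3) *\<^sub>R vector [1, 1, 1]"], rule bexI[of _ "(1 / sqrt 3) *\<^sub>R vector [\<phi>, 0, \<phi> - 1]"])
        (auto simp: inner3 base_vertex field_simps intro!: imageI)
    show "0 \<le> (1190 * sqrt 5 - 675 * \<theta>) / (1190 * sqrt 5 + 6237 * \<theta>)"
      using N D by simp
    show "(1190 * sqrt 5 - 675 * \<theta>) / (1190 * sqrt 5 + 6237 * \<theta>) \<le> 1"
      unfolding divide_le_eq_1_pos[OF D] using \<theta> by simp
    show "- 1 < sqrt 5 / 3" "sqrt 5 / 3 < 1" by (rule c)+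
  qed (simp_all add: finite_vertices vertices_on_sphere nonempty_vertices)
  have "(1190 * sqrt 5 - 675 * \<theta>) / (1190 * sqrt 5 + 6237 * \<theta>) * (26 / 5 * (3 + 4 * \<phi>)) +
      (1 - (1190 * sqrt 5 - 675 * \<theta>) / (1190 * sqrt 5 + 6237 * \<theta>)) *
      ((35 / 8 * (3 + 4 * \<phi>) * \<theta> - 85 / 108 * (1 + 2 * \<phi>)) / \<theta>) = 6 * (20 * \<phi> + 15) / 7"
  proof (rule balance_quotient)
    show "1190 * sqrt 5 + 6237 * \<theta> \<noteq> 0" using D by simp
  qed (use \<theta> in \<open>simp_all add: sqrt_5_eq field_simps phi_mult\<close>)
  thus ?thesis
    using hybrid_9_design[where U = dodecahedron, OF pyritohedral_vertices(5,5,4) golden_reflection_vertices(2,2,1)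
        icosahedral_form_icosahedron icosahedral_edge_dodecahedron] assms
    unfolding \<theta>_def dodecahedron_edges_def by blast
qed

theorem icosahedron_dodecahedron_design:
  assumes "induced_cycle icosahedron icosahedron_edges \<gamma>"
  shows "hybrid_design 9 ((126 + 45 * arccos (1 / sqrt 5)) / (126 + 301 * arccos (1 / sqrt 5))) \<gamma> dodecahedron"
proof -
  define \<theta> :: real where "\<theta> = arccos (1 / sqrt 5)"
  have c: "- 1 < 1 / sqrt 5" "1 / sqrt 5 < 1"
    by (rule less_trans[of _ 0]) simp_all
  have \<theta>: "0 < \<theta>" using arccos_lt_bounded[OF c] by (simp add: \<theta>_def)
  interpret edge_design icosahedron icosahedron dodecahedron "1 / sqrt 5" "(126 + 45 * \<theta>) / (126 + 301 * \<theta>)"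
  proof
    have "((1 / sqrt (\<phi> + 2)) *\<^sub>R vector [\<phi>, 1, 0] :: real^3) \<bullet> ((1 / sqrt (\<phi> + 2)) *\<^sub>R vector [\<phi>, - 1, 0]) =
        (1 / sqrt (\<phi> + 2)) * (1 / sqrt (\<phi> + 2)) * (\<phi> * \<phi> - 1)"
      unfolding inner_scaleR_left inner_scaleR_right by (simp add: inner3)
    also have "\<dots> = (\<phi> * \<phi> - 1) / (\<phi> + 2)" using phi_gt by simp
    also have "\<dots> = 1 / sqrt 5" unfolding sqrt_5_eq using phi_gt by (simp add: field_simps phi_mult)
    finally show "\<exists>x\<in>icosahedron. \<exists>y\<in>icosahedron. x \<bullet> y = 1 / sqrt 5"
      unfolding icosahedron_eq
      by (intro bexI[of _ "(1 / sqrt (\<phi> + 2)) *\<^sub>R vector [\<phi>, 1, 0]"]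
          bexI[of _ "(1 / sqrt (\<phi> + 2)) *\<^sub>R vector [\<phi>, - 1, 0]"] imageI)
        (simp_all add: mem_orbit_iff mem_pm_iff)
  qed (use \<theta> c in \<open>simp_all add: finite_vertices vertices_on_sphere nonempty_vertices\<close>)
  have "(126 + 45 * \<theta>) / (126 + 301 * \<theta>) * (34 / 9 * (3 + 4 * \<phi>)) +
      (1 - (126 + 45 * \<theta>) / (126 + 301 * \<theta>)) *
      ((35 / 8 * (3 + 4 * \<phi>) * \<theta> + (3 + 4 * \<phi>) / 4) / \<theta>) = 6 * (20 * \<phi> + 15) / 7"
    by (rule balance_quotient) (use \<theta> in \<open>simp_all add: field_simps\<close>)
  thus ?thesis
    using hybrid_9_design[where U = icosahedron, OF pyritohedral_vertices(4,4,5) golden_reflection_vertices(1,1,2)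
        icosahedral_form_dodecahedron icosahedral_edge_icosahedron] assms
    unfolding \<theta>_def icosahedron_edges_def by blast
qed

theorem rhombic_triacontahedron_icosidodecahedron_design:
  fixes \<theta> :: real
  defines "\<theta> \<equiv> arccos (sqrt (1 / 3 + 2 / (3 * sqrt 5)))"
  assumes "induced_cycle rhombic_triacontahedron rhombic_triacontahedron_edges \<gamma>"
  shows "hybrid_design 9
    ((7 * (17 * sqrt 5 - 27) + 135 * \<theta>) / (7 * (17 * sqrt 5 - 27) + 567 * \<theta>)) \<gamma> icosidodecahedron"
proof -
  let ?c = "sqrt (1 / 3 + 2 / (3 * sqrt 5))"
  have c2: "1 / 3 + 2 / (3 * sqrt 5) = (4 * \<phi> + 3) / 15"
    unfolding sqrt_5_eq using phi_gt by (simp add: field_simps phi_mult)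
  have c: "- 1 < ?c" "?c < 1"
    unfolding c2 using phi_gt phi_less by (simp_all add: less_trans[of _ 0])
  have \<theta>: "0 < \<theta>" using arccos_lt_bounded[OF c] by (simp add: \<theta>_def)
  have N: "0 < 17 * sqrt 5 - 27" unfolding sqrt_5_eq using phi_gt by simp
  have D: "0 < 7 * (17 * sqrt 5 - 27) + 567 * \<theta>" using N \<theta> by (intro add_pos_pos) simp_all
  interpret edge_design icosahedron dodecahedron icosidodecahedron ?c
    "(7 * (17 * sqrt 5 - 27) + 135 * \<theta>) / (7 * (17 * sqrt 5 - 27) + 567 * \<theta>)"
  proof
    have "((1 / sqrt (\<phi> + 2)) *\<^sub>R vector [\<phi>, 1, 0] :: real^3) \<bullet> ((1 / sqrt 3) *\<^sub>R vector [1, 1, 1]) = ?c"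
      unfolding inner_scaleR_left inner_scaleR_right rhombic_triacontahedron_inner by (simp add: inner3)
    thus "\<exists>x\<in>icosahedron. \<exists>y\<in>dodecahedron. x \<bullet> y = ?c"
      unfolding icosahedron_eq dodecahedron_eq
      by (intro bexI[of _ "(1 / sqrt (\<phi> + 2)) *\<^sub>R vector [\<phi>, 1, 0]"]
          bexI[of _ "(1 / sqrt 3) *\<^sub>R vector [1, 1, 1]"] imageI)
        (simp_all add: base_vertex)
    show "0 \<le> (7 * (17 * sqrt 5 - 27) + 135 * \<theta>) / (7 * (17 * sqrt 5 - 27) + 567 * \<theta>)"
      using N \<theta> by (intro divide_nonneg_nonneg add_nonneg_nonneg) simp_all
    show "(7 * (17 * sqrt 5 - 27) + 135 * \<theta>) / (7 * (17 * sqrt 5 - 27) + 567 * \<theta>) \<le> 1"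
      unfolding divide_le_eq_1_pos[OF D] using \<theta> by simp
  qed (use c in \<open>simp_all add: finite_vertices vertices_on_sphere nonempty_vertices\<close>)
  have "(7 * (17 * sqrt 5 - 27) + 135 * \<theta>) / (7 * (17 * sqrt 5 - 27) + 567 * \<theta>) * (4 * (3 + 4 * \<phi>)) +
      (1 - (7 * (17 * sqrt 5 - 27) + 135 * \<theta>) / (7 * (17 * sqrt 5 - 27) + 567 * \<theta>)) *
      ((35 / 8 * (3 + 4 * \<phi>) * \<theta> + (2 + 31 * \<phi>) / 108) / \<theta>) = 6 * (20 * \<phi> + 15) / 7"
  proof (rule balance_quotient)
    show "7 * (17 * sqrt 5 - 27) + 567 * \<theta> \<noteq> 0" using less_imp_neq[OF D] by (rule not_sym)
  qed (use \<theta> in \<open>simp_all add: sqrt_5_eq field_simps phi_mult\<close>)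
  thus ?thesis
    using hybrid_9_design[where U = rhombic_triacontahedron, OF pyritohedral_vertices(4,5,6)
        golden_reflection_vertices(1,2,3) icosahedral_form_icosidodecahedron
        icosahedral_edge_rhombic_triacontahedron] assms
    unfolding \<theta>_def rhombic_triacontahedron_edges_def by blast
qed

section \<open>The tetrahedron\<close>

definition tetrahedral_vectors :: "(real^3) set" where
  "tetrahedral_vectors = {vector [1, 1, 1], vector [1, - 1, - 1], vector [- 1, 1, - 1], vector [- 1, - 1, 1]}"

lemma tetrahedron_eq: "tetrahedron = (*\<^sub>R) (1 / sqrt 3) ` tetrahedral_vectors"
  by (simp add: tetrahedron_def tetrahedral_vectors_def)

lemma dual_tetrahedron_eq: "dual_tetrahedron = (*\<^sub>R) (- 1 / sqrt 3) ` tetrahedral_vectors"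
  by (simp add: dual_tetrahedron_def tetrahedron_eq image_image)

lemma half_turn_vector: "half_turn (vector [a, b, c]) = vector [- a, - b, c]"
  by (simp add: half_turn_def)

lemma tetrahedral_vectors_invariant:
  "cyc ` tetrahedral_vectors \<subseteq> tetrahedral_vectors" "half_turn ` tetrahedral_vectors \<subseteq> tetrahedral_vectors"
  by (simp_all add: tetrahedral_vectors_def cyc_vector half_turn_vector)

lemma tetrahedral_vectors_inner:
  assumes "v \<in> tetrahedral_vectors" "w \<in> tetrahedral_vectors"
  shows "v \<bullet> w = (if v = w then 3 else - 1)"
  using assms unfolding tetrahedral_vectors_def by (auto simp: inner3 vec3_eq_iff)

lemma tetrahedron_edges_eq: "tetrahedron_edges = pairs_with_inner tetrahedron tetrahedron (- 1 / 3)"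
proof -
  have "x \<noteq> y \<longleftrightarrow> x \<bullet> y = - 1 / 3" if xy: "x \<in> tetrahedron" "y \<in> tetrahedron" for x y
  proof -
    obtain v w where vw: "v \<in> tetrahedral_vectors" "w \<in> tetrahedral_vectors"
      "x = (1 / sqrt 3) *\<^sub>R v" "y = (1 / sqrt 3) *\<^sub>R w"
      using xy unfolding tetrahedron_eq by blast
    have "x \<bullet> y = (if v = w then 3 else - 1) / 3"
      using tetrahedral_vectors_inner[OF vw(1,2)] by (simp add: vw(3,4))
    thus ?thesis by (auto simp: vw(3,4))
  qed
  thus ?thesis unfolding tetrahedron_edges_def pairs_with_inner_def by blast
qed

lemma tetrahedra_on_sphere: "tetrahedron \<subseteq> S2" "dual_tetrahedron \<subseteq> S2"
proof -
  have "norm v = sqrt 3" if "v \<in> tetrahedral_vectors" for v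
    using tetrahedral_vectors_inner[OF that that] by (simp add: norm_eq_sqrt_inner)
  thus "tetrahedron \<subseteq> S2" "dual_tetrahedron \<subseteq> S2"
    unfolding tetrahedron_eq dual_tetrahedron_eq by auto
qed

text \<open>
  The midpoint of this edge is the first axis.  In the corresponding frame \<open>x y z\<close> becomes
  \<open>cos u (sin u)\<^sup>2 / 2\<close>, the derivative of \<open>(sin u)\<^sup>3 / 6\<close>.
\<close>

lemma cubic_arc_tetrahedron:
  "arc_integral ((1 / sqrt 3) *\<^sub>R vector [1, - 1, - 1]) ((1 / sqrt 3) *\<^sub>R vector [1, 1, 1]) (monomial 1 1 1) =
     2 * sqrt 2 / (9 * sqrt 3)"
proof -
  obtain \<alpha> where \<alpha>: "0 < \<alpha>" "\<alpha> < pi / 2" "cos \<alpha> = 1 / sqrt 3" "sin \<alpha> = sqrt 2 / sqrt 3"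
    by (rule quadrant_angle[of "1 / sqrt 3" "sqrt 2 / sqrt 3"]) (simp_all add: power_divide)
  let ?m = "vector [1, 0, 0] :: real^3" and ?w = "vector [0, 1 / sqrt 2, 1 / sqrt 2] :: real^3"
  have "arc_integral ((1 / sqrt 3) *\<^sub>R vector [1, - 1, - 1]) ((1 / sqrt 3) *\<^sub>R vector [1, 1, 1]) (monomial 1 1 1) =
      sin \<alpha> ^ 3 / 6 - sin (- \<alpha>) ^ 3 / 6"
  proof (rule arc_integral_great_circle[of ?m ?w "- \<alpha>" \<alpha>])
    fix u
    have "monomial 1 1 1 (cos u *\<^sub>R ?m + sin u *\<^sub>R ?w) = 3 * (sin u)\<^sup>2 * cos u / 6"
      by (simp add: monomial_def power2_eq_square)
    moreover have "((\<lambda>u. sin u ^ 3 / 6) has_real_derivative 3 * (sin u)\<^sup>2 * cos u / 6) (at u)"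
      by (auto intro!: derivative_eq_intros)
    ultimately show "((\<lambda>u. sin u ^ 3 / 6) has_real_derivative monomial 1 1 1 (cos u *\<^sub>R ?m + sin u *\<^sub>R ?w)) (at u)"
      by (simp only:)
  qed (use \<alpha> in \<open>simp_all add: inner3 vec3_eq_iff\<close>)
  also have "\<dots> = 2 * sqrt 2 / (9 * sqrt 3)"
    by (simp add: \<alpha> power_divide power3_eq_cube)
  finally show ?thesis .
qed

text \<open>
  Rotations lead from the reference arc to each of the six edges in one direction, and the symmetry
  of the arc integral supplies the other.
\<close>

lemma cubic_edge_tetrahedron:
  assumes "x \<in> tetrahedron" "y \<in> tetrahedron" "x \<bullet> y = - 1 / 3"
  shows "arc_integral x y (monomial 1 1 1) = 2 * sqrt 2 / (9 * sqrt 3)"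
proof -
  define s where "s = 1 / sqrt 3"
  define J where "J = 2 * sqrt 2 / (9 * sqrt 3)"
  define v0 v1 v2 v3 :: "real^3" where v: "v0 = vector [1, 1, 1]" "v1 = vector [1, - 1, - 1]"
    "v2 = vector [- 1, 1, - 1]" "v3 = vector [- 1, - 1, 1]"
  let ?I = "\<lambda>v w. arc_integral (s *\<^sub>R v) (s *\<^sub>R w) (monomial 1 1 1)"
  have m: "monomial 1 1 1 (cyc x) = monomial 1 1 1 x" "monomial 1 1 1 (half_turn x) = monomial 1 1 1 x" for x
    by (simp_all add: monomial_def cyc_def half_turn_def)
  have cyc: "?I (cyc v) (cyc w) = ?I v w" for v w
    using arc_integral_invariant[where p = "monomial 1 1 1", OF cyc_orthogonal m(1), of "s *\<^sub>R v" "s *\<^sub>R w"]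
    unfolding isometry_scale[OF cyc_orthogonal] .
  have half_turn: "?I (half_turn v) (half_turn w) = ?I v w" for v w
    using arc_integral_invariant[where p = "monomial 1 1 1", OF half_turn_orthogonal m(2), of "s *\<^sub>R v" "s *\<^sub>R w"]
    unfolding isometry_scale[OF half_turn_orthogonal] .
  have cv: "cyc v0 = v0" "cyc v1 = v3" "cyc v3 = v2" "cyc v2 = v1"
    and hv: "half_turn v0 = v3" "half_turn v1 = v2" "half_turn v2 = v1" "half_turn v3 = v0"
    by (simp_all add: v cyc_vector half_turn_vector)
  have 1: "?I v1 v0 = J" unfolding v s_def J_def by (rule cubic_arc_tetrahedron)
  have 3: "?I v3 v0 = J" using cyc[of v1 v0] 1 unfolding cv by simp
  have 2: "?I v2 v0 = J" using cyc[of v3 v0] 3 unfolding cv by simp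
  have 23: "?I v2 v3 = J" using half_turn[of v1 v0] 1 unfolding hv by simp
  have 13: "?I v1 v3 = J" using half_turn[of v2 v0] 2 unfolding hv by simp
  have 21: "?I v2 v1 = J" using cyc[of v1 v3] cyc[of v3 v2] 13 unfolding cv by simp
  have swap: "arc_integral x y (monomial 1 1 1) = arc_integral y x (monomial 1 1 1)"
    using assms tetrahedra_on_sphere by (intro arc_integral_swap) (auto simp: inner_commute)
  obtain a b where ab: "a \<in> {v0, v1, v2, v3}" "x = s *\<^sub>R a" "b \<in> {v0, v1, v2, v3}" "y = s *\<^sub>R b"
    using assms(1,2) unfolding tetrahedron_eq tetrahedral_vectors_def v s_def by blast
  have "a \<noteq> b"
    using assms tetrahedral_vectors_inner[of a a] ab unfolding tetrahedral_vectors_def v s_def by auto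
  hence "?I a b = J \<or> ?I b a = J"
    using ab(1,3) 1 2 3 23 13 21 by blast
  thus ?thesis using swap unfolding ab(2,4) J_def by argo
qed

theorem tetrahedron_dual_tetrahedron_design:
  assumes "induced_cycle tetrahedron tetrahedron_edges \<gamma>"
  shows "hybrid_design 3 (4 / (4 + 3 * sqrt 2 * arccos (- 1 / 3))) \<gamma> dual_tetrahedron"
proof -
  define \<theta> :: real where "\<theta> = arccos (- 1 / 3)"
  have \<theta>: "0 < \<theta>" using arccos_lt_bounded[of "- 1 / 3"] by (simp add: \<theta>_def)
  have "0 < sqrt 2 * \<theta>" using \<theta> by simp
  hence D: "0 < 4 + 3 * sqrt 2 * \<theta>" "4 \<le> 4 + 3 * sqrt 2 * \<theta>" by linarith+
  interpret edge_design tetrahedron tetrahedron dual_tetrahedron "- 1 / 3" "4 / (4 + 3 * sqrt 2 * \<theta>)"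
  proof
    show "finite tetrahedron" "finite dual_tetrahedron" "dual_tetrahedron \<noteq> {}"
      by (simp_all add: tetrahedron_eq dual_tetrahedron_eq tetrahedral_vectors_def)
    show "\<exists>x\<in>tetrahedron. \<exists>y\<in>tetrahedron. x \<bullet> y = - 1 / 3"
      unfolding tetrahedron_eq
      by (rule bexI[of _ "(1 / sqrt 3) *\<^sub>R vector [1, 1, 1]"], rule bexI[of _ "(1 / sqrt 3) *\<^sub>R vector [1, - 1, - 1]"])
        (auto simp: inner3 tetrahedral_vectors_def intro!: imageI)
    show "4 / (4 + 3 * sqrt 2 * \<theta>) \<le> 1" unfolding divide_le_eq_1_pos[OF D(1)] by (rule D(2))
    show "0 \<le> 4 / (4 + 3 * sqrt 2 * \<theta>)" using D(1) by simp
  qed (simp_all add: tetrahedra_on_sphere)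
  interpret D: tetrahedral_functional defect
  proof
    fix p :: "real^3 \<Rightarrow> real" assume p: "continuous_on S2 p"
    show "defect (\<lambda>x. p (cyc x)) = defect p" "defect (\<lambda>x. p (half_turn x)) = defect p"
      unfolding tetrahedron_eq dual_tetrahedron_eq
      by (intro defect_isometry[unfolded tetrahedron_eq dual_tetrahedron_eq] image_scale_subset cyc_orthogonal half_turn_orthogonal tetrahedral_vectors_invariant p)+
  qed
  have cubic: "defect (monomial 1 1 1) = 0"
  proof (rule defect_eq_0)
    show "monomial 1 1 1 x = - 1 / (3 * sqrt 3)" if "x \<in> dual_tetrahedron" for x
      using that by (auto simp: dual_tetrahedron_eq tetrahedral_vectors_def monomial_def)
    show "arc_integral x y (monomial 1 1 1) = 2 * sqrt 2 / (9 * sqrt 3)"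
      if "x \<in> tetrahedron" "y \<in> tetrahedron" "x \<bullet> y = - 1 / 3" for x y
      using that by (rule cubic_edge_tetrahedron)
    have "4 / (4 + 3 * sqrt 2 * \<theta>) * (- 1 / (3 * sqrt 3)) +
        (1 - 4 / (4 + 3 * sqrt 2 * \<theta>)) * (2 * sqrt 2 / (9 * sqrt 3) / \<theta>) = 0"
      by (rule balance_quotient) (use \<theta> D in \<open>simp_all add: field_simps\<close>)
    also have "0 = integral\<^sup>L sphere_measure (monomial 1 1 1)"
      by (subst sphere.L_monomial_odd) simp_all
    finally show "4 / (4 + 3 * sqrt 2 * \<theta>) * (- 1 / (3 * sqrt 3)) +
        (1 - 4 / (4 + 3 * sqrt 2 * \<theta>)) * (2 * sqrt 2 / (9 * sqrt 3) / arccos (- 1 / 3)) =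
        integral\<^sup>L sphere_measure (monomial 1 1 1)"
      by (simp only: \<theta>_def)
  qed
  have "hybrid_design 3 (4 / (4 + 3 * sqrt 2 * \<theta>)) \<gamma> dual_tetrahedron"
    by (rule hybrid_design[OF assms[unfolded tetrahedron_edges_eq]]) (rule D.L_Pol_3_eq_0[OF defect_1 cubic])
  thus ?thesis by (simp only: \<theta>_def)
qed

section \<open>The seven hybrid designs\<close>

theorem theorem4p4:
  shows
    "(\<forall>\<gamma>. induced_cycle tetrahedron tetrahedron_edges \<gamma> \<longrightarrow>
        hybrid_design 3 (4 / (4 + 3 * sqrt 2 * arccos (- 1 / 3))) \<gamma> dual_tetrahedron) \<and>
     (\<forall>\<gamma>. induced_cycle octahedron octahedron_edges \<gamma> \<longrightarrow>
        hybrid_design 5 (9 / 25) \<gamma> cube) \<and>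
     (\<forall>\<gamma>. induced_cycle cube cube_edges \<gamma> \<longrightarrow>
        hybrid_design 5
          ((10 * sqrt 2 + 3 * arccos (1 / 3)) / (10 * sqrt 2 + 35 * arccos (1 / 3)))
          \<gamma> octahedron) \<and>
     (\<forall>\<gamma>. induced_cycle rhombic_dodecahedron rhombic_dodecahedron_edges \<gamma> \<longrightarrow>
        hybrid_design 5
          ((10 - 3 * sqrt 2 * arccos (1 / sqrt 3)) / (10 + 5 * sqrt 2 * arccos (1 / sqrt 3)))
          \<gamma> cuboctahedron) \<and>
     (\<forall>\<gamma>. induced_cycle dodecahedron dodecahedron_edges \<gamma> \<longrightarrow>
        hybrid_design 9
          ((1190 * sqrt 5 - 675 * arccos (sqrt 5 / 3)) / (1190 * sqrt 5 + 6237 * arccos (sqrt 5 / 3)))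
          \<gamma> icosahedron) \<and>
     (\<forall>\<gamma>. induced_cycle icosahedron icosahedron_edges \<gamma> \<longrightarrow>
        hybrid_design 9
          ((126 + 45 * arccos (1 / sqrt 5)) / (126 + 301 * arccos (1 / sqrt 5)))
          \<gamma> dodecahedron) \<and>
     (\<forall>\<gamma>. induced_cycle rhombic_triacontahedron rhombic_triacontahedron_edges \<gamma> \<longrightarrow>
        (let \<theta> = arccos (sqrt (1 / 3 + 2 / (3 * sqrt 5))) in
          hybrid_design 9
            ((7 * (17 * sqrt 5 - 27) + 135 * \<theta>) / (7 * (17 * sqrt 5 - 27) + 567 * \<theta>))
            \<gamma> icosidodecahedron))"
  unfolding Let_def
  by (intro conjI allI impI tetrahedron_dual_tetrahedron_design octahedron_cube_design
      cube_octahedron_design rhombic_dodecahedron_cuboctahedron_design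
      dodecahedron_icosahedron_design icosahedron_dodecahedron_design
      rhombic_triacontahedron_icosidodecahedron_design)

end
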